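(* Let $U:\mathbb{R}^d\to\mathbb{R}^+$ with $\int e^{-U}<\infty$, let $\pi(d\mathbf{x})\propto e^{-U(\mathbf{x})}d\mathbf{x}$, let $\lambda^{\mathrm{ref}}>0$, and consider the Coordinate Sampler process with invariant distribution $\rho=\pi\otimes\varphi$ (defined in the context). Assume: (A.1) each second partial derivative $\frac{\partial^2 U}{\partial x_i\partial x_j}$ is locally Lipschitz continuous; (A.2) $\int |\nabla U(\mathbf{x})|\,\pi(d\mathbf{x})<\infty$; (A.3) $\liminf_{|\mathbf{x}|\to\infty} e^{U(\mathbf{x})/2}/\sqrt{|\nabla U(\mathbf{x})|}>0$; (A.4) $V\ge c_0$ on $\mathbb{R}^d\times\mathcal{V}$ for some constant $c_0>0$, where $V(\mathbf{x},\mathbf{v})=e^{U(\mathbf{x})/2}\big/\sqrt{\lambda^{\mathrm{ref}}+\langle\nabla U(\mathbf{x}),-\mathbf{v}\rangle_+}$. Assume moreover that one of the following holds: (C.1) $\liminf_{|\mathbf{x}|\to\infty}|\nabla U(\mathbf{x})|=\infty$, $\limsup_{|\mathbf{x}|\to\infty}\|\Delta U(\mathbf{x})\|\le\alpha_1<\infty$, and $\lambda^{\mathrm{ref}}>\sqrt{8\alpha_1}$; (C.2) $\liminf_{|\mathbf{x}|\to\infty}|\nabla U(\mathbf{x})|=2\alpha_2>0$, $\limsup_{|\mathbf{x}|\to\infty}\|\Delta U(\mathbf{x})\|=0$, and $\lambda^{\mathrm{ref}}<\frac{\alpha_2}{14d}$. Then the Coordinate Sampler is $V$-uniformly ergodic: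 there exist constants $\Gamma<\infty$ and $0<\gamma<1$ such that for all $\mathbf{z}\in\mathbb{R}^d\times\mathcal{V}$ and all $t\ge0$, $\|P^t(\mathbf{z},\cdot)-\rho\|_V\le V(\mathbf{z})\,\Gamma\,\gamma^t$.
   Context: Let $e_1,\dots,e_d$ be the standard basis of $\mathbb{R}^d$ and $\mathcal{V}=\{\pm e_i: i=1,\dots,d\}$; $\varphi$ denotes the uniform distribution on $\mathcal{V}$ and $\rho(d\mathbf{x},d\mathbf{v})=\pi(d\mathbf{x})\varphi(d\mathbf{v})$. For $a\in\mathbb{R}$, $a_+=\max(a,0)$. The Coordinate Sampler is the piecewise deterministic Markov process $\mathbf{Z}_t=(\mathbf{X}_t,\mathbf{V}_t)$ on $\mathbb{R}^d\times\mathcal{V}$ with: (i) deterministic dynamic between events $\frac{d\mathbf{X}_t}{dt}=\mathbf{V}_t$, $\frac{d\mathbf{V}_t}{dt}=0$; (ii) event rate $\lambda(\mathbf{X}_t,\mathbf{V}_t)$ with $\lambda(\mathbf{x},\mathbf{v})=\langle\mathbf{v},\nabla U(\mathbf{x})\rangle_++\lambda^{\mathrm{ref}}$; (iii) at an event with pre-event state $(\mathbf{x},\mathbf{v})$, the position is kept and the new velocity is $\mathbf{v}^*\in\mathcal{V}$ with probability $\lambda(\mathbf{x},-\mathbf{v}^* )/\lambda(\mathbf{x})$, where $\lambda(\mathbf{x})=\sum_{\mathbf{w}\in\mathcal{V}}\lambda(\mathbf{x},\mathbf{w})=2d\lambda^{\mathrm{ref}}+\sum_{i=1}^d|\partial U(\mathbf{x})/\partial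 x_i|$. $P^t(\mathbf{z},\cdot)$ is the law at time $t$ of this process started at $\mathbf{z}$. For a signed measure $\mu$, $\|\mu\|_V=\sup_{|f|<V}\int f(\mathbf{z})\,\mu(d\mathbf{z})$ (supremum over measurable $f$ with $|f|<V$). $\Delta U(\mathbf{x})$ denotes the Hessian matrix $\left(\frac{\partial^2 U(\mathbf{x})}{\partial x_i\partial x_j}\right)_{i,j}$ and $\|\cdot\|$ a matrix (operator) norm; $|\cdot|$ is the Euclidean norm. *)

theory Defs
  imports "HOL-Analysis.Analysis" "HOL-Probability.Probability"
begin

type_synonym 'd state = "(real^'d) \<times> (real^'d)"

definition Vset :: "(real^'d) set" where
  "Vset = {axis i 1 | i. True} \<union> {axis i (-1) | i. True}"

definition rate :: "(real^'d \<Rightarrow> real^'d) \<Rightarrow> real \<Rightarrow> real^'d \<Rightarrow> real^'d \<Rightarrow> real" where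
  "rate gU lr x v = max 0 (v \<bullet> gU x) + lr"

definition total_rate :: "(real^'d \<Rightarrow> real^'d) \<Rightarrow> real \<Rightarrow> real^'d \<Rightarrow> real" where
  "total_rate gU lr x = (\<Sum>w\<in>Vset. rate gU lr x w)"

definition cum_rate :: "(real^'d \<Rightarrow> real^'d) \<Rightarrow> real \<Rightarrow> real^'d \<Rightarrow> real^'d \<Rightarrow> real \<Rightarrow> real" where
  "cum_rate gU lr x v s = integral {0..s} (\<lambda>r. rate gU lr (x + r *\<^sub>R v) v)"

text \<open>Contribution of trajectories with exactly n events in [0,t], acting on
  nonnegative test functions (standard construction of a PDMP law).\<close>
fun Qk :: "(real^'d \<Rightarrow> real^'d) \<Rightarrow> real \<Rightarrow> nat \<Rightarrow> real \<Rightarrow> ('d state \<Rightarrow> ennreal) \<Rightarrow> 'd state \<Rightarrow> ennreal" where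
  "Qk gU lr 0 t f (x, v) = ennreal (exp (- cum_rate gU lr x v t)) * f (x + t *\<^sub>R v, v)"
| "Qk gU lr (Suc n) t f (x, v) =
     (\<integral>\<^sup>+ s. indicator {0..t} s *
        ennreal (rate gU lr (x + s *\<^sub>R v) v * exp (- cum_rate gU lr x v s)) *
        (\<Sum>w\<in>Vset. ennreal (rate gU lr (x + s *\<^sub>R v) (- w) / total_rate gU lr (x + s *\<^sub>R v)) *
            Qk gU lr n (t - s) f (x + s *\<^sub>R v, w)) \<partial>lborel)"

definition CS_kernel :: "(real^'d \<Rightarrow> real^'d) \<Rightarrow> real \<Rightarrow> real \<Rightarrow> 'd state \<Rightarrow> 'd state measure" where
  "CS_kernel gU lr t z =
     measure_of UNIV (sets borel) (\<lambda>A. \<Sum>n. Qk gU lr n t (indicator A) z)"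

definition pi_U :: "(real^'d \<Rightarrow> real) \<Rightarrow> (real^'d) measure" where
  "pi_U U = density lborel (\<lambda>x. ennreal (exp (- U x) / (\<integral>y. exp (- U y) \<partial>lborel)))"

definition rho_U :: "(real^'d \<Rightarrow> real) \<Rightarrow> 'd state measure" where
  "rho_U U = measure_of UNIV (sets borel)
     (\<lambda>A. \<Sum>w\<in>Vset. ennreal (1 / real (card (Vset :: (real^'d) set))) *
            emeasure (pi_U U) {x. (x, w) \<in> A})"

definition Vfun :: "(real^'d \<Rightarrow> real) \<Rightarrow> (real^'d \<Rightarrow> real^'d) \<Rightarrow> real \<Rightarrow> 'd state \<Rightarrow> real" where
  "Vfun U gU lr z = exp (U (fst z) / 2) / sqrt (lr + max 0 (gU (fst z) \<bullet> (- snd z)))"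

definition Vnorm :: "('a::topological_space \<Rightarrow> real) \<Rightarrow> 'a measure \<Rightarrow> 'a measure \<Rightarrow> ereal" where
  "Vnorm V M N = (SUP f \<in> {f. f \<in> borel_measurable borel \<and> (\<forall>z. \<bar>f z\<bar> < V z)}.
      (if integrable M f \<and> integrable N f then ereal ((\<integral>z. f z \<partial>M) - (\<integral>z. f z \<partial>N)) else \<infinity>))"

end

theory Submission
  imports Defs
begin

text \<open>
  Writing \<open>Q n t\<close> for the contribution of \<open>n\<close> events, the recursion at the first event gives the
  semigroup property, and bounded rates on balls exclude explosion. Since the jump flux from \<open>v\<close> to
  \<open>w\<close> equals that from \<open>- w\<close> to \<open>- v\<close>, and a free flight from \<open>x\<close> to \<open>x + t v\<close> has the same weight
  under \<open>exp (- U)\<close> as the flight back, the process is skew-reversible; conservation of mass then makes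
  \<open>\<rho>\<close> invariant. The function \<open>V\<close> satisfies \<open>L V \<le> - (lr / 2) V + C\<close> for the generator \<open>L\<close>, which is
  integrated through the minimality of the semigroup among supersolutions of its renewal equation, so
  that only one-sided derivatives of \<open>V\<close> along the flow are needed. Sublevel sets of \<open>V\<close> are bounded,
  and bounded sets are small because two events suffice to spread one coordinate. Harris' theorem in
  the form of Hairer and Mattingly concludes. Both (C.1) and (C.2) enter only through
  \<open>\<bar>\<nabla>U\<bar> > 27 d lr\<close> and a Hessian of norm below \<open>lr\<^sup>2 / 4\<close> far away.
\<close>

section \<open>Velocities and event rates\<close>

text \<open>The process is known only through its event expansion, with no path space, so each
  property is proved for a fixed number of events in \<open>ennreal\<close>, where Tonelli applies,
  and then summed. The price is joint measurability in state, time and a parameter of the test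
  function. The kernel is also defined at velocities outside \<open>Vset\<close>; all estimates
  concern velocities in \<open>Vset\<close>. The denominator of \<open>V\<close> has a kink where
  the gradient is orthogonal to the velocity; hence the one-sided derivatives. The minorization time
  depends on the sublevel set, and the sublevel set has to be chosen from the drift constant. The
  circle is broken by keeping the drift bound in the form
  \<open>\<delta> V + C (1 - \<delta>)\<close>: the level \<open>2 C + 1\<close> works for every
  time. As to the thresholds, a total rate of at least \<open>29 d lr\<close> makes the mean of
  \<open>V\<close> after a jump at most a third of \<open>exp (U / 2) / sqrt lr\<close>, and a
  Hessian below \<open>lr^2 / 4\<close> costs at most \<open>lr / 8\<close>. Together these leave
  the decay rate \<open>lr / 2\<close>.\<close>

lemma finite_Vset [simp]: "finite (Vset :: (real^'d) set)"
proof -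
  have "Vset = range (\<lambda>i::'d. axis i (1::real)) \<union> range (\<lambda>i. axis i (-1))"
    by (auto simp: Vset_def)
  thus ?thesis by (metis finite_UnI finite finite_imageI)
qed

lemma Vset_axis [simp]: "axis i 1 \<in> Vset" "axis i (-1) \<in> Vset"
  by (auto simp: Vset_def)

lemma minus_axis: "- axis i (x::real) = axis i (- x)"
  by (simp add: vec_eq_iff axis_def)

lemma Vset_uminus [simp]: "- w \<in> Vset \<longleftrightarrow> w \<in> Vset"
proof -
  have "- w \<in> Vset" if "w \<in> Vset" for w :: "real^'a"
    using that by (auto simp: Vset_def minus_axis)
  from this[of w] this[of "-w"] show ?thesis by auto
qed

lemma norm_Vset: "w \<in> Vset \<Longrightarrow> norm w = 1"
  by (auto simp: Vset_def norm_axis_1 minus_axis[of _ 1, symmetric])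

lemma sum_Vset_uminus: "(\<Sum>w\<in>Vset. f (- w)) = (\<Sum>w\<in>Vset. f w)"
  by (rule sum.reindex_bij_witness[of _ uminus uminus]) auto

lemma sum_Vset:
  fixes f :: "real^'d \<Rightarrow> 'a::comm_monoid_add"
  shows "(\<Sum>w\<in>Vset. f w) = (\<Sum>i\<in>UNIV. f (axis i 1) + f (axis i (-1)))"
proof -
  have V: "Vset = range (\<lambda>i::'d. axis i (1::real)) \<union> range (\<lambda>i. axis i (-1))"
    by (auto simp: Vset_def)
  have inj: "inj (\<lambda>i::'d. axis i (c::real))" if "c \<noteq> 0" for c
    using that by (auto intro!: injI simp: axis_eq_axis)
  have "(\<Sum>w\<in>Vset. f w) = sum f (range (\<lambda>i::'d. axis i 1)) + sum f (range (\<lambda>i. axis i (-1)))"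
    unfolding V by (rule sum.union_disjoint) (auto simp: axis_eq_axis)
  thus ?thesis using inj[of 1] inj[of "-1"] by (simp add: sum.reindex sum.distrib)
qed

lemma card_Vset: "card (Vset :: (real^'d) set) = 2 * CARD('d)"
proof -
  have "card (Vset :: (real^'d) set) = (\<Sum>w\<in>(Vset :: (real^'d) set). 1)" by simp
  also have "\<dots> = 2 * CARD('d)" by (subst sum_Vset) simp
  finally show ?thesis .
qed

lemma Vset_nonempty: "(Vset :: (real^'d) set) \<noteq> {}"
  using Vset_axis(1) by blast

text \<open>Construction, conservation of mass and minorization use only the field
  \<open>gU\<close>; the potential, the target measure and the second-order bounds join in the later
  locales.\<close>

locale coordinate_sampler =
  fixes gU :: "real^'d \<Rightarrow> real^'d" and lr :: real
  assumes gU_cont: "continuous_on UNIV gU" and lr_pos: "lr > 0"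
begin

lemma gU_measurable [measurable]: "gU \<in> borel_measurable borel"
  using gU_cont by (rule borel_measurable_continuous_onI)

lemma rate_ge: "rate gU lr x v \<ge> lr" and rate_pos: "rate gU lr x v > 0"
  using lr_pos by (auto simp: rate_def)

lemma rate_measurable [measurable (raw)]:
  assumes [measurable]: "f \<in> borel_measurable M" "g \<in> borel_measurable M"
  shows "(\<lambda>z. rate gU lr (f z) (g z)) \<in> borel_measurable M"
  unfolding rate_def by measurable

lemma total_rate_measurable [measurable (raw)]:
  assumes [measurable]: "f \<in> borel_measurable M"
  shows "(\<lambda>z. total_rate gU lr (f z)) \<in> borel_measurable M"
  unfolding total_rate_def by measurable

lemma rate_continuous [continuous_intros]:
  assumes "continuous_on S f" "continuous_on S g"
  shows "continuous_on S (\<lambda>z. rate gU lr (f z) (g z))"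
  unfolding rate_def
  by (intro continuous_intros assms continuous_on_compose2[OF gU_cont]) auto

lemma total_rate_continuous [continuous_intros]:
  assumes "continuous_on S f"
  shows "continuous_on S (\<lambda>z. total_rate gU lr (f z))"
  unfolding total_rate_def by (intro continuous_intros assms)

lemma total_rate_ge: "total_rate gU lr x \<ge> 2 * real CARD('d) * lr"
proof -
  have "total_rate gU lr x \<ge> (\<Sum>w\<in>(Vset :: (real^'d) set). lr)"
    unfolding total_rate_def by (intro sum_mono rate_ge)
  thus ?thesis by (simp add: card_Vset)
qed

lemma total_rate_pos: "total_rate gU lr x > 0"
  using total_rate_ge[of x] lr_pos
  by (smt (verit) mult_pos_pos of_nat_0_less_iff zero_less_card_finite)

lemma sum_rate_uminus: "(\<Sum>w\<in>Vset. rate gU lr x (- w)) = total_rate gU lr x"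
  unfolding total_rate_def by (rule sum_Vset_uminus)

lemma rate_path_continuous: "continuous_on S (\<lambda>r. rate gU lr (x + r *\<^sub>R v) v)"
  by (intro continuous_intros)

text \<open>The gauge integral of the definition becomes a Lebesgue integral, because measurability
  of \<open>cum_rate\<close> in all its arguments then follows from that of parameter
  integrals.\<close>

lemma cum_rate_eq:
  "cum_rate gU lr x v s = (LBINT r:{0..s}. rate gU lr (x + r *\<^sub>R v) v)"
  unfolding cum_rate_def
  by (rule set_borel_integral_eq_integral(2)[symmetric])
     (rule borel_integrable_atLeastAtMost', rule rate_path_continuous)

lemma cum_rate_measurable [measurable (raw)]:
  assumes [measurable]: "f \<in> borel_measurable M" "g \<in> borel_measurable M" "h \<in> borel_measurable M"
  shows "(\<lambda>z. cum_rate gU lr (f z) (g z) (h z)) \<in> borel_measurable M"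
  unfolding cum_rate_eq set_lebesgue_integral_def indicator_def atLeastAtMost_iff by measurable

lemma cum_rate_0 [simp]: "cum_rate gU lr x v 0 = 0"
  by (simp add: cum_rate_def)

lemma cum_rate_nonneg: "cum_rate gU lr x v s \<ge> 0"
  unfolding cum_rate_def
  by (intro integral_nonneg integrable_continuous_real rate_path_continuous less_imp_le[OF rate_pos])

lemma cum_rate_add:
  assumes "s \<ge> 0" "t \<ge> 0"
  shows "cum_rate gU lr x v (s + t) = cum_rate gU lr x v s + cum_rate gU lr (x + s *\<^sub>R v) v t"
proof -
  have "integral {0..s+t} (\<lambda>r. rate gU lr (x + r *\<^sub>R v) v) =
        integral {0..s} (\<lambda>r. rate gU lr (x + r *\<^sub>R v) v) +
        integral {s..s+t} (\<lambda>r. rate gU lr (x + r *\<^sub>R v) v)"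
    using assms
    by (intro Henstock_Kurzweil_Integration.integral_combine[symmetric]
          integrable_continuous_real rate_path_continuous) auto
  moreover have "integral {s..s+t} (\<lambda>r. rate gU lr (x + r *\<^sub>R v) v) =
      integral {0..t} (\<lambda>r. rate gU lr (x + (r + s) *\<^sub>R v) v)"
    using integral_shift_Icc_real[of 0 t "\<lambda>r. rate gU lr (x + r *\<^sub>R v) v" s]
    by (simp add: o_def add.commute)
  ultimately show ?thesis
    by (simp add: cum_rate_def algebra_simps)
qed

lemma cum_rate_has_deriv:
  assumes "0 \<le> s" "s \<le> t"
  shows "(cum_rate gU lr x v has_real_derivative rate gU lr (x + s *\<^sub>R v) v) (at s within {0..t})"
  unfolding cum_rate_def
  by (rule integral_has_real_derivative) (use assms rate_path_continuous in auto)

lemma cum_rate_le: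
  assumes "0 \<le> s" "\<And>r. 0 \<le> r \<Longrightarrow> r \<le> s \<Longrightarrow> rate gU lr (x + r *\<^sub>R v) v \<le> M"
  shows "cum_rate gU lr x v s \<le> M * s"
proof -
  have "cum_rate gU lr x v s \<le> integral {0..s} (\<lambda>_. M)"
    unfolding cum_rate_def
    by (intro integral_le integrable_continuous_real rate_path_continuous) (use assms in auto)
  thus ?thesis using assms(1) by (simp add: mult.commute)
qed

text \<open>The gain part of the generator: event rate and jump probability merged into one
  coefficient, of total mass \<open>rate\<close> rather than one. The merged form is what time
  reversal leaves symmetric and what makes the recursion a composition of operators.\<close>

definition jump_op :: "('d state \<Rightarrow> ennreal) \<Rightarrow> 'd state \<Rightarrow> ennreal" where
  "jump_op f = (\<lambda>(x, v). \<Sum>w\<in>Vset.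
     ennreal (rate gU lr x v * rate gU lr x (- w) / total_rate gU lr x) * f (x, w))"

lemma Qk_0: "Qk gU lr 0 t f z =
    ennreal (exp (- cum_rate gU lr (fst z) (snd z) t)) * f (fst z + t *\<^sub>R snd z, snd z)"
  by (cases z) simp

text \<open>Moving the event rate from the waiting-time density into \<open>jump_op\<close> leaves a
  flight \<open>Q 0 s\<close>, a jump and a remainder. The semigroup, duality and drift arguments
  rest on this form.\<close>

lemma Qk_Suc: "Qk gU lr (Suc n) t f z =
   (\<integral>\<^sup>+ s. indicator {0..t} s * Qk gU lr 0 s (jump_op (Qk gU lr n (t - s) f)) z \<partial>lborel)"
proof (cases z)
  case (Pair x v)
  have *: "ennreal (a * b) * (\<Sum>w\<in>Vset. ennreal (r w / c) * F w) =
      ennreal b * (\<Sum>w\<in>Vset. ennreal (a * r w / c) * F w)"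
    if "a \<ge> 0" "b \<ge> 0" "\<And>w. r w \<ge> 0" "c > 0" for a b c and r :: "real^'d \<Rightarrow> real" and F
    using that
    by (simp add: sum_distrib_left ennreal_mult[symmetric] mult.assoc[symmetric])
       (intro sum.cong refl arg_cong2[where f="(*)"] arg_cong[where f=ennreal], auto)
  show ?thesis unfolding Pair Qk.simps jump_op_def prod.case mult.assoc
    by (intro nn_integral_cong arg_cong[where f="(*) (indicator {0..t} s)" for s] *)
       (auto intro: less_imp_le rate_pos total_rate_pos)
qed

declare Qk.simps [simp del]

lemma jump_op_measurable:
  assumes [measurable]: "(\<lambda>(p,z). F p z) \<in> borel_measurable (N \<Otimes>\<^sub>M borel)"
  shows "(\<lambda>(p,z). jump_op (F p) z) \<in> borel_measurable (N \<Otimes>\<^sub>M borel)"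
  unfolding jump_op_def borel_prod[symmetric] case_prod_beta
  using assms unfolding borel_prod[symmetric] by measurable

text \<open>The induction needs joint measurability, since the recursion integrates over a time that
  also shifts the position. The parameter \<open>p\<close> allows test functions that depend on an
  integration variable, as in \<open>jump_op (Q n (t - s) f)\<close>.\<close>

lemma Qk_measurable:
  fixes F :: "'p \<Rightarrow> 'd state \<Rightarrow> ennreal"
  assumes F [measurable]: "(\<lambda>(p,z). F p z) \<in> borel_measurable (N \<Otimes>\<^sub>M borel)"
  shows "(\<lambda>(p,t,x,v). Qk gU lr n t (F p) (x,v)) \<in>
    borel_measurable (N \<Otimes>\<^sub>M (borel :: real measure) \<Otimes>\<^sub>M (borel :: (real^'d) measure) \<Otimes>\<^sub>M borel)"
proof (induction n)
  case 0
  have F' [measurable]: "(\<lambda>(p,z). F p z) \<in> borel_measurable (N \<Otimes>\<^sub>M borel \<Otimes>\<^sub>M borel)"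
    using F by (simp add: borel_prod)
  show ?case unfolding Qk.simps case_prod_beta by measurable
next
  case (Suc n)
  let ?M = "(N \<Otimes>\<^sub>M (borel :: real measure) \<Otimes>\<^sub>M (borel :: (real^'d) measure) \<Otimes>\<^sub>M (borel :: (real^'d) measure)) \<Otimes>\<^sub>M lborel"
  have IH: "(\<lambda>(y, s). Qk gU lr n (fst (snd y) - s) (F (fst y))
      (fst (snd (snd y)) + s *\<^sub>R snd (snd (snd y)), w)) \<in> borel_measurable ?M" for w
  proof -
    have "(\<lambda>y. (fst (fst y), fst (snd (fst y)) - snd y, fst (snd (snd (fst y))) + snd y *\<^sub>R snd (snd (snd (fst y))), w))
       \<in> ?M \<rightarrow>\<^sub>M N \<Otimes>\<^sub>M borel \<Otimes>\<^sub>M borel \<Otimes>\<^sub>M borel"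
      by measurable
    from measurable_compose[OF this Suc.IH] show ?thesis
      by (simp add: case_prod_beta)
  qed
  show ?case unfolding Qk.simps case_prod_beta indicator_def atLeastAtMost_iff
    by (intro lborel.borel_measurable_nn_integral)
       (unfold case_prod_beta, intro borel_measurable_times_ennreal borel_measurable_sum
         IH[unfolded case_prod_beta], measurable)
qed

lemma Qk_measurable_comp:
  fixes F :: "'p \<Rightarrow> 'd state \<Rightarrow> ennreal"
  assumes F: "(\<lambda>(p,z). F p z) \<in> borel_measurable (N \<Otimes>\<^sub>M borel)"
    and [measurable]: "p \<in> measurable M N" "t \<in> borel_measurable M" "x \<in> borel_measurable M" "v \<in> borel_measurable M"
  shows "(\<lambda>y. Qk gU lr n (t y) (F (p y)) (x y, v y)) \<in> borel_measurable M"
proof -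
  note [measurable] = Qk_measurable[OF F, of n]
  have "(\<lambda>y. (\<lambda>(p,t,x,v). Qk gU lr n t (F p) (x,v)) (p y, t y, x y, v y)) \<in> borel_measurable M"
    by measurable
  thus ?thesis by simp
qed

text \<open>One commutation statement for all sigma-finite \<open>N\<close>: Lebesgue measure gives
  the renewal integrals and the layer cake formula, counting measure gives countable
  additivity.\<close>

lemma Qk_nn_integral:
  fixes F :: "'p \<Rightarrow> 'd state \<Rightarrow> ennreal"
  assumes F: "(\<lambda>(p,z). F p z) \<in> borel_measurable (N \<Otimes>\<^sub>M borel)" and N: "sigma_finite_measure N"
  shows "Qk gU lr n t (\<lambda>z. \<integral>\<^sup>+ p. F p z \<partial>N) z0 = (\<integral>\<^sup>+ p. Qk gU lr n t (F p) z0 \<partial>N)"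
proof (induction n arbitrary: t z0)
  case 0
  have [measurable]: "(\<lambda>p. F p z) \<in> borel_measurable N" for z
    using measurable_compose[OF _ F, of "\<lambda>p. (p, z)" N] by simp
  show ?case unfolding Qk_0 by (subst nn_integral_cmult) auto
next
  case (Suc n)
  obtain x v where z0: "z0 = (x,v)" by (cases z0)
  interpret N: sigma_finite_measure N by fact
  interpret pair_sigma_finite lborel N ..
  let ?r = "\<lambda>s. indicator {0..t} s *
        ennreal (rate gU lr (x + s *\<^sub>R v) v * exp (- cum_rate gU lr x v s)) :: ennreal"
  let ?p = "\<lambda>s w. ennreal (rate gU lr (x + s *\<^sub>R v) (- w) / total_rate gU lr (x + s *\<^sub>R v))"
  let ?G = "\<lambda>s p. ?r s * (\<Sum>w\<in>Vset. ?p s w * Qk gU lr n (t - s) (F p) (x + s *\<^sub>R v, w))"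
  have m: "(\<lambda>(s,p). ?r s * (\<Sum>w\<in>Vset. ?p s w * Qk gU lr n (t - s) (F p) (x + s *\<^sub>R v, w))) \<in> borel_measurable (lborel \<Otimes>\<^sub>M N)"
    unfolding case_prod_beta
    by (intro borel_measurable_times_ennreal borel_measurable_sum Qk_measurable_comp[OF F]) measurable
  have m1: "(\<lambda>p. Qk gU lr n (t - s) (F p) (x + s *\<^sub>R v, w)) \<in> borel_measurable N" for s w
    by (intro Qk_measurable_comp[OF F]) measurable
  have "Qk gU lr (Suc n) t (\<lambda>z. \<integral>\<^sup>+ p. F p z \<partial>N) z0 = (\<integral>\<^sup>+ s. (\<integral>\<^sup>+ p. ?G s p \<partial>N) \<partial>lborel)"
    unfolding z0 Qk.simps Suc.IH
  proof (intro nn_integral_cong)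
    fix s :: real
    have "(\<integral>\<^sup>+ p. ?G s p \<partial>N) =
        ?r s * (\<integral>\<^sup>+ p. (\<Sum>w\<in>Vset. ?p s w * Qk gU lr n (t - s) (F p) (x + s *\<^sub>R v, w)) \<partial>N)"
      by (intro nn_integral_cmult borel_measurable_sum borel_measurable_times_ennreal m1) auto
    also have "(\<integral>\<^sup>+ p. (\<Sum>w\<in>Vset. ?p s w * Qk gU lr n (t - s) (F p) (x + s *\<^sub>R v, w)) \<partial>N) =
       (\<Sum>w\<in>Vset. (\<integral>\<^sup>+ p. ?p s w * Qk gU lr n (t - s) (F p) (x + s *\<^sub>R v, w) \<partial>N))"
      by (intro nn_integral_sum borel_measurable_times_ennreal m1) auto
    also have "\<dots> = (\<Sum>w\<in>Vset. ?p s w * (\<integral>\<^sup>+ p. Qk gU lr n (t - s) (F p) (x + s *\<^sub>R v, w) \<partial>N))"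
      by (intro sum.cong refl nn_integral_cmult m1)
    finally show "?r s * (\<Sum>w\<in>Vset. ?p s w * (\<integral>\<^sup>+ p. Qk gU lr n (t - s) (F p) (x + s *\<^sub>R v, w) \<partial>N)) =
       (\<integral>\<^sup>+ p. ?G s p \<partial>N)" by simp
  qed
  also have "\<dots> = (\<integral>\<^sup>+ p. (\<integral>\<^sup>+ s. ?G s p \<partial>lborel) \<partial>N)"
    using Fubini'[OF m] by simp
  finally show ?case unfolding z0 Qk.simps .
qed

end

section \<open>The semigroup\<close>

text \<open>Padding the inner sum with zeros turns the triangle into a full double series; Tonelli
  for counting measures swaps the sums, and the shift \<open>n = k + j\<close> removes the
  padding.\<close>

lemma suminf_ennreal_Cauchy:
  fixes a :: "nat \<Rightarrow> nat \<Rightarrow> ennreal"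
  shows "(\<Sum>n. \<Sum>k\<le>n. a k (n - k)) = (\<Sum>k. \<Sum>j. a k j)"
proof -
  have sf: "sigma_finite_measure (count_space (UNIV :: nat set))"
    by (rule sigma_finite_measure_count_space)
  interpret pair_sigma_finite "count_space (UNIV :: nat set)" "count_space (UNIV :: nat set)"
    using sf by (simp add: pair_sigma_finite_def)
  let ?b = "\<lambda>n k. if k \<le> n then a k (n - k) else 0"
  have fin: "(\<Sum>k\<le>n. a k (n - k)) = (\<Sum>k. ?b n k)" for n
    by (subst suminf_finite[of "{..n}"]) auto
  have "(\<Sum>n. \<Sum>k. ?b n k) = (\<Sum>k. \<Sum>n. ?b n k)"
    using Fubini'[of "\<lambda>n k. ?b k n"]
    by (simp add: nn_integral_count_space_nat pair_measure_countable)
  moreover have "(\<Sum>n. ?b n k) = (\<Sum>j. a k j)" for k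
    using suminf_offset[of "\<lambda>n. ?b n k" k] by simp
  ultimately show ?thesis by (simp add: fin)
qed

lemma borel_measurable_fst_borel:
  "(fst :: 'a::second_countable_topology \<times> 'b::second_countable_topology \<Rightarrow> 'a) \<in> borel \<rightarrow>\<^sub>M borel"
  unfolding borel_prod[symmetric] by (rule measurable_fst)

lemma borel_measurable_snd_borel:
  "(snd :: 'a::second_countable_topology \<times> 'b::second_countable_topology \<Rightarrow> 'b) \<in> borel \<rightarrow>\<^sub>M borel"
  unfolding borel_prod[symmetric] by (rule measurable_snd)

lemma sigma_finite_lborel: "sigma_finite_measure (lborel :: 'a::euclidean_space measure)" ..

context coordinate_sampler
begin

abbreviation "Q \<equiv> Qk gU lr"

lemma Qk_param:
  fixes F :: "'p \<Rightarrow> 'd state \<Rightarrow> ennreal"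
  assumes F: "(\<lambda>(p,z). F p z) \<in> borel_measurable (N \<Otimes>\<^sub>M borel)"
    and \<tau> [measurable]: "\<tau> \<in> borel_measurable N"
  shows "(\<lambda>(p,z). Q n (\<tau> p) (F p) z) \<in> borel_measurable (N \<Otimes>\<^sub>M borel)"
proof -
  note [measurable] = borel_measurable_fst_borel borel_measurable_snd_borel
  have "(\<lambda>y. Q n (\<tau> (fst y)) (F (fst y)) (fst (snd y), snd (snd y))) \<in> borel_measurable (N \<Otimes>\<^sub>M borel)"
    by (rule Qk_measurable_comp[OF F]) measurable
  thus ?thesis by (simp add: case_prod_beta)
qed

lemma Qk_param_sec:
  fixes F :: "'p \<Rightarrow> 'd state \<Rightarrow> ennreal"
  assumes F: "(\<lambda>(p,z). F p z) \<in> borel_measurable (N \<Otimes>\<^sub>M borel)"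
    and \<tau>: "\<tau> \<in> borel_measurable N"
  shows "(\<lambda>p. Q n (\<tau> p) (F p) z) \<in> borel_measurable N"
  using measurable_compose[OF _ Qk_param[OF F \<tau>], of "\<lambda>p. (p, z)" N] by simp

lemma param_const:
  "f \<in> borel_measurable borel \<Longrightarrow> (\<lambda>(p,z). f z) \<in> borel_measurable (N \<Otimes>\<^sub>M borel)"
  using measurable_compose[OF measurable_snd] by (simp add: case_prod_beta')

lemma param_sec:
  assumes "(\<lambda>(p,z). F p z) \<in> borel_measurable (N \<Otimes>\<^sub>M M)" "p \<in> space N"
  shows "F p \<in> borel_measurable M"
  using measurable_compose[OF measurable_Pair1'[OF assms(2), of M] assms(1)] by simp

lemma Qk_measurable_state [measurable]:
  assumes f: "f \<in> borel_measurable borel"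
  shows "Q n t f \<in> borel_measurable borel"
  using param_sec[OF Qk_param[OF param_const[OF f, of "borel :: real measure"], of "\<lambda>_. t" n], of 0] by simp

lemma jump_op_measurable_state [measurable]:
  assumes f: "f \<in> borel_measurable borel"
  shows "jump_op f \<in> borel_measurable borel"
  using param_sec[OF jump_op_measurable[OF param_const[OF f, of "borel :: real measure"]], of 0] by simp

lemma jump_op_nn_integral:
  assumes F: "(\<lambda>(p,z). F p z) \<in> borel_measurable (N \<Otimes>\<^sub>M borel)"
  shows "jump_op (\<lambda>z. \<integral>\<^sup>+ p. F p z \<partial>N) = (\<lambda>z. \<integral>\<^sup>+ p. jump_op (F p) z \<partial>N)"
proof (rule ext)
  fix z0
  have m: "(\<lambda>p. F p z) \<in> borel_measurable N" for z
    using measurable_compose[OF _ F, of "\<lambda>p. (p, z)" N] by simp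
  show "jump_op (\<lambda>z. \<integral>\<^sup>+ p. F p z \<partial>N) z0 = (\<integral>\<^sup>+ p. jump_op (F p) z0 \<partial>N)"
    unfolding jump_op_def case_prod_beta
    by (subst nn_integral_sum) (auto intro!: borel_measurable_times_ennreal m sum.cong nn_integral_cmult[symmetric])
qed

lemma jump_op_cmult: "jump_op (\<lambda>z. c * f z) = (\<lambda>z. c * jump_op f z)"
  by (simp add: fun_eq_iff jump_op_def case_prod_beta sum_distrib_left mult_ac)

lemma jump_op_sum: "jump_op (\<lambda>z. \<Sum>k\<in>A. F k z) = (\<lambda>z. \<Sum>k\<in>A. jump_op (F k) z)"
  unfolding jump_op_def case_prod_beta sum_distrib_left by (rule ext, rule sum.swap)

lemma jump_op_add: "jump_op (\<lambda>z. f z + g z) = (\<lambda>z. jump_op f z + jump_op g z)"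
  by (simp add: fun_eq_iff jump_op_def case_prod_beta distrib_left sum.distrib)

lemma jump_op_mono: "(\<And>w. w \<in> Vset \<Longrightarrow> f (fst z, w) \<le> g (fst z, w)) \<Longrightarrow> jump_op f z \<le> jump_op g z"
  unfolding jump_op_def case_prod_beta by (intro sum_mono mult_left_mono) auto

lemma jump_op_1: "jump_op (\<lambda>_. c) (x, v) = ennreal (rate gU lr x v) * c"
proof -
  have "jump_op (\<lambda>_. c) (x, v) =
      (\<Sum>w\<in>Vset. ennreal (rate gU lr x v * rate gU lr x (- w) / total_rate gU lr x)) * c"
    by (simp add: jump_op_def sum_distrib_right)
  also have "(\<Sum>w\<in>Vset. ennreal (rate gU lr x v * rate gU lr x (- w) / total_rate gU lr x)) =
     ennreal (\<Sum>w\<in>Vset. rate gU lr x v * rate gU lr x (- w) / total_rate gU lr x)"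
    by (intro sum_ennreal) (simp add: less_imp_le rate_pos total_rate_pos)
  also have "(\<Sum>w\<in>Vset. rate gU lr x v * rate gU lr x (- w) / total_rate gU lr x) = rate gU lr x v"
    using total_rate_pos[of x]
    by (simp add: sum_divide_distrib[symmetric] sum_distrib_left[symmetric] sum_rate_uminus)
  finally show ?thesis .
qed

lemma Q0_cmult: "Q 0 t (\<lambda>z. c * f z) z0 = c * Q 0 t f z0"
  by (simp add: Qk_0 mult_ac)

lemma Q0_sum: "Q 0 t (\<lambda>z. \<Sum>k\<in>A. F k z) z0 = (\<Sum>k\<in>A. Q 0 t (F k) z0)"
  by (simp add: Qk_0 sum_distrib_left)

lemma Q0_mono: "(\<And>x. f (x, snd z) \<le> g (x, snd z)) \<Longrightarrow> Q 0 t f z \<le> Q 0 t g z"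
  by (simp add: Qk_0 mult_left_mono)

lemma Q0_add_time:
  assumes "s \<ge> 0" "t \<ge> 0"
  shows "Q 0 (s + t) f z = Q 0 s (Q 0 t f) z"
proof -
  have "ennreal (exp (- cum_rate gU lr (fst z) (snd z) (s + t))) =
      ennreal (exp (- cum_rate gU lr (fst z) (snd z) s)) *
      ennreal (exp (- cum_rate gU lr (fst z + s *\<^sub>R snd z) (snd z) t))"
    unfolding cum_rate_add[OF assms] minus_add_distrib exp_add by (rule ennreal_mult) auto
  thus ?thesis
    by (simp add: Qk_0 scaleR_add_left add.assoc mult.assoc)
qed

text \<open>The split is according to the first event. If it falls in \<open>{0..s}\<close>,
  induction applies to the time left before \<open>s\<close>; if it falls later, the flight up to
  \<open>s\<close> is free and gives the summand \<open>k = 0\<close>.\<close>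

lemma Qk_add_time:
  assumes f: "f \<in> borel_measurable borel" and s: "s \<ge> 0" and t: "t \<ge> 0"
  shows "Q n (s + t) f z = (\<Sum>k\<le>n. Q k s (Q (n - k) t f) z)"
  using s
proof (induction n arbitrary: s z)
  case 0
  thus ?case using t by (simp add: Q0_add_time)
next
  case (Suc n)
  define h where "h = (\<lambda>r. Q 0 r (jump_op (Q n (s + t - r) f)) z)"
  have m: "(\<lambda>(r,z). jump_op (Q n (u - r) f) z) \<in> borel_measurable (lborel \<Otimes>\<^sub>M borel)" for u
    by (intro jump_op_measurable Qk_param param_const f) auto
  have hm [measurable]: "h \<in> borel_measurable borel"
    using Qk_param_sec[OF m, of "\<lambda>r. r" 0 "s + t"] by (simp add: h_def)
  have "Q (Suc n) (s + t) f z = (\<integral>\<^sup>+ r. indicator {0..s+t} r * h r \<partial>lborel)"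
    by (simp add: Qk_Suc h_def)
  also have "\<dots> = (\<integral>\<^sup>+ r. indicator {0..s} r * h r + indicator {s<..s+t} r * h r \<partial>lborel)"
    using \<open>s \<ge> 0\<close> t by (intro nn_integral_cong) (auto simp: indicator_def)
  also have "\<dots> = (\<integral>\<^sup>+ r. indicator {0..s} r * h r \<partial>lborel) + (\<integral>\<^sup>+ r. indicator {s<..s+t} r * h r \<partial>lborel)"
    by (rule nn_integral_add) auto
  also have "(\<integral>\<^sup>+ r. indicator {0..s} r * h r \<partial>lborel) =
      (\<integral>\<^sup>+ r. (\<Sum>k\<le>n. indicator {0..s} r * Q 0 r (jump_op (Q k (s - r) (Q (n - k) t f))) z) \<partial>lborel)"
  proof (intro nn_integral_cong)
    fix r :: real
    have "h r = (\<Sum>k\<le>n. Q 0 r (jump_op (Q k (s - r) (Q (n - k) t f))) z)" if "r \<in> {0..s}"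
    proof -
      have "s - r \<ge> 0" using that by simp
      hence IH: "Q n (s - r + t) f = (\<lambda>z. \<Sum>k\<le>n. Q k (s - r) (Q (n - k) t f) z)"
        by (intro ext Suc.IH)
      have eq: "s + t - r = s - r + t" by simp
      show ?thesis unfolding h_def eq IH jump_op_sum Q0_sum ..
    qed
    thus "indicator {0..s} r * h r = (\<Sum>k\<le>n. indicator {0..s} r * Q 0 r (jump_op (Q k (s - r) (Q (n - k) t f))) z)"
      by (auto simp: indicator_def sum_distrib_left)
  qed
  also have "\<dots> = (\<Sum>k\<le>n. Q (Suc k) s (Q (n - k) t f) z)"
    unfolding Qk_Suc
    by (intro nn_integral_sum borel_measurable_times_ennreal Qk_param_sec jump_op_measurable Qk_param param_const)
       (auto intro: Qk_measurable_state f)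
  also have "(\<integral>\<^sup>+ r. indicator {s<..s+t} r * h r \<partial>lborel) = (\<integral>\<^sup>+ r. indicator {0<..t} r * h (s + r) \<partial>lborel)"
    using nn_integral_real_affine[of "\<lambda>r. indicator {s<..s+t} r * h r" 1 s]
    by (simp add: indicator_def)
  \<comment> \<open>The half-open interval produced by the split differs from \<open>{0..t}\<close>
    by a null set.\<close>
  also have "\<dots> = (\<integral>\<^sup>+ r. indicator {0..t} r * h (s + r) \<partial>lborel)"
  proof (rule nn_integral_cong_AE)
    show "AE r in lborel. indicator {0<..t} r * h (s + r) = indicator {0..t} r * h (s + r)"
      using AE_lborel_singleton[of "0::real"] by eventually_elim (simp add: indicator_def)
  qed
  also have "\<dots> = (\<integral>\<^sup>+ r. Q 0 s (\<lambda>z. indicator {0..t} r * Q 0 r (jump_op (Q n (t - r) f)) z) z \<partial>lborel)"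
    using \<open>s \<ge> 0\<close>
    by (intro nn_integral_cong) (auto simp: indicator_def h_def Q0_add_time Qk_0[of _ "\<lambda>_. 0"])
  also have "\<dots> = Q 0 s (Q (Suc n) t f) z"
    unfolding Qk_Suc
    by (rule Qk_nn_integral[symmetric, OF _ sigma_finite_lborel])
       (use Qk_param[OF m, of "\<lambda>r. r" 0 t] in \<open>simp add: case_prod_beta\<close>)
  finally show ?case
    by (subst sum.atMost_Suc_shift) (simp add: add.commute)
qed

text \<open>Expansion at the last event instead of the first. Time reversal exchanges the two, so
  duality for \<open>Suc n\<close> events compares this form with \<open>Qk_Suc\<close>.\<close>

lemma Qk_Suc_last:
  assumes f: "f \<in> borel_measurable borel"
  shows "Q (Suc n) t f z = (\<integral>\<^sup>+ s. indicator {0..t} s * Q n s (jump_op (Q 0 (t - s) f)) z \<partial>lborel)"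
proof (induction n arbitrary: t z)
  case 0
  show ?case by (rule Qk_Suc)
next
  case (Suc n)
  define F where "F = (\<lambda>r. jump_op (Q 0 (t - r) f))"
  have F: "(\<lambda>(r,z). F r z) \<in> borel_measurable (lborel \<Otimes>\<^sub>M borel)"
    unfolding F_def by (intro jump_op_measurable Qk_param param_const f) auto
  \<comment> \<open>Indicators encode the triangle \<open>0 \<le> s \<le> u \<le> t\<close>, with
    \<open>s\<close> the first and \<open>u\<close> the last event time, so that Fubini applies on
    the whole plane.\<close>
  define G where "G = (\<lambda>s u. indicator {0..t} u * indicator {0..u} s * Q 0 s (jump_op (Q n (u - s) (F u))) z)"
  have F2: "(\<lambda>(p,z). F (snd p) z) \<in> borel_measurable ((lborel \<Otimes>\<^sub>M lborel) \<Otimes>\<^sub>M borel)"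
    using measurable_compose[OF _ F, of "\<lambda>y. (snd (fst y), snd y)" "(lborel \<Otimes>\<^sub>M lborel) \<Otimes>\<^sub>M borel"]
    by (simp add: case_prod_beta')
  have "(\<lambda>(p,z). jump_op (Q n (snd p - fst p) (F (snd p))) z)
      \<in> borel_measurable ((lborel \<Otimes>\<^sub>M lborel) \<Otimes>\<^sub>M borel)"
    by (intro jump_op_measurable Qk_param F2) auto
  note * = Qk_param_sec[OF this, of fst 0 z]
  have G [measurable]: "(\<lambda>(s,u). G s u) \<in> borel_measurable (lborel \<Otimes>\<^sub>M lborel)"
    unfolding G_def case_prod_beta
    by (intro borel_measurable_times_ennreal *) (auto simp: indicator_def)
  have G' [measurable]: "G s \<in> borel_measurable borel" for s
    using param_sec[OF G, of s] by simp
  have "Q (Suc (Suc n)) t f z = (\<integral>\<^sup>+ s. (\<integral>\<^sup>+ r. G s (s + r) \<partial>lborel) \<partial>lborel)"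
    unfolding Qk_Suc[of "Suc n"]
  proof (intro nn_integral_cong)
    fix s :: real
    have J: "(\<lambda>(r,z). indicator {0..t-s} r * Q n r (F (s + r)) z) \<in> borel_measurable (lborel \<Otimes>\<^sub>M borel)"
    proof -
      have "(\<lambda>(r,z). F (s + r) z) \<in> borel_measurable (lborel \<Otimes>\<^sub>M borel)"
        using measurable_compose[OF _ F, of "\<lambda>y. (s + fst y, snd y)" "lborel \<Otimes>\<^sub>M borel"]
        by (simp add: case_prod_beta)
      from Qk_param[OF this, of "\<lambda>r. r" n] show ?thesis
        by (simp add: case_prod_beta)
    qed
    have "Q (Suc n) (t - s) f = (\<lambda>z. \<integral>\<^sup>+ r. indicator {0..t-s} r * Q n r (F (s + r)) z \<partial>lborel)"
      by (rule ext) (simp add: Suc.IH F_def algebra_simps)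
    hence "Q 0 s (jump_op (Q (Suc n) (t - s) f)) z =
        (\<integral>\<^sup>+ r. Q 0 s (jump_op (\<lambda>z. indicator {0..t-s} r * Q n r (F (s + r)) z)) z \<partial>lborel)"
      using J by (simp add: jump_op_nn_integral jump_op_measurable Qk_nn_integral[OF _ sigma_finite_lborel])
    also have "\<dots> = (\<integral>\<^sup>+ r. indicator {0..t-s} r * Q 0 s (jump_op (Q n r (F (s + r)))) z \<partial>lborel)"
      by (simp only: jump_op_cmult Q0_cmult)
    finally have *: "Q 0 s (jump_op (Q (Suc n) (t - s) f)) z =
        (\<integral>\<^sup>+ r. indicator {0..t-s} r * Q 0 s (jump_op (Q n r (F (s + r)))) z \<partial>lborel)" .
    show "indicator {0..t} s * Q 0 s (jump_op (Q (Suc n) (t - s) f)) z = (\<integral>\<^sup>+ r. G s (s + r) \<partial>lborel)"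
    proof (cases "s \<in> {0..t}")
      case True
      hence "G s (s + r) = indicator {0..t-s} r * Q 0 s (jump_op (Q n r (F (s + r)))) z" for r
        by (auto simp: G_def indicator_def)
      thus ?thesis using True by (simp add: *)
    next
      case False
      hence "G s (s + r) = 0" for r by (auto simp: G_def indicator_def)
      thus ?thesis using False by simp
    qed
  qed
  also have "\<dots> = (\<integral>\<^sup>+ s. (\<integral>\<^sup>+ u. G s u \<partial>lborel) \<partial>lborel)"
    using nn_integral_real_affine[OF G', of 1] by simp
  also have "\<dots> = (\<integral>\<^sup>+ u. (\<integral>\<^sup>+ s. G s u \<partial>lborel) \<partial>lborel)"
    using lborel_pair.Fubini'[OF G] by simp
  also have "\<dots> = (\<integral>\<^sup>+ u. indicator {0..t} u * Q (Suc n) u (F u) z \<partial>lborel)"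
    unfolding Qk_Suc[of n] G_def
    by (intro nn_integral_cong) (auto simp: indicator_def intro!: nn_integral_cong)
  finally show ?case by (simp add: F_def)
qed

text \<open>As a sum in \<open>ennreal\<close> it exists for every nonnegative test function; that
  no mass is lost is a separate fact, \<open>PP_1\<close>.\<close>

definition PP :: "real \<Rightarrow> ('d state \<Rightarrow> ennreal) \<Rightarrow> 'd state \<Rightarrow> ennreal" where
  "PP t f z = (\<Sum>n. Q n t f z)"

lemma PP_nn_integral:
  fixes F :: "'p \<Rightarrow> 'd state \<Rightarrow> ennreal"
  assumes F: "(\<lambda>(p,z). F p z) \<in> borel_measurable (N \<Otimes>\<^sub>M borel)" and N: "sigma_finite_measure N"
  shows "PP t (\<lambda>z. \<integral>\<^sup>+ p. F p z \<partial>N) z0 = (\<integral>\<^sup>+ p. PP t (F p) z0 \<partial>N)"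
  unfolding PP_def Qk_nn_integral[OF F N]
  by (rule nn_integral_suminf[symmetric], rule Qk_param_sec[OF F]) auto

lemma Qk_suminf:
  fixes F :: "nat \<Rightarrow> 'd state \<Rightarrow> ennreal"
  assumes F: "\<And>i. F i \<in> borel_measurable borel"
  shows "Q n t (\<lambda>z. \<Sum>i. F i z) z0 = (\<Sum>i. Q n t (F i) z0)"
proof -
  have "(\<lambda>(p,z). F p z) \<in> borel_measurable (count_space UNIV \<Otimes>\<^sub>M borel)"
    using F by (auto intro!: measurable_pair_measure_countable1)
  from Qk_nn_integral[OF this sigma_finite_measure_count_space] show ?thesis
    by (simp add: nn_integral_count_space_nat)
qed

lemma PP_measurable [measurable]:
  assumes f: "f \<in> borel_measurable borel"
  shows "PP t f \<in> borel_measurable borel"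
  unfolding PP_def by (intro borel_measurable_suminf_order Qk_measurable_state f)

lemma PP_add_time:
  assumes f: "f \<in> borel_measurable borel" and "s \<ge> 0" "t \<ge> 0"
  shows "PP (s + t) f z = PP s (PP t f) z"
proof -
  have "PP (s + t) f z = (\<Sum>n. \<Sum>k\<le>n. Q k s (Q (n - k) t f) z)"
    using assms by (simp add: PP_def Qk_add_time)
  also have "\<dots> = (\<Sum>k. \<Sum>j. Q k s (Q j t f) z)"
    by (rule suminf_ennreal_Cauchy)
  also have "\<dots> = PP s (PP t f) z"
    unfolding PP_def by (subst Qk_suminf) (auto intro: Qk_measurable_state f)
  finally show ?thesis .
qed

section \<open>Renewal equation, minimality and conservation of mass\<close>

lemma sum_Qk_Suc:
  assumes f: "f \<in> borel_measurable borel"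
  shows "(\<Sum>k<Suc n. Q k t f z) = Q 0 t f z +
    (\<integral>\<^sup>+ s. indicator {0..t} s * Q 0 s (jump_op (\<lambda>z. \<Sum>k<n. Q k (t - s) f z)) z \<partial>lborel)"
proof -
  have "(\<Sum>k<n. Q (Suc k) t f z) =
      (\<integral>\<^sup>+ s. (\<Sum>k<n. indicator {0..t} s * Q 0 s (jump_op (Q k (t - s) f)) z) \<partial>lborel)"
    unfolding Qk_Suc
    by (intro nn_integral_sum[symmetric] borel_measurable_times_ennreal Qk_param_sec jump_op_measurable Qk_param param_const f)
       auto
  thus ?thesis
    unfolding sum.lessThan_Suc_shift o_def jump_op_sum Q0_sum sum_distrib_left by simp
qed

text \<open>The partial sums over event numbers are the Picard iterates of the renewal equation
  started at zero. The renewal operator is monotone, so all iterates stay below \<open>W\<close>,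
  and \<open>PP\<close> is their supremum.\<close>

lemma PP_le_supersolution:
  assumes f: "f \<in> borel_measurable borel" and v: "snd z \<in> Vset" and t: "t \<ge> 0"
    and super: "\<And>t z. t \<ge> 0 \<Longrightarrow> snd z \<in> Vset \<Longrightarrow>
      Q 0 t f z + (\<integral>\<^sup>+ s. indicator {0..t} s * Q 0 s (jump_op (W (t - s))) z \<partial>lborel) \<le> W t z"
  shows "PP t f z \<le> W t z"
proof -
  have "(\<Sum>k<n. Q k t f z) \<le> W t z" for n
    using v t
  proof (induction n arbitrary: t z)
    case (Suc n)
    have "(\<Sum>k<Suc n. Q k t f z) \<le> Q 0 t f z + (\<integral>\<^sup>+ s. indicator {0..t} s * Q 0 s (jump_op (W (t - s))) z \<partial>lborel)"
      unfolding sum_Qk_Suc[OF f] using Suc.IH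
      by (intro add_left_mono nn_integral_mono)
         (auto simp: indicator_def intro!: Q0_mono jump_op_mono)
    also have "\<dots> \<le> W t z" using Suc.prems by (intro super)
    finally show ?case .
  qed auto
  thus ?thesis unfolding PP_def suminf_eq_SUP by (auto intro!: SUP_least)
qed

text \<open>Either no event occurs up to \<open>t\<close>, or the first one has density
  \<open>rate * exp (- cum_rate)\<close>; hence the constant one is a fixed point of the renewal
  equation.\<close>

lemma exp_cum_rate_identity:
  assumes "t \<ge> 0"
  shows "Q 0 t (\<lambda>_. 1) z + (\<integral>\<^sup>+ s. indicator {0..t} s * Q 0 s (jump_op (\<lambda>_. 1)) z \<partial>lborel) = 1"
proof (cases z)
  case (Pair x v)
  define L where "L = cum_rate gU lr x v"
  define l where "l = (\<lambda>s. rate gU lr (x + s *\<^sub>R v) v)"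
  have [measurable]: "l \<in> borel_measurable borel" "L \<in> borel_measurable borel"
    unfolding l_def L_def by measurable
  have "(\<integral>\<^sup>+ s. ennreal (l s * exp (- L s)) * indicator {0..t} s \<partial>lborel) = ennreal (- exp (- L t) - (- exp (- L 0)))"
    using assms
    by (intro nn_integral_has_integral_lebesgue' fundamental_theorem_of_calculus)
       (auto simp: L_def l_def less_imp_le rate_pos has_real_derivative_iff_has_vector_derivative[symmetric]
         intro!: derivative_eq_intros cum_rate_has_deriv)
  hence "(\<integral>\<^sup>+ s. indicator {0..t} s * Q 0 s (jump_op (\<lambda>_. 1)) z \<partial>lborel) = ennreal (1 - exp (- L t))"
    by (simp add: Qk_0 Pair jump_op_1 l_def L_def mult_ac ennreal_mult less_imp_le rate_pos)
  thus ?thesis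
    by (simp add: Qk_0 Pair L_def ennreal_plus[symmetric] cum_rate_nonneg del: ennreal_plus)
qed

lemma rate_bounded:
  "\<exists>M>0. \<forall>x v. norm x \<le> R \<longrightarrow> v \<in> Vset \<longrightarrow> rate gU lr x v \<le> M"
proof -
  have "compact (gU ` cball 0 R)"
    by (intro compact_continuous_image continuous_on_subset[OF gU_cont]) auto
  then obtain B where B: "\<And>x. norm x \<le> R \<Longrightarrow> norm (gU x) \<le> B"
    using compact_imp_bounded[of "gU ` cball 0 R"] by (force simp: bounded_iff)
  have "rate gU lr x v \<le> \<bar>B\<bar> + lr" if "norm x \<le> R" "v \<in> Vset" for x v
  proof -
    have "v \<bullet> gU x \<le> norm v * norm (gU x)" by (rule norm_cauchy_schwarz)
    thus ?thesis using B[OF that(1)] norm_Vset[OF that(2)] by (simp add: rate_def)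
  qed
  thus ?thesis using lr_pos by (intro exI[of _ "\<bar>B\<bar> + lr"]) auto
qed

text \<open>Comparison with a Poisson process of rate \<open>M\<close>, whose chance of
  \<open>n\<close> events by time \<open>t\<close> is at most \<open>(M t)^n / n!\<close>. Speed one
  keeps all paths in the ball where \<open>M\<close> bounds the rates, and the hypothesis
  \<open>norm (fst z) + t \<le> R\<close> is inherited after a flight.\<close>

lemma mass_lower:
  assumes M: "\<And>x v. norm x \<le> R \<Longrightarrow> v \<in> Vset \<Longrightarrow> rate gU lr x v \<le> M" "M > 0"
    and "t \<ge> 0" "norm (fst z) + t \<le> R" "snd z \<in> Vset"
  shows "1 \<le> (\<Sum>k<n. Q k t (\<lambda>_. 1) z) + ennreal ((M * t) ^ n / fact n)"
  using assms(3-5)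
proof (induction n arbitrary: t z)
  case (Suc n)
  obtain x v where z: "z = (x, v)" by (cases z)
  let ?S = "\<lambda>s z. \<Sum>k<n. Q k s (\<lambda>_. 1) z"
  have one: "(\<lambda>_. 1 :: ennreal) \<in> borel_measurable borel" by simp
  have mS: "(\<lambda>s. indicator {0..t} s * Q 0 s (jump_op (?S (t - s))) z) \<in> borel_measurable lborel"
    unfolding jump_op_sum Q0_sum
    by (intro borel_measurable_times_ennreal borel_measurable_sum Qk_param_sec jump_op_measurable Qk_param param_const) auto
  \<comment> \<open>An antiderivative of \<open>M\<close> times the error in the induction
    hypothesis; integrating raises the exponent from \<open>n\<close> to
    \<open>Suc n\<close>.\<close>
  have deriv: "((\<lambda>s. - ((M * (t - s)) ^ Suc n / fact (Suc n))) has_real_derivative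
      M * (M * (t - s)) ^ n / fact n) (at s within A)" for s A
  proof -
    have "real (Suc n) / fact (Suc n) = 1 / fact n"
      by (simp del: of_nat_Suc)
    hence eq: "(real (Suc n) / fact (Suc n)) * (M * (M * (t - s)) ^ n) = M * (M * (t - s)) ^ n / fact n"
      by (simp only: mult_1 times_divide_eq_left)
    have "((\<lambda>s. - ((M * (t - s)) ^ Suc n / fact (Suc n))) has_real_derivative
        (real (Suc n) / fact (Suc n)) * (M * (M * (t - s)) ^ n)) (at s within A)"
    proof -
      have "((\<lambda>s. M * (t - s)) has_real_derivative - M) (at s within A)"
        by (auto intro!: derivative_eq_intros)
      from DERIV_minus[OF DERIV_cdivide[OF DERIV_power_Suc[OF this, of n], of "fact (Suc n)"]]
      show ?thesis
        by (simp only: mult_minus_left mult_minus_right divide_minus_left minus_minus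
          times_divide_eq_left mult_1_left mult_1 mult.commute of_nat_Suc of_nat_add of_nat_1)
    qed
    thus ?thesis by (simp only: eq)
  qed
  have "indicator {0..t} s * Q 0 s (jump_op (\<lambda>_. 1)) z \<le>
      indicator {0..t} s * Q 0 s (jump_op (?S (t - s))) z + 
      ennreal (M * (M * (t - s)) ^ n / fact n) * indicator {0..t} s" for s
  proof (cases "s \<in> {0..t}")
    case True
    let ?c = "ennreal ((M * (t - s)) ^ n / fact n)"
    have v: "v \<in> Vset" using Suc.prems z by simp
    have nx: "norm (x + s *\<^sub>R v) \<le> norm x + s"
      using norm_triangle_ineq[of x "s *\<^sub>R v"] True norm_Vset[OF v] by simp
    have "jump_op (\<lambda>_. 1) (x + s *\<^sub>R v, v) \<le> jump_op (\<lambda>z. ?S (t - s) z + ?c) (x + s *\<^sub>R v, v)"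
      using True Suc.prems z nx by (intro jump_op_mono Suc.IH) auto
    also have "\<dots> = jump_op (?S (t - s)) (x + s *\<^sub>R v, v) + ennreal (rate gU lr (x + s *\<^sub>R v) v) * ?c"
      by (simp add: jump_op_add jump_op_1)
    finally have "Q 0 s (jump_op (\<lambda>_. 1)) z \<le> ennreal (exp (- cum_rate gU lr x v s)) *
        (jump_op (?S (t - s)) (x + s *\<^sub>R v, v) + ennreal (rate gU lr (x + s *\<^sub>R v) v) * ?c)"
      by (simp add: z Qk_0 mult_left_mono)
    also have "\<dots> \<le> Q 0 s (jump_op (?S (t - s))) z + 1 * (ennreal M * ?c)"
      unfolding distrib_left using M(1)[of "x + s *\<^sub>R v" v] nx Suc.prems True v z
      by (intro add_mono mult_mono) (auto simp: Qk_0 cum_rate_nonneg ennreal_leI)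
    also have "ennreal M * ?c = ennreal (M * (M * (t - s)) ^ n / fact n)"
      using M(2) True by (simp add: ennreal_mult[symmetric])
    finally show ?thesis using True by simp
  qed auto
  hence "(\<integral>\<^sup>+ s. indicator {0..t} s * Q 0 s (jump_op (\<lambda>_. 1)) z \<partial>lborel) \<le>
    (\<integral>\<^sup>+ s. indicator {0..t} s * Q 0 s (jump_op (?S (t - s))) z + 
      ennreal (M * (M * (t - s)) ^ n / fact n) * indicator {0..t} s \<partial>lborel)"
    by (intro nn_integral_mono)
  also have "\<dots> = (\<integral>\<^sup>+ s. indicator {0..t} s * Q 0 s (jump_op (?S (t - s))) z \<partial>lborel) +
     (\<integral>\<^sup>+ s. ennreal (M * (M * (t - s)) ^ n / fact n) * indicator {0..t} s \<partial>lborel)"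
    by (intro nn_integral_add mS) auto
  also have "(\<integral>\<^sup>+ s. ennreal (M * (M * (t - s)) ^ n / fact n) * indicator {0..t} s \<partial>lborel) =
     ennreal (- ((M * (t - t)) ^ Suc n / fact (Suc n)) - (- ((M * (t - 0)) ^ Suc n / fact (Suc n))))"
    using M(2) \<open>t \<ge> 0\<close>
    by (intro nn_integral_FTC_Icc)
       (auto intro!: deriv simp del: power_Suc fact_Suc)
  finally have "Q 0 t (\<lambda>_. 1) z + (\<integral>\<^sup>+ s. indicator {0..t} s * Q 0 s (jump_op (\<lambda>_. 1)) z \<partial>lborel) \<le>
     (\<Sum>k<Suc n. Q k t (\<lambda>_. 1) z) + ennreal ((M * t) ^ Suc n / fact (Suc n))"
    unfolding sum_Qk_Suc[OF one] by (simp add: add.assoc add_left_mono)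
  thus ?case using exp_cum_rate_identity[OF \<open>t \<ge> 0\<close>] by simp
qed auto

text \<open>The upper bound is minimality applied to the supersolution one, the lower bound is the
  Poisson comparison as the number of events tends to infinity.\<close>

lemma PP_1:
  assumes t: "t \<ge> 0" and v: "snd z \<in> Vset"
  shows "PP t (\<lambda>_. 1) z = 1"
proof (rule antisym)
  show "PP t (\<lambda>_. 1) z \<le> 1"
    using PP_le_supersolution[of "\<lambda>_. 1" z t "\<lambda>_ _. 1"] assms by (simp add: exp_cum_rate_identity)
  obtain M where M: "M > 0" "\<And>x v. norm x \<le> norm (fst z) + t \<Longrightarrow> v \<in> Vset \<Longrightarrow> rate gU lr x v \<le> M"
    using rate_bounded by blast
  have "1 \<le> PP t (\<lambda>_. 1) z + ennreal ((M * t) ^ n / fact n)" for n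
    using mass_lower[OF M(2) M(1) t order_refl v, of n]
    by (rule order_trans) (auto intro!: add_right_mono sum_le_suminf simp: PP_def)
  moreover have "(\<lambda>n. PP t (\<lambda>_. 1) z + ennreal ((M * t) ^ n / fact n)) \<longlonglongrightarrow> PP t (\<lambda>_. 1) z + ennreal 0"
    using summable_LIMSEQ_zero[OF summable_exp[of "M * t"]]
    by (intro tendsto_intros tendsto_ennrealI) (simp add: field_simps)
  ultimately show "1 \<le> PP t (\<lambda>_. 1) z"
    by (intro LIMSEQ_le_const[of "\<lambda>n. PP t (\<lambda>_. 1) z + ennreal ((M * t) ^ n / fact n)"]) auto
qed

end

section \<open>The transition kernel\<close>

lemma nn_integral_layer_cake:
  "(\<integral>\<^sup>+ p. indicator {p. 0 \<le> p \<and> ennreal p < c} p \<partial>lborel) = c"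
proof (cases c)
  case (real r)
  hence "{p. 0 \<le> p \<and> ennreal p < c} = {0..<r}"
    by (auto simp: ennreal_less_iff)
  thus ?thesis using real by simp
next
  case top
  hence "{p. 0 \<le> p \<and> ennreal p < c} = {0..}"
    by (auto simp: less_top[symmetric])
  moreover have "emeasure lborel {0::real..} = \<infinity>"
  proof -
    have "ennreal (real n) \<le> emeasure lborel {0::real..}" for n
      using emeasure_mono[of "{0..real n}" "{0..}" lborel] by simp
    hence "(SUP n. of_nat n :: ennreal) \<le> emeasure lborel {0::real..}"
      by (intro SUP_least) (simp add: ennreal_of_nat_eq_real_of_nat)
    thus ?thesis by (simp add: ennreal_SUP_of_nat_eq_top top_unique)
  qed
  ultimately show ?thesis using top by simp
qed

text \<open>The functions at hand are integrals of indicators over the reals by the layer cake formula, so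
  no monotone class argument is needed.\<close>

lemma
  fixes L :: "('a::second_countable_topology \<Rightarrow> ennreal) \<Rightarrow> ennreal"
  assumes comm_real: "\<And>F. (\<lambda>(p,z). F p z) \<in> borel_measurable ((lborel::real measure) \<Otimes>\<^sub>M borel) \<Longrightarrow>
        L (\<lambda>z. \<integral>\<^sup>+p. F p z \<partial>lborel) = (\<integral>\<^sup>+p. L (F p) \<partial>lborel)"
    and comm_nat: "\<And>F. (\<And>i::nat. F i \<in> borel_measurable borel) \<Longrightarrow> L (\<lambda>z. \<Sum>i. F i z) = (\<Sum>i. L (F i))"
    and zero: "L (\<lambda>_. 0) = 0"
    and fin: "L (\<lambda>_. 1) < \<infinity>"
    and \<mu>: "\<And>A. A \<in> sets borel \<Longrightarrow> \<mu> A = L (indicator A)"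
  shows emeasure_measure_of_functional:
      "A \<in> sets borel \<Longrightarrow> emeasure (measure_of UNIV (sets borel) \<mu>) A = L (indicator A)"
    and nn_integral_measure_of_functional:
      "f \<in> borel_measurable borel \<Longrightarrow> (\<integral>\<^sup>+z. f z \<partial>measure_of UNIV (sets borel) \<mu>) = L f"
proof -
  define M where "M = measure_of UNIV (sets borel) \<mu>"
  have sets_M [simp, measurable_cong]: "sets M = sets borel" and space_M [simp]: "space M = UNIV"
    using sets.sigma_sets_eq[of "borel :: 'a measure"] by (simp_all add: M_def)
  have em: "emeasure M A = L (indicator A)" if A: "A \<in> sets borel" for A
  proof -
    have "emeasure M A = \<mu> A"
      unfolding M_def
    proof (rule emeasure_measure_of_sigma)
      show "sigma_algebra UNIV (sets (borel :: 'a measure))"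
        using sets.sigma_algebra_axioms[of "borel :: 'a measure"] by simp
      show "positive (sets borel) \<mu>"
        by (simp add: positive_def \<mu> zero[simplified] indicator_def[abs_def] zero)
      show "countably_additive (sets borel) \<mu>"
      proof (rule countably_additiveI)
        fix A :: "nat \<Rightarrow> 'a set"
        assume A: "range A \<subseteq> sets borel" "disjoint_family A" "\<Union> (range A) \<in> sets borel"
        have "(\<Sum>i. \<mu> (A i)) = (\<Sum>i. L (indicator (A i)))"
          using A by (intro suminf_cong \<mu>) auto
        also have "\<dots> = L (\<lambda>z. \<Sum>i. indicator (A i) z)"
          using A(1) by (intro comm_nat[symmetric]) auto
        also have "(\<lambda>z. (\<Sum>i. indicator (A i) z) :: ennreal) = indicator (\<Union> (range A))"
          using suminf_indicator[OF A(2)] by (simp add: fun_eq_iff)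
        finally show "(\<Sum>i. \<mu> (A i)) = \<mu> (\<Union> (range A))" using \<mu>[OF A(3)] by simp
      qed
    qed (use A in auto)
    thus ?thesis using \<mu>[OF A] by simp
  qed
  have nn: "(\<integral>\<^sup>+z. f z \<partial>M) = L f" if f [measurable]: "f \<in> borel_measurable borel" for f
  proof -
    define F where "F = (\<lambda>(p::real) z. indicator {p. 0 \<le> p \<and> ennreal p < f z} p :: ennreal)"
    have F [measurable]: "(\<lambda>(p,z). F p z) \<in> borel_measurable (lborel \<Otimes>\<^sub>M borel)"
      unfolding F_def indicator_def mem_Collect_eq by measurable
    have F_ind: "F p = indicator {z. 0 \<le> p \<and> ennreal p < f z}" for p
      by (auto simp: F_def indicator_def fun_eq_iff)
    have fF: "f z = (\<integral>\<^sup>+ p. F p z \<partial>lborel)" for z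
      unfolding F_def by (rule nn_integral_layer_cake[symmetric])
    \<comment> \<open>Finite total mass makes \<open>M\<close> sigma-finite, as Fubini
      requires.\<close>
    interpret M: finite_measure M
      using fin em[of UNIV] by (intro finite_measureI) (simp add: indicator_def[abs_def])
    interpret pair_sigma_finite "lborel :: real measure" M ..
    have "(\<integral>\<^sup>+z. f z \<partial>M) = (\<integral>\<^sup>+z. (\<integral>\<^sup>+ p. F p z \<partial>lborel) \<partial>M)" by (simp add: fF[symmetric])
    also have "\<dots> = (\<integral>\<^sup>+ p. (\<integral>\<^sup>+z. F p z \<partial>M) \<partial>lborel)"
      by (intro Fubini') measurable
    also have "\<dots> = (\<integral>\<^sup>+ p. L (F p) \<partial>lborel)"
      unfolding F_ind by (intro nn_integral_cong) (subst nn_integral_indicator, auto simp: em)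
    also have "\<dots> = L f" using comm_real[OF F] by (simp add: fF[symmetric])
    finally show ?thesis .
  qed
  show "A \<in> sets borel \<Longrightarrow> emeasure (measure_of UNIV (sets borel) \<mu>) A = L (indicator A)"
    using em by (simp add: M_def)
  show "f \<in> borel_measurable borel \<Longrightarrow> (\<integral>\<^sup>+z. f z \<partial>measure_of UNIV (sets borel) \<mu>) = L f"
    using nn by (simp add: M_def)
qed

lemma Vset_state_sets [measurable]: "{z :: 'd::finite state. snd z \<in> Vset} \<in> sets borel"
proof -
  have "closed (Vset :: (real^'d) set)" by (rule finite_imp_closed) simp
  hence "snd -` (Vset :: (real^'d) set) \<inter> space borel \<in> sets (borel :: 'd state measure)"
    by (intro measurable_sets[OF borel_measurable_snd_borel]) auto
  thus ?thesis by (simp add: vimage_def)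
qed

context coordinate_sampler
begin

abbreviation "K \<equiv> CS_kernel gU lr"

lemma sets_K [simp, measurable_cong]: "sets (K t z) = sets borel"
  and space_K [simp]: "space (K t z) = UNIV"
  using sets.sigma_sets_eq[of "borel :: 'd state measure"] by (simp_all add: CS_kernel_def)

lemma PP_suminf:
  fixes F :: "nat \<Rightarrow> 'd state \<Rightarrow> ennreal"
  assumes F: "\<And>i. F i \<in> borel_measurable borel"
  shows "PP t (\<lambda>z. \<Sum>i. F i z) z0 = (\<Sum>i. PP t (F i) z0)"
proof -
  have "(\<lambda>(p,z). F p z) \<in> borel_measurable (count_space UNIV \<Otimes>\<^sub>M borel)"
    using F by (auto intro!: measurable_pair_measure_countable1)
  from PP_nn_integral[OF this sigma_finite_measure_count_space] show ?thesis
    by (simp add: nn_integral_count_space_nat)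
qed

lemma Qk_zero: "Q n t (\<lambda>_. 0) z = 0"
proof (induction n arbitrary: t z)
  case (Suc n)
  thus ?case by (simp add: Qk_Suc jump_op_def Qk_0)
qed (simp add: Qk_0)

lemma PP_zero: "PP t (\<lambda>_. 0) z = 0"
  by (simp add: PP_def Qk_zero)

text \<open>From a velocity in \<open>Vset\<close> all later velocities lie in \<open>Vset\<close>,
  so values of the test function elsewhere are never seen. This gives the almost sure statement
  about velocities under the kernel.\<close>

lemma PP_cong:
  assumes "snd z \<in> Vset" and "\<And>x w. w \<in> Vset \<Longrightarrow> f (x, w) = g (x, w)"
  shows "PP t f z = PP t g z"
proof -
  have "Q n t f z = Q n t g z" for n
    using assms(1)
  proof (induction n arbitrary: t z)
    case (Suc n)
    hence "jump_op (Q n s f) = jump_op (Q n s g)" for s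
      by (auto simp: jump_op_def fun_eq_iff intro!: sum.cong)
    thus ?case by (simp add: Qk_Suc)
  qed (simp add: Qk_0 assms(2))
  thus ?thesis by (simp add: PP_def)
qed

context
  fixes t :: real and z :: "'d state"
  assumes t: "t \<ge> 0" and z: "snd z \<in> Vset"
begin

lemma emeasure_K: "A \<in> sets borel \<Longrightarrow> emeasure (K t z) A = PP t (indicator A) z"
  unfolding CS_kernel_def
  by (rule emeasure_measure_of_functional)
     (auto simp: PP_1 t z PP_nn_integral[OF _ sigma_finite_lborel] PP_suminf PP_zero PP_def[symmetric])

lemma nn_integral_K: "f \<in> borel_measurable borel \<Longrightarrow> (\<integral>\<^sup>+y. f y \<partial>K t z) = PP t f z"
  unfolding CS_kernel_def
  by (rule nn_integral_measure_of_functional)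
     (auto simp: PP_1 t z PP_nn_integral[OF _ sigma_finite_lborel] PP_suminf PP_zero PP_def[symmetric])

lemma prob_space_K: "prob_space (K t z)"
  by (rule prob_spaceI) (simp add: emeasure_K indicator_def[abs_def] PP_1 t z)

lemma AE_K: "AE y in K t z. snd y \<in> Vset"
proof -
  have "emeasure (K t z) {y. snd y \<notin> Vset} = PP t (indicator {y. snd y \<notin> Vset}) z"
    using sets.compl_sets[OF Vset_state_sets] by (intro emeasure_K) (simp add: Compl_eq_Diff_UNIV[symmetric] Collect_neg_eq)
  also have "\<dots> = PP t (\<lambda>_. 0) z" by (intro PP_cong z) auto
  finally show ?thesis 
    using sets.compl_sets[OF Vset_state_sets]
    by (intro AE_I[of _ _ "{y. snd y \<notin> Vset}"])
       (auto simp: PP_def Qk_zero Compl_eq_Diff_UNIV[symmetric] Collect_neg_eq)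
qed

end
end

section \<open>Skew-reversibility and invariance\<close>

locale coordinate_sampler_potential = coordinate_sampler gU lr
  for gU :: "real^'d \<Rightarrow> real^'d" and lr :: real +
  fixes U :: "real^'d \<Rightarrow> real"
  assumes grad: "\<And>x. (U has_derivative (\<lambda>h. gU x \<bullet> h)) (at x)"
begin

lemma U_cont: "continuous_on S U"
  using grad has_derivative_continuous by (blast intro: continuous_at_imp_continuous_on)

lemma U_measurable [measurable]: "U \<in> borel_measurable borel"
  using U_cont by (rule borel_measurable_continuous_onI)

lemma U_path_deriv:
  "((\<lambda>s. U (x + s *\<^sub>R v)) has_real_derivative gU (x + s *\<^sub>R v) \<bullet> v) (at s within A)"
proof -
  have "((\<lambda>s. U (x + s *\<^sub>R v)) has_derivative (\<lambda>h. gU (x + s *\<^sub>R v) \<bullet> (h *\<^sub>R v))) (at s within A)"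
    by (rule has_derivative_compose[OF _ grad, of "\<lambda>s. x + s *\<^sub>R v"]) (auto intro!: derivative_eq_intros)
  thus ?thesis by (simp add: has_field_derivative_def mult_commute_abs)
qed

lemma integral_reflect_Icc: "integral {0..t} (\<lambda>r. h (t - r)) = integral {0..t} (h :: real \<Rightarrow> real)"
proof -
  have "integral {0..t} h = integral {-t..0} (\<lambda>r. h (- r))"
    using Henstock_Kurzweil_Integration.integral_reflect_real[of t 0 h] by simp
  also have "\<dots> = integral {0..t} (\<lambda>r. h (t - r))"
    using integral_shift_Icc_real[of 0 t "\<lambda>r. h (- r)" "-t"] by (simp add: o_def)
  finally show ?thesis ..
qed

text \<open>Detailed balance of free flights: \<open>rate\<close> at \<open>v\<close> minus
  \<open>rate\<close> at \<open>- v\<close> is the directional derivative of \<open>U\<close>, and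
  reading the path backwards turns the integral of the second rate into the \<open>cum_rate\<close>
  of the return flight.\<close>

lemma U_diff_cum_rate:
  assumes t: "t \<ge> 0"
  shows "U (x + t *\<^sub>R v) - U x = cum_rate gU lr x v t - cum_rate gU lr (x + t *\<^sub>R v) (- v) t"
proof -
  have int: "(\<lambda>r. rate gU lr (x + r *\<^sub>R v) w) integrable_on {0..t}" for w
    by (intro integrable_continuous_real continuous_intros)
  have "((\<lambda>r. gU (x + r *\<^sub>R v) \<bullet> v) has_integral (U (x + t *\<^sub>R v) - U (x + 0 *\<^sub>R v))) {0..t}"
    using t by (intro fundamental_theorem_of_calculus)
      (auto simp: has_real_derivative_iff_has_vector_derivative[symmetric] intro!: U_path_deriv)
  hence "U (x + t *\<^sub>R v) - U x = integral {0..t} (\<lambda>r. gU (x + r *\<^sub>R v) \<bullet> v)"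
    by (simp add: integral_unique)
  also have "\<dots> = integral {0..t} (\<lambda>r. rate gU lr (x + r *\<^sub>R v) v - rate gU lr (x + r *\<^sub>R v) (- v))"
    by (intro integral_cong) (auto simp: rate_def inner_commute max_def)
  also have "\<dots> = cum_rate gU lr x v t - integral {0..t} (\<lambda>r. rate gU lr (x + r *\<^sub>R v) (- v))"
    by (simp add: integral_diff int cum_rate_def)
  also have "integral {0..t} (\<lambda>r. rate gU lr (x + r *\<^sub>R v) (- v)) =
     integral {0..t} (\<lambda>r. rate gU lr (x + (t - r) *\<^sub>R v) (- v))"
    by (rule integral_reflect_Icc[symmetric])
  also have "\<dots> = cum_rate gU lr (x + t *\<^sub>R v) (- v) t"
    by (simp add: cum_rate_def algebra_simps)
  finally show ?thesis .
qed

definition flip :: "('d state \<Rightarrow> ennreal) \<Rightarrow> 'd state \<Rightarrow> ennreal" where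
  "flip f = (\<lambda>z. f (fst z, - snd z))"

text \<open>The bilinear form of \<open>exp (- U)\<close> times Lebesgue and counting measure. It is
  unnormalised and \<open>ennreal\<close>-valued, so duality is stated before
  \<open>exp (- U)\<close> is known to be integrable.\<close>

definition pairing :: "('d state \<Rightarrow> ennreal) \<Rightarrow> ('d state \<Rightarrow> ennreal) \<Rightarrow> ennreal" where
  "pairing g f = (\<integral>\<^sup>+x. (\<Sum>v\<in>Vset. ennreal (exp (- U x)) * g (x, v) * f (x, v)) \<partial>lborel)"

lemma flip_flip [simp]: "flip (flip f) = f"
  by (simp add: flip_def)

lemma flip_measurable [measurable]:
  assumes [measurable]: "f \<in> borel_measurable borel" shows "flip f \<in> borel_measurable borel"
proof -
  note [measurable] = borel_measurable_fst_borel borel_measurable_snd_borel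
  have "(\<lambda>z :: 'd state. (fst z, - snd z)) \<in> borel \<rightarrow>\<^sub>M borel \<Otimes>\<^sub>M borel" by measurable
  thus ?thesis unfolding flip_def using assms by (auto simp: borel_prod intro: measurable_compose)
qed

lemma pairing_commute: "pairing f g = pairing g f"
  by (simp add: pairing_def mult_ac)

lemma measurable_state_fst:
  fixes f :: "'d state \<Rightarrow> ennreal"
  assumes "f \<in> borel_measurable borel" shows "(\<lambda>x. f (x, v)) \<in> borel_measurable borel"
  by (rule measurable_compose[OF borel_measurable_continuous_onI assms]) (intro continuous_intros)

lemma measurable_param_fst:
  fixes F :: "'p \<Rightarrow> 'd state \<Rightarrow> ennreal"
  assumes F: "(\<lambda>(p,z). F p z) \<in> borel_measurable (N \<Otimes>\<^sub>M borel)"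
  shows "(\<lambda>(p,x). F p (x, v)) \<in> borel_measurable (N \<Otimes>\<^sub>M lborel)"
proof -
  have "(\<lambda>(p,x). (p, x, v)) \<in> N \<Otimes>\<^sub>M lborel \<rightarrow>\<^sub>M N \<Otimes>\<^sub>M borel \<Otimes>\<^sub>M borel" by measurable
  from measurable_compose[OF this[unfolded borel_prod] F] show ?thesis
    by (simp add: case_prod_beta')
qed

lemma pairing_param:
  fixes F :: "'p \<Rightarrow> 'd state \<Rightarrow> ennreal"
  assumes g: "g \<in> borel_measurable borel"
    and F: "(\<lambda>(p,z). F p z) \<in> borel_measurable (N \<Otimes>\<^sub>M borel)"
  shows "(\<lambda>(p,x). (\<Sum>v\<in>Vset. ennreal (exp (- U x)) * g (x, v) * F p (x, v)))
    \<in> borel_measurable (N \<Otimes>\<^sub>M lborel)"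
proof -
  note [measurable] = measurable_state_fst[OF g] measurable_param_fst[OF F]
  show ?thesis by measurable
qed

lemma pairing_param_measurable:
  assumes g: "g \<in> borel_measurable borel"
    and F: "(\<lambda>(p,z). F p z) \<in> borel_measurable (N \<Otimes>\<^sub>M borel)"
  shows "(\<lambda>p. pairing g (F p)) \<in> borel_measurable N"
  unfolding pairing_def using pairing_param[OF g F] by (rule lborel.borel_measurable_nn_integral)

lemma pairing_nn_integral:
  assumes g: "g \<in> borel_measurable borel" and N: "sigma_finite_measure N"
    and F: "(\<lambda>(p,z). F p z) \<in> borel_measurable (N \<Otimes>\<^sub>M borel)"
  shows "pairing g (\<lambda>z. \<integral>\<^sup>+p. F p z \<partial>N) = (\<integral>\<^sup>+p. pairing g (F p) \<partial>N)"
proof -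
  interpret N: sigma_finite_measure N by fact
  interpret pair_sigma_finite N lborel ..
  have m [measurable]: "(\<lambda>p. F p z) \<in> borel_measurable N" for z
    using measurable_compose[OF _ F, of "\<lambda>p. (p, z)" N] by simp
  have "pairing g (\<lambda>z. \<integral>\<^sup>+p. F p z \<partial>N) =
      (\<integral>\<^sup>+x. (\<integral>\<^sup>+p. (\<Sum>v\<in>Vset. ennreal (exp (- U x)) * g (x, v) * F p (x, v)) \<partial>N) \<partial>lborel)"
    unfolding pairing_def
    by (intro nn_integral_cong, subst nn_integral_sum) (auto simp: nn_integral_cmult)
  also have "\<dots> = (\<integral>\<^sup>+p. pairing g (F p) \<partial>N)"
    unfolding pairing_def using pairing_param[OF g F] by (rule Fubini')
  finally show ?thesis .
qed

lemma nn_integral_lborel_shift: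
  fixes f :: "real^'d \<Rightarrow> ennreal"
  assumes [measurable]: "f \<in> borel_measurable borel"
  shows "(\<integral>\<^sup>+x. f (x + c) \<partial>lborel) = (\<integral>\<^sup>+x. f x \<partial>lborel)"
proof -
  have "(\<integral>\<^sup>+x. f x \<partial>lborel) = (\<integral>\<^sup>+x. f x \<partial>distr lborel borel ((+) c))"
    by (simp add: lborel_distr_plus)
  also have "\<dots> = (\<integral>\<^sup>+x. f (c + x) \<partial>lborel)" by (rule nn_integral_distr) auto
  finally show ?thesis by (simp add: add.commute)
qed

text \<open>Substituting the end point \<open>y = x + t v\<close> moves the weight to
  \<open>y\<close>; by \<open>U_diff_cum_rate\<close> the survival factor becomes that of the return
  flight.\<close>

lemma pairing_Q0:
  assumes g: "g \<in> borel_measurable borel" and f: "f \<in> borel_measurable borel" and t: "t \<ge> 0"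
  shows "pairing g (Q 0 t f) = pairing f (flip (Q 0 t (flip g)))"
proof -
  note [measurable] = measurable_state_fst[OF g] measurable_state_fst[OF f]
  define h where "h = (\<lambda>v y. ennreal (exp (- U y)) * f (y, v) *
      (ennreal (exp (- cum_rate gU lr y (- v) t)) * g (y - t *\<^sub>R v, v)))"
  have [measurable]: "h v \<in> borel_measurable borel" for v unfolding h_def by measurable
  have "pairing g (Q 0 t f) = (\<integral>\<^sup>+x. (\<Sum>v\<in>Vset. h v (x + t *\<^sub>R v)) \<partial>lborel)"
    unfolding pairing_def
  proof (intro nn_integral_cong sum.cong refl)
    fix x v
    have "exp (- U x) * exp (- cum_rate gU lr x v t) =
        exp (- U (x + t *\<^sub>R v)) * exp (- cum_rate gU lr (x + t *\<^sub>R v) (- v) t)"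
      using U_diff_cum_rate[OF t, of x v] by (simp add: exp_add[symmetric])
    hence "ennreal (exp (- U x)) * ennreal (exp (- cum_rate gU lr x v t)) =
      ennreal (exp (- U (x + t *\<^sub>R v))) * ennreal (exp (- cum_rate gU lr (x + t *\<^sub>R v) (- v) t))"
      by (metis ennreal_mult'' exp_ge_zero)
    hence "(ennreal (exp (- U x)) * ennreal (exp (- cum_rate gU lr x v t))) * (g (x, v) * f (x + t *\<^sub>R v, v)) =
      (ennreal (exp (- U (x + t *\<^sub>R v))) * ennreal (exp (- cum_rate gU lr (x + t *\<^sub>R v) (- v) t))) *
      (g (x, v) * f (x + t *\<^sub>R v, v))" by (simp only:)
    thus "ennreal (exp (- U x)) * g (x, v) * Q 0 t f (x, v) = h v (x + t *\<^sub>R v)"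
      by (simp add: h_def Qk_0 ac_simps)
  qed
  also have "\<dots> = (\<Sum>v\<in>Vset. \<integral>\<^sup>+x. h v (x + t *\<^sub>R v) \<partial>lborel)"
    by (intro nn_integral_sum) measurable
  also have "\<dots> = (\<Sum>v\<in>Vset. \<integral>\<^sup>+x. h v x \<partial>lborel)"
    by (intro sum.cong refl nn_integral_lborel_shift) measurable
  also have "\<dots> = (\<integral>\<^sup>+x. (\<Sum>v\<in>Vset. h v x) \<partial>lborel)"
    by (intro nn_integral_sum[symmetric]) measurable
  also have "\<dots> = pairing f (flip (Q 0 t (flip g)))"
    by (simp add: pairing_def h_def flip_def Qk_0)
  finally show ?thesis .
qed

lemma pairing_jump_op: "pairing g (jump_op f) = pairing f (flip (jump_op (flip g)))"
  unfolding pairing_def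
proof (intro nn_integral_cong)
  fix x
  let ?c = "\<lambda>v w. ennreal (rate gU lr x v * rate gU lr x (- w) / total_rate gU lr x)"
  let ?e = "ennreal (exp (- U x))"
  have "(\<Sum>v\<in>Vset. ?e * g (x, v) * jump_op f (x, v)) =
      (\<Sum>v\<in>Vset. \<Sum>w\<in>Vset. ?e * g (x, v) * (?c v w * f (x, w)))"
    by (simp add: jump_op_def sum_distrib_left)
  also have "\<dots> = (\<Sum>w\<in>Vset. \<Sum>v\<in>Vset. ?e * g (x, v) * (?c v w * f (x, w)))"
    by (rule sum.swap)
  \<comment> \<open>The coefficient satisfies \<open>?c v w = ?c (- w) (- v)\<close>, because the
    two rates merely trade places.\<close>
  also have "\<dots> = (\<Sum>w\<in>Vset. ?e * f (x, w) * (\<Sum>v\<in>Vset. ?c (- w) (- v) * g (x, - (- v))))"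
    by (simp add: sum_distrib_left mult_ac)
  also have "\<dots> = (\<Sum>w\<in>Vset. ?e * f (x, w) * flip (jump_op (flip g)) (x, w))"
    by (subst sum_Vset_uminus[of "\<lambda>v. ?c (- w) v * g (x, - v)" for w])
       (simp add: flip_def jump_op_def)
  finally show "(\<Sum>v\<in>Vset. ?e * g (x, v) * jump_op f (x, v)) =
    (\<Sum>w\<in>Vset. ?e * f (x, w) * flip (jump_op (flip g)) (x, w))" .
qed

text \<open>The left side is expanded at the last event, the right side at the first. Each of the
  three factors of the composition passes to its adjoint, which reverses their order.\<close>

lemma pairing_Qk:
  assumes "g \<in> borel_measurable borel" "f \<in> borel_measurable borel" "t \<ge> 0"
  shows "pairing g (Q n t f) = pairing f (flip (Q n t (flip g)))"
  using assms
proof (induction n arbitrary: f g t)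
  case 0
  thus ?case by (intro pairing_Q0)
next
  case (Suc n)
  note g = Suc.prems(1) and f = Suc.prems(2)
  have fg: "flip g \<in> borel_measurable borel" using g by (rule flip_measurable)
  define R where "R = (\<lambda>s. Q 0 (t - s) (jump_op (Q n s (flip g))))"
  have Rm: "(\<lambda>(s,z). R s z) \<in> borel_measurable (lborel \<Otimes>\<^sub>M borel)"
    unfolding R_def by (intro Qk_param jump_op_measurable param_const fg) auto
  have Rf: "(\<lambda>(s,z). flip (R s) z) \<in> borel_measurable (lborel \<Otimes>\<^sub>M borel)"
  proof -
    note [measurable] = borel_measurable_fst_borel borel_measurable_snd_borel
    have "(\<lambda>(s, z :: 'd state). (s, fst z, - snd z)) \<in> lborel \<Otimes>\<^sub>M borel \<rightarrow>\<^sub>M lborel \<Otimes>\<^sub>M borel \<Otimes>\<^sub>M borel"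
      by measurable
    from measurable_compose[OF this[unfolded borel_prod] Rm] show ?thesis
      by (simp add: flip_def case_prod_beta')
  qed
  have "Q (Suc n) t f = (\<lambda>z. \<integral>\<^sup>+ s. indicator {0..t} s * Q n s (jump_op (Q 0 (t - s) f)) z \<partial>lborel)"
    by (rule ext, rule Qk_Suc_last[OF f])
  moreover have "(\<lambda>(s,z). indicator {0..t} s * Q n s (jump_op (Q 0 (t - s) f)) z) \<in> borel_measurable (lborel \<Otimes>\<^sub>M borel)"
  proof -
    have "(\<lambda>(s,z). Q n s (jump_op (Q 0 (t - s) f)) z) \<in> borel_measurable (lborel \<Otimes>\<^sub>M borel)"
      by (intro Qk_param jump_op_measurable param_const f) auto
    thus ?thesis by (simp add: case_prod_beta')
  qed
  ultimately have "pairing g (Q (Suc n) t f) =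
      (\<integral>\<^sup>+ s. pairing g (\<lambda>z. indicator {0..t} s * Q n s (jump_op (Q 0 (t - s) f)) z) \<partial>lborel)"
    by (simp add: pairing_nn_integral[OF g sigma_finite_lborel])
  also have "\<dots> = (\<integral>\<^sup>+ s. pairing f (\<lambda>z. indicator {0..t} s * flip (R s) z) \<partial>lborel)"
  proof (intro nn_integral_cong)
    fix s :: real
    show "pairing g (\<lambda>z. indicator {0..t} s * Q n s (jump_op (Q 0 (t - s) f)) z) =
      pairing f (\<lambda>z. indicator {0..t} s * flip (R s) z)"
    proof (cases "s \<in> {0..t}")
      case True
      hence s: "s \<ge> 0" "t - s \<ge> 0" by auto
      have "pairing g (Q n s (jump_op (Q 0 (t - s) f))) =
          pairing (jump_op (Q 0 (t - s) f)) (flip (Q n s (flip g)))"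
        by (intro Suc.IH g jump_op_measurable_state Qk_measurable_state f s)
      also have "\<dots> = pairing (Q 0 (t - s) f) (flip (jump_op (Q n s (flip g))))"
        by (subst pairing_commute, subst pairing_jump_op) simp
      also have "\<dots> = pairing f (flip (R s))"
        using s(2) by (subst pairing_commute, subst pairing_Q0)
           (auto simp: R_def intro!: flip_measurable jump_op_measurable_state Qk_measurable_state fg g f s(1))
      finally show ?thesis using True by simp
    qed (simp add: pairing_def)
  qed
  \<comment> \<open>Run backwards, the last event at time \<open>s\<close> is the first one, at time
    \<open>t - s\<close>; the substitution restores the form of \<open>Qk_Suc\<close>.\<close>
  also have "\<dots> = (\<integral>\<^sup>+ s. pairing f (\<lambda>z. indicator {0..t} (t - s) * flip (R (t - s)) z) \<partial>lborel)"
    using nn_integral_real_affine[of "\<lambda>s. pairing f (\<lambda>z. indicator {0..t} s * flip (R s) z)" "-1" t]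
      pairing_param_measurable[OF f, of "\<lambda>s z. indicator {0..t} s * flip (R s) z" lborel] Rf
    by (simp add: case_prod_beta')
  also have "\<dots> = (\<integral>\<^sup>+ s. pairing f (\<lambda>z. indicator {0..t} s * flip (R (t - s)) z) \<partial>lborel)"
    by (intro nn_integral_cong) (auto simp: indicator_def)
  also have "\<dots> = pairing f (flip (Q (Suc n) t (flip g)))"
  proof -
    have "(\<lambda>(s,z). flip (R (t - s)) z) \<in> borel_measurable (lborel \<Otimes>\<^sub>M borel)"
      using measurable_compose[OF _ Rf, of "\<lambda>y. (t - fst y, snd y)" "lborel \<Otimes>\<^sub>M borel"]
      by (simp add: case_prod_beta')
    hence "(\<lambda>(s,z). indicator {0..t} s * flip (R (t - s)) z) \<in> borel_measurable (lborel \<Otimes>\<^sub>M borel)"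
      by (simp add: case_prod_beta')
    note * = pairing_nn_integral[OF f sigma_finite_lborel this]
    have "flip (Q (Suc n) t (flip g)) = (\<lambda>z. \<integral>\<^sup>+ s. indicator {0..t} s * flip (R (t - s)) z \<partial>lborel)"
      by (simp add: flip_def Qk_Suc R_def)
    thus ?thesis using * by simp
  qed
  finally show ?case .
qed

lemma pairing_suminf:
  assumes g: "g \<in> borel_measurable borel" and F: "\<And>i::nat. F i \<in> borel_measurable borel"
  shows "pairing g (\<lambda>z. \<Sum>i. F i z) = (\<Sum>i. pairing g (F i))"
proof -
  have "(\<lambda>(p,z). F p z) \<in> borel_measurable (count_space UNIV \<Otimes>\<^sub>M borel)"
    using F by (auto intro!: measurable_pair_measure_countable1)
  from pairing_nn_integral[OF g sigma_finite_measure_count_space this] show ?thesis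
    by (simp add: nn_integral_count_space_nat)
qed

lemma pairing_invariant:
  assumes f: "f \<in> borel_measurable borel" and t: "t \<ge> 0"
  shows "pairing (\<lambda>_. 1) (PP t f) = pairing (\<lambda>_. 1) f"
proof -
  have one: "(\<lambda>_. 1 :: ennreal) \<in> borel_measurable (borel :: 'd state measure)" by simp
  have "pairing (\<lambda>_. 1) (PP t f) = (\<Sum>n. pairing (\<lambda>_. 1) (Q n t f))"
    unfolding PP_def using pairing_suminf[OF one Qk_measurable_state[OF f]] by simp
  also have "\<dots> = (\<Sum>n. pairing f (flip (Q n t (\<lambda>_. 1))))"
    using pairing_Qk[OF one f t] by (simp add: flip_def)
  also have "\<dots> = pairing f (\<lambda>z. \<Sum>n. flip (Q n t (\<lambda>_. 1)) z)"
    by (intro pairing_suminf[symmetric] f flip_measurable Qk_measurable_state one)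
  also have "\<dots> = pairing f (\<lambda>_. 1)"
    unfolding pairing_def
  proof (intro nn_integral_cong sum.cong refl)
    fix x v :: "real^'d" assume "v \<in> Vset"
    \<comment> \<open>Reversal flips the velocity and \<open>Vset\<close> is closed under sign, so
      conservation of mass applies at \<open>- v\<close>.\<close>
    hence "PP t (\<lambda>_. 1) (x, - v) = 1" by (intro PP_1 t) auto
    thus "ennreal (exp (- U x)) * f (x, v) * (\<Sum>n. flip (Q n t (\<lambda>_. 1)) (x, v)) =
      ennreal (exp (- U x)) * f (x, v) * 1"
      by (simp add: flip_def PP_def)
  qed
  finally show ?thesis by (simp add: pairing_commute)
qed

end

section \<open>The invariant probability measure\<close>

locale coordinate_sampler_target = coordinate_sampler_potential gU lr U
  for gU :: "real^'d \<Rightarrow> real^'d" and lr :: real and U :: "real^'d \<Rightarrow> real" +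
  assumes integrable_exp: "integrable lborel (\<lambda>x. exp (- U x))"
begin

abbreviation "Z \<equiv> (\<integral>x. exp (- U x) \<partial>lborel)"

lemma Z_nn: "(\<integral>\<^sup>+x. ennreal (exp (- U x)) \<partial>lborel) = ennreal Z"
  using integrable_exp by (intro nn_integral_eq_integral) auto

lemma Z_pos: "Z > 0"
proof -
  have "Z \<noteq> 0"
  proof
    assume "Z = 0"
    hence "AE x in lborel. exp (- U x) = 0"
      using integral_nonneg_eq_0_iff_AE[OF integrable_exp] by simp
    hence "AE x :: real^'d in lborel. False" by simp
    thus False using ae_filter_eq_bot_iff[of "lborel :: (real^'d) measure"] emeasure_lborel_UNIV
      by (simp add: trivial_limit_def[symmetric] eventually_False)
  qed
  thus ?thesis by (simp add: less_le integral_nonneg_AE)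
qed

abbreviation "rho \<equiv> rho_U U"

lemma sets_rho [simp, measurable_cong]: "sets rho = sets borel"
  and space_rho [simp]: "space rho = UNIV"
  using sets.sigma_sets_eq[of "borel :: 'd state measure"] by (simp_all add: rho_U_def)

definition rho_const :: ennreal where
  "rho_const = ennreal (1 / (real (card (Vset :: (real^'d) set)) * Z))"

lemma pairing_1_1: "pairing (\<lambda>_. 1) (\<lambda>_. 1) = ennreal (real (card (Vset :: (real^'d) set)) * Z)"
proof -
  have "pairing (\<lambda>_. 1) (\<lambda>_. 1) = (\<integral>\<^sup>+x. of_nat (card (Vset :: (real^'d) set)) * ennreal (exp (- U x)) \<partial>lborel)"
    by (simp add: pairing_def)
  also have "\<dots> = of_nat (card (Vset :: (real^'d) set)) * ennreal Z"
    by (subst nn_integral_cmult) (auto simp: Z_nn)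
  finally show ?thesis by (simp add: ennreal_of_nat_eq_real_of_nat ennreal_mult)
qed

lemma rho_const_mult: "rho_const * pairing (\<lambda>_. 1) (\<lambda>_. 1) = 1"
  using Z_pos Vset_nonempty[where 'd='d]
  by (simp add: rho_const_def pairing_1_1 ennreal_mult[symmetric] card_eq_0_iff)

text \<open>Writes the set function behind \<open>rho_U\<close> as a functional of indicators, so
  the representation lemma used for the kernel also identifies this measure and its
  integral.\<close>

lemma rho_emeasure:
  assumes A: "A \<in> sets borel"
  shows "(\<Sum>w\<in>Vset. ennreal (1 / real (card (Vset :: (real^'d) set))) * emeasure (pi_U U) {x. (x, w) \<in> A}) =
    rho_const * pairing (\<lambda>_. 1) (indicator A)"
proof -
  have ind: "(indicator A :: 'd state \<Rightarrow> ennreal) \<in> borel_measurable borel" using A by simp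
  note [measurable] = measurable_state_fst[OF ind]
  have "ennreal (1 / real (card (Vset :: (real^'d) set))) * emeasure (pi_U U) {x. (x, w) \<in> A} =
     rho_const * (\<integral>\<^sup>+x. ennreal (exp (- U x)) * indicator A (x, w) \<partial>lborel)" for w
  proof -
    have "(\<lambda>x. (x, w)) -` A \<inter> space borel \<in> sets borel"
      using A by (intro measurable_sets[OF borel_measurable_continuous_onI]) (auto intro!: continuous_intros)
    hence B: "{x. (x, w) \<in> A} \<in> sets borel" by (simp add: vimage_def)
    have "emeasure (pi_U U) {x. (x, w) \<in> A} =
        (\<integral>\<^sup>+x. ennreal (exp (- U x) / Z) * indicator {x. (x, w) \<in> A} x \<partial>lborel)"
      unfolding pi_U_def by (rule emeasure_density) (use B in auto)
    also have "\<dots> = (\<integral>\<^sup>+x. ennreal (1 / Z) * (ennreal (exp (- U x)) * indicator A (x, w)) \<partial>lborel)"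
      using Z_pos by (intro nn_integral_cong) (auto simp: indicator_def ennreal_mult[symmetric])
    also have "\<dots> = ennreal (1 / Z) * (\<integral>\<^sup>+x. ennreal (exp (- U x)) * indicator A (x, w) \<partial>lborel)"
      by (rule nn_integral_cmult) measurable
    finally show ?thesis using Z_pos
      by (simp add: rho_const_def ennreal_mult[symmetric] mult.assoc[symmetric])
  qed
  moreover have "pairing (\<lambda>_. 1) (indicator A) = (\<Sum>w\<in>Vset. \<integral>\<^sup>+x. ennreal (exp (- U x)) * indicator A (x, w) \<partial>lborel)"
    unfolding pairing_def mult_1_right by (rule nn_integral_sum) measurable
  ultimately show ?thesis by (simp add: sum_distrib_left)
qed

lemma pairing_zero: "pairing g (\<lambda>_. 0) = 0"
  by (simp add: pairing_def)

lemma
  shows emeasure_rho: "A \<in> sets borel \<Longrightarrow> emeasure rho A = rho_const * pairing (\<lambda>_. 1) (indicator A)"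
    and nn_integral_rho: "f \<in> borel_measurable borel \<Longrightarrow> (\<integral>\<^sup>+z. f z \<partial>rho) = rho_const * pairing (\<lambda>_. 1) f"
proof -
  have one: "(\<lambda>_. 1 :: ennreal) \<in> borel_measurable (borel :: 'd state measure)" by simp
  note * = pairing_nn_integral[OF one sigma_finite_lborel] pairing_suminf[OF one] pairing_param_measurable[OF one]
  show "A \<in> sets borel \<Longrightarrow> emeasure rho A = rho_const * pairing (\<lambda>_. 1) (indicator A)"
    unfolding rho_U_def
    by (rule emeasure_measure_of_functional)
       (auto simp: rho_emeasure rho_const_mult * nn_integral_cmult pairing_zero)
  show "f \<in> borel_measurable borel \<Longrightarrow> (\<integral>\<^sup>+z. f z \<partial>rho) = rho_const * pairing (\<lambda>_. 1) f"
    unfolding rho_U_def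
    by (rule nn_integral_measure_of_functional)
       (auto simp: rho_emeasure rho_const_mult * nn_integral_cmult pairing_zero)
qed

lemma prob_space_rho: "prob_space rho"
  by (rule prob_spaceI) (simp add: emeasure_rho indicator_def[abs_def] rho_const_mult)

lemma AE_rho: "AE y in rho. snd y \<in> Vset"
proof -
  have m: "{y :: 'd state. snd y \<notin> Vset} \<in> sets borel"
    using sets.compl_sets[OF Vset_state_sets] by (simp add: Compl_eq_Diff_UNIV[symmetric] Collect_neg_eq)
  have "emeasure rho {y. snd y \<notin> Vset} = 0"
    unfolding emeasure_rho[OF m] by (simp add: pairing_def)
  thus ?thesis using m by (intro AE_I[of _ _ "{y. snd y \<notin> Vset}"]) auto
qed

lemma nn_integral_rho_PP:
  assumes "f \<in> borel_measurable borel" "t \<ge> 0"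
  shows "(\<integral>\<^sup>+z. PP t f z \<partial>rho) = (\<integral>\<^sup>+z. f z \<partial>rho)"
  using assms by (simp add: nn_integral_rho PP_measurable pairing_invariant)

end

section \<open>Harris' theorem\<close>

text \<open>The constant is the supremum of \<open>f - W\<close>, which the hypothesis puts below
  every value of \<open>f + W\<close>. Centering makes the weighted oscillation seminorm a weighted
  sup norm, the device behind the Hairer-Mattingly argument.\<close>

lemma oscillation_centering:
  fixes f W :: "'s \<Rightarrow> real"
  assumes "S \<noteq> {}" and osc: "\<And>y y'. y \<in> S \<Longrightarrow> y' \<in> S \<Longrightarrow> f y - f y' \<le> W y + W y'"
  shows "\<exists>c. \<forall>y\<in>S. \<bar>f y - c\<bar> \<le> W y"
proof -
  obtain y0 where y0: "y0 \<in> S" using assms(1) by blast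
  define c where "c = (SUP y\<in>S. f y - W y)"
  have bdd: "bdd_above ((\<lambda>y. f y - W y) ` S)"
    using osc[OF _ y0] by (intro bdd_aboveI2[of _ _ "f y0 + W y0"]) (force simp: algebra_simps)
  have "f y - W y \<le> c" if "y \<in> S" for y
    unfolding c_def by (rule cSUP_upper[OF that bdd])
  moreover have "c \<le> f y + W y" if "y \<in> S" for y
    unfolding c_def using osc[OF _ that] assms(1) by (intro cSUP_least) (auto simp: algebra_simps)
  ultimately show ?thesis by (intro exI[of _ c]) (force simp: abs_le_iff algebra_simps)
qed

text \<open>The function \<open>W - g\<close> under \<open>\<mu>1\<close> and the function
  \<open>W + g\<close> under \<open>\<mu>2\<close> both keep at least their
  \<open>\<nu>\<close>-integral, and under \<open>\<nu>\<close> they add up to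
  \<open>2 W \<ge> 2\<close>. This replaces subtracting \<open>\<nu>\<close> from the two
  measures.\<close>

lemma common_part_contraction:
  fixes g W :: "'s \<Rightarrow> real"
  assumes "prob_space \<mu>1" "prob_space \<mu>2"
    and sets: "sets \<mu>1 = sets \<nu>" "sets \<mu>2 = sets \<nu>"
    and le: "\<And>A. A \<in> sets \<nu> \<Longrightarrow> emeasure \<nu> A \<le> emeasure \<mu>1 A" "\<And>A. A \<in> sets \<nu> \<Longrightarrow> emeasure \<nu> A \<le> emeasure \<mu>2 A"
    and mass: "emeasure \<nu> (space \<nu>) \<ge> ennreal \<epsilon>" and "\<epsilon> \<ge> 0"
    and W: "integrable \<mu>1 W" "integrable \<mu>2 W" "\<And>y. W y \<ge> 1"
    and g: "integrable \<mu>1 g" "integrable \<mu>2 g"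
    and AE: "AE y in \<mu>1. \<bar>g y\<bar> \<le> W y" "AE y in \<mu>2. \<bar>g y\<bar> \<le> W y"
  shows "(\<integral>y. g y \<partial>\<mu>1) - (\<integral>y. g y \<partial>\<mu>2) \<le> (\<integral>y. W y \<partial>\<mu>1) + (\<integral>y. W y \<partial>\<mu>2) - 2 * \<epsilon>"
proof -
  have [measurable_cong]: "sets \<mu>1 = sets \<nu>" "sets \<mu>2 = sets \<nu>" by fact+
  have [measurable]: "g \<in> borel_measurable \<nu>" "W \<in> borel_measurable \<nu>"
    using g(1) W(1) by (auto dest!: borel_measurable_integrable cong: measurable_cong_sets simp: measurable_cong_sets[OF sets(1) refl])
  have le': "\<nu> \<le> \<mu>1" "\<nu> \<le> \<mu>2" using le sets by (auto simp: le_measure)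
  have pos: "AE y in \<mu>1. 0 \<le> W y - g y" "AE y in \<mu>2. 0 \<le> W y + g y"
    using AE by (auto elim!: eventually_mono)
  have *: "0 \<le> (\<integral>y. W y - g y \<partial>\<mu>1) + (\<integral>y. W y + g y \<partial>\<mu>2)"
    using pos by (intro add_nonneg_nonneg integral_nonneg_AE)
  have "ennreal (2 * \<epsilon>) \<le> (\<integral>\<^sup>+y. 2 \<partial>\<nu>)"
    using mass \<open>\<epsilon> \<ge> 0\<close> by (simp add: ennreal_mult mult_left_mono)
  also have "\<dots> \<le> (\<integral>\<^sup>+y. ennreal (W y - g y) + ennreal (W y + g y) \<partial>\<nu>)"
  proof (intro nn_integral_mono)
    fix y
    \<comment> \<open>The bound \<open>\<bar>g\<bar> \<le> W\<close> is known only almost everywhere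
      for \<open>\<mu>1\<close> and \<open>\<mu>2\<close>, so negative values, which
      \<open>ennreal\<close> cuts off, are allowed for.\<close>
    have "ennreal 2 \<le> ennreal (max 0 (W y - g y) + max 0 (W y + g y))"
      using W(3)[of y] by (intro ennreal_leI) linarith
    also have "\<dots> = ennreal (W y - g y) + ennreal (W y + g y)"
      by (subst ennreal_plus) (auto simp: max_def ennreal_neg)
    finally show "2 \<le> ennreal (W y - g y) + ennreal (W y + g y)" by simp
  qed
  also have "\<dots> = (\<integral>\<^sup>+y. ennreal (W y - g y) \<partial>\<nu>) + (\<integral>\<^sup>+y. ennreal (W y + g y) \<partial>\<nu>)"
    by (rule nn_integral_add) auto
  also have "\<dots> \<le> (\<integral>\<^sup>+y. ennreal (W y - g y) \<partial>\<mu>1) + (\<integral>\<^sup>+y. ennreal (W y + g y) \<partial>\<mu>2)"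
    using sets le' by (intro add_mono nn_integral_mono_measure) auto
  also have "(\<integral>\<^sup>+y. ennreal (W y - g y) \<partial>\<mu>1) = ennreal (\<integral>y. W y - g y \<partial>\<mu>1)"
    using pos(1) W g by (intro nn_integral_eq_integral) auto
  also have "(\<integral>\<^sup>+y. ennreal (W y + g y) \<partial>\<mu>2) = ennreal (\<integral>y. W y + g y \<partial>\<mu>2)"
    using pos(2) W g by (intro nn_integral_eq_integral) auto
  also have "ennreal (\<integral>y. W y - g y \<partial>\<mu>1) + ennreal (\<integral>y. W y + g y \<partial>\<mu>2) =
      ennreal ((\<integral>y. W y - g y \<partial>\<mu>1) + (\<integral>y. W y + g y \<partial>\<mu>2))"
    using pos by (intro ennreal_plus[symmetric] integral_nonneg_AE)
  finally have "2 * \<epsilon> \<le> (\<integral>y. W y - g y \<partial>\<mu>1) + (\<integral>y. W y + g y \<partial>\<mu>2)"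
    using * by (simp add: ennreal_le_iff)
  thus ?thesis using W g by simp
qed

text \<open>Where \<open>V\<close> is large the drift contracts, elsewhere
  the common part of the two laws does.\<close>

lemma Harris_contraction:
  fixes V :: "'s \<Rightarrow> real" and K :: "'s \<Rightarrow> 's measure"
  assumes sets: "\<And>z. sets (K z) = sets \<nu>"
    and prob: "\<And>z. z \<in> S \<Longrightarrow> prob_space (K z)"
    and AE: "\<And>z. z \<in> S \<Longrightarrow> AE y in K z. y \<in> S"
    and V_nonneg: "\<And>z. V z \<ge> 0"
    and V_int: "\<And>z. z \<in> S \<Longrightarrow> integrable (K z) V"
    and drift: "\<And>z. z \<in> S \<Longrightarrow> (\<integral>y. V y \<partial>K z) \<le> \<delta> * V z + C"
    and minor: "\<And>z A. z \<in> S \<Longrightarrow> V z \<le> R \<Longrightarrow> A \<in> sets \<nu> \<Longrightarrow> emeasure \<nu> A \<le> emeasure (K z) A"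
    and mass: "emeasure \<nu> (space \<nu>) \<ge> ennreal \<epsilon>" and \<epsilon>: "\<epsilon> > 0"
    and \<delta>: "0 \<le> \<delta>" "\<delta> < 1" and C: "C \<ge> 0" and R: "R * (1 - \<delta>) > 2 * C" and "R > 0"
  shows "\<exists>\<alpha> \<beta>. 0 < \<alpha> \<and> \<alpha> < 1 \<and> \<beta> > 0 \<and>
    (\<forall>f c. f \<in> borel_measurable \<nu> \<longrightarrow> c \<ge> 0 \<longrightarrow>
       (\<forall>y\<in>S. \<forall>y'\<in>S. \<bar>f y - f y'\<bar> \<le> c * (2 + \<beta> * V y + \<beta> * V y')) \<longrightarrow>
       (\<forall>z\<in>S. \<forall>z'\<in>S. \<bar>(\<integral>y. f y \<partial>K z) - (\<integral>y. f y \<partial>K z')\<bar> \<le> \<alpha> * c * (2 + \<beta> * V z + \<beta> * V z')))"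
proof -
  \<comment> \<open>Small enough that the drift constant, entering as
    \<open>2 * \<beta> * C\<close>, eats at most half of the gain \<open>2 * \<epsilon>\<close> from
    the common part.\<close>
  define \<beta> where "\<beta> = \<epsilon> / (2 * (C + 1))"
  have \<beta>: "\<beta> > 0" "2 * \<beta> * C \<le> \<epsilon>"
    using \<epsilon> C by (auto simp: \<beta>_def field_simps)
  \<comment> \<open>The contraction factor on the line \<open>V z + V z' = R\<close>; above it the
    factor only falls, towards \<open>\<delta>\<close>. It is below one because
    \<open>R * (1 - \<delta>) > 2 * C\<close>.\<close>
  define \<alpha>1 where "\<alpha>1 = (2 + \<beta> * \<delta> * R + 2 * \<beta> * C) / (2 + \<beta> * R)"
  have den: "2 + \<beta> * R > 0" using \<beta> \<open>R > 0\<close> by (simp add: add_pos_pos)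
  have \<alpha>1: "\<alpha>1 < 1"
  proof -
    have "\<beta> * (2 * C) < \<beta> * (R * (1 - \<delta>))" using \<beta> R by (intro mult_strict_left_mono) auto
    thus ?thesis using den by (simp add: \<alpha>1_def field_simps)
  qed
  have \<alpha>1_pos: "\<alpha>1 > 0"
    using \<beta> \<delta> C \<open>R > 0\<close> den unfolding \<alpha>1_def by (intro divide_pos_pos add_pos_nonneg) auto
  have \<alpha>1_ge: "\<delta> \<le> \<alpha>1"
  proof -
    have "\<delta> * (2 + \<beta> * R) \<le> 2 + \<beta> * \<delta> * R + 2 * \<beta> * C"
      using \<delta> mult_nonneg_nonneg[OF less_imp_le[OF \<beta>(1)] C] by (simp add: algebra_simps)
    thus ?thesis using den by (simp add: \<alpha>1_def pos_le_divide_eq)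
  qed
  have \<alpha>1_eq: "\<alpha>1 * (2 + \<beta> * R) = 2 + \<beta> * \<delta> * R + 2 * \<beta> * C"
    using den by (simp add: \<alpha>1_def)
  define \<alpha> where "\<alpha> = max \<alpha>1 (max (1 - \<epsilon> / 2) \<delta>)"
  have \<alpha>: "0 < \<alpha>" "\<alpha> < 1" "\<alpha>1 \<le> \<alpha>" "1 - \<epsilon> / 2 \<le> \<alpha>" "\<delta> \<le> \<alpha>"
    using \<alpha>1 \<alpha>1_pos \<epsilon> \<delta> by (auto simp: \<alpha>_def)
  have one_sided: "(\<integral>y. f y \<partial>K z) - (\<integral>y. f y \<partial>K z') \<le> \<alpha> * c * (2 + \<beta> * V z + \<beta> * V z')"
    if f: "f \<in> borel_measurable \<nu>" and c: "c \<ge> 0"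
      and osc: "\<And>y y'. y \<in> S \<Longrightarrow> y' \<in> S \<Longrightarrow> \<bar>f y - f y'\<bar> \<le> c * (2 + \<beta> * V y + \<beta> * V y')"
      and z: "z \<in> S" "z' \<in> S" for f c z z'
  proof -
    define W where "W = (\<lambda>y. 1 + \<beta> * V y)"
    have W1: "W y \<ge> 1" for y using \<beta> V_nonneg by (simp add: W_def)
    have [measurable_cong]: "sets (K u) = sets \<nu>" for u by (rule sets)
    have f' [measurable]: "f \<in> borel_measurable (K u)" for u
      using f by simp
    have W_int: "integrable (K u) W" if "u \<in> S" for u
    proof -
      interpret prob_space "K u" using prob[OF that] .
      show ?thesis unfolding W_def using V_int[OF that] by auto
    qed
    have W_drift: "(\<integral>y. W y \<partial>K u) \<le> 1 + \<beta> * \<delta> * V u + \<beta> * C" if "u \<in> S" for u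
    proof -
      interpret prob_space "K u" using prob[OF that] .
      have "(\<integral>y. W y \<partial>K u) = 1 + \<beta> * (\<integral>y. V y \<partial>K u)"
        unfolding W_def using V_int[OF that] by (simp add: prob_space)
      also have "\<dots> \<le> 1 + \<beta> * (\<delta> * V u + C)"
        using drift[OF that] \<beta> by simp
      finally show ?thesis by (simp add: algebra_simps)
    qed
    have "\<exists>a. \<forall>y\<in>S. \<bar>f y - a\<bar> \<le> c * W y"
    proof (rule oscillation_centering)
      fix y y' assume "y \<in> S" "y' \<in> S"
      from osc[OF this] show "f y - f y' \<le> c * W y + c * W y'"
        by (simp add: W_def algebra_simps)
    qed (use z in auto)
    then obtain a where a: "\<And>y. y \<in> S \<Longrightarrow> \<bar>f y - a\<bar> \<le> c * W y" by blast
    have AE_a: "AE y in K u. \<bar>f y - a\<bar> \<le> c * W y" if "u \<in> S" for u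
      using AE[OF that] by eventually_elim (rule a)
    have fa_int: "integrable (K u) (\<lambda>y. f y - a)" if "u \<in> S" for u
      using integrable_mult_right[OF W_int[OF that], of c] AE_a[OF that] W1 c
      by (elim Bochner_Integration.integrable_bound) (auto elim!: eventually_mono intro: order_trans[OF _ abs_ge_self])
    have f_int: "integrable (K u) f" if "u \<in> S" for u
    proof -
      interpret prob_space "K u" using prob[OF that] .
      have "integrable (K u) (\<lambda>y. (f y - a) + a)"
        using fa_int[OF that] by (intro Bochner_Integration.integrable_add) auto
      thus ?thesis by simp
    qed
    have diff: "(\<integral>y. f y \<partial>K z) - (\<integral>y. f y \<partial>K z') = (\<integral>y. f y - a \<partial>K z) - (\<integral>y. f y - a \<partial>K z')"
    proof -
      interpret p1: prob_space "K z" using prob[OF z(1)] .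
      interpret p2: prob_space "K z'" using prob[OF z(2)] .
      show ?thesis using f_int z by (simp add: p1.prob_space p2.prob_space)
    qed
    have drift_sum: "(\<integral>y. W y \<partial>K z) + (\<integral>y. W y \<partial>K z') \<le> 2 + \<beta> * \<delta> * (V z + V z') + 2 * \<beta> * C"
      using W_drift[OF z(1)] W_drift[OF z(2)] by (simp add: algebra_simps)
    have key: "(\<integral>y. f y \<partial>K z) - (\<integral>y. f y \<partial>K z') \<le> c * B \<Longrightarrow> B \<le> \<alpha> * (2 + \<beta> * V z + \<beta> * V z') \<Longrightarrow> ?thesis" for B
      using mult_left_mono[OF _ c, of B "\<alpha> * (2 + \<beta> * V z + \<beta> * V z')"] by (simp add: mult_ac)
    show ?thesis
    proof (cases "V z + V z' \<ge> R")
      case True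
      show ?thesis
      proof (rule key)
        have "(\<integral>y. f y - a \<partial>K z) \<le> (\<integral>y. c * W y \<partial>K z)"
          using AE_a[OF z(1)] fa_int[OF z(1)] W_int[OF z(1)]
          by (intro integral_mono_AE) (auto elim!: eventually_mono)
        moreover have "(\<integral>y. - (c * W y) \<partial>K z') \<le> (\<integral>y. f y - a \<partial>K z')"
          using AE_a[OF z(2)] fa_int[OF z(2)] W_int[OF z(2)]
          by (intro integral_mono_AE) (auto elim!: eventually_mono)
        ultimately show "(\<integral>y. f y \<partial>K z) - (\<integral>y. f y \<partial>K z') \<le> c * ((\<integral>y. W y \<partial>K z) + (\<integral>y. W y \<partial>K z'))"
          unfolding diff by (simp add: algebra_simps)
        have "0 \<le> \<beta> * ((\<alpha>1 - \<delta>) * (V z + V z' - R))"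
          using True \<beta> \<alpha>1_ge by auto
        hence "2 + \<beta> * \<delta> * (V z + V z') + 2 * \<beta> * C \<le> \<alpha>1 * (2 + \<beta> * (V z + V z'))"
          using \<alpha>1_eq by (simp add: algebra_simps)
        also have "\<dots> \<le> \<alpha> * (2 + \<beta> * (V z + V z'))"
          using \<alpha> \<beta> V_nonneg[of z] V_nonneg[of z'] by (intro mult_right_mono) auto
        finally show "(\<integral>y. W y \<partial>K z) + (\<integral>y. W y \<partial>K z') \<le> \<alpha> * (2 + \<beta> * V z + \<beta> * V z')"
          using drift_sum by (simp add: algebra_simps)
      qed
    next
      case False
      \<comment> \<open>The sum is below \<open>R\<close> and both terms are nonnegative, so both
        laws dominate \<open>\<nu>\<close>.\<close>
      hence R': "V z \<le> R" "V z' \<le> R" using V_nonneg[of z] V_nonneg[of z'] by auto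
      show ?thesis
      proof (rule key)
        show "(\<integral>y. f y \<partial>K z) - (\<integral>y. f y \<partial>K z') \<le> c * ((\<integral>y. W y \<partial>K z) + (\<integral>y. W y \<partial>K z') - 2 * \<epsilon>)"
        \<comment> \<open>The normalisation \<open>g = (f - a) / c\<close> below excludes
          \<open>c = 0\<close>.\<close>
        proof (cases "c = 0")
          case True
          have "(\<integral>y. f y - a \<partial>K u) = 0" if "u \<in> S" for u
            using AE_a[OF that] True by (intro integral_eq_zero_AE) auto
          thus ?thesis unfolding diff using z True by simp
        next
          case False
          define g where "g = (\<lambda>y. (f y - a) / c)"
          have AE_g: "AE y in K u. \<bar>g y\<bar> \<le> W y" if "u \<in> S" for u
            using AE_a[OF that] by eventually_elim (use False c in \<open>auto simp: g_def field_simps\<close>)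
          have "(\<integral>y. g y \<partial>K z) - (\<integral>y. g y \<partial>K z') \<le> (\<integral>y. W y \<partial>K z) + (\<integral>y. W y \<partial>K z') - 2 * \<epsilon>"
            using z R' \<epsilon> mass W1
            by (intro common_part_contraction[of _ _ \<nu>] prob sets minor W_int AE_g) (auto simp: g_def intro!: fa_int)
          moreover have "(\<integral>y. g y \<partial>K u) = (\<integral>y. f y - a \<partial>K u) / c" for u
            unfolding g_def by simp
          ultimately show ?thesis unfolding diff using False c by (simp add: field_simps)
        qed
        have "2 * (1 - \<epsilon> / 2) + \<delta> * (\<beta> * (V z + V z')) \<le> \<alpha> * 2 + \<alpha> * (\<beta> * (V z + V z'))"
          using \<alpha> \<beta> V_nonneg[of z] V_nonneg[of z'] by (intro add_mono mult_right_mono) auto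
        thus "(\<integral>y. W y \<partial>K z) + (\<integral>y. W y \<partial>K z') - 2 * \<epsilon> \<le> \<alpha> * (2 + \<beta> * V z + \<beta> * V z')"
          using drift_sum \<beta>(2) by (simp add: algebra_simps)
      qed
    qed
  qed
  have "\<bar>(\<integral>y. f y \<partial>K z) - (\<integral>y. f y \<partial>K z')\<bar> \<le> \<alpha> * c * (2 + \<beta> * V z + \<beta> * V z')"
    if f: "f \<in> borel_measurable \<nu>" and c: "c \<ge> 0"
      and osc: "\<And>y y'. y \<in> S \<Longrightarrow> y' \<in> S \<Longrightarrow> \<bar>f y - f y'\<bar> \<le> c * (2 + \<beta> * V y + \<beta> * V y')"
      and z: "z \<in> S" "z' \<in> S" for f c z z'
    using one_sided[OF f c osc z] one_sided[OF f c osc z(2,1)] by (simp add: abs_le_iff algebra_simps)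
  thus ?thesis using \<alpha> \<beta> by (intro exI[of _ \<alpha>] exI[of _ \<beta>]) blast
qed

section \<open>Minorization on bounded sets\<close>

definition upd :: "real^'d \<Rightarrow> 'd \<Rightarrow> real \<Rightarrow> real^'d" where
  "upd x i y = x + (y - x $ i) *\<^sub>R axis i 1"

lemma upd_nth [simp]: "upd x i y $ j = (if j = i then y else x $ j)"
  by (simp add: upd_def axis_def)

lemma upd_measurable [measurable (raw)]:
  fixes f :: "'a \<Rightarrow> real^'d"
  assumes [measurable]: "f \<in> borel_measurable M" "g \<in> borel_measurable M"
  shows "(\<lambda>z. upd (f z) i (g z)) \<in> borel_measurable M"
proof -
  have "(\<lambda>z. f z $ i) = (\<lambda>z. f z \<bullet> axis i 1)" by (simp add: inner_axis)
  moreover have "(\<lambda>z. f z \<bullet> axis i 1) \<in> borel_measurable M"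
    by (intro borel_measurable_inner assms measurable_const) simp
  ultimately show ?thesis
    unfolding upd_def
    by (intro borel_measurable_add borel_measurable_scaleR borel_measurable_diff assms measurable_const) simp_all
qed

text \<open>An iterated integral over \<open>{-1..1}\<close> in the listed coordinates, the others
  kept from \<open>x\<close>. For a list of all coordinates it is Lebesgue measure on the cube,
  times two for each repetition. The list form matches the induction over coordinates.\<close>

primrec cube_integral :: "'d::finite list \<Rightarrow> (real^'d \<Rightarrow> ennreal) \<Rightarrow> real^'d \<Rightarrow> ennreal" where
  "cube_integral [] f x = f x"
| "cube_integral (i # is) f x = (\<integral>\<^sup>+y. indicator {-1..1} y * cube_integral is f (upd x i y) \<partial>lborel)"

text \<open>Listed coordinates are overwritten. Once the list exhausts the index type the value is
  the same for all \<open>x\<close>, which makes the minorizing measure common to all starting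
  points.\<close>

lemma cube_integral_cong:
  assumes "\<And>j. j \<notin> set is \<Longrightarrow> x $ j = x' $ j"
  shows "cube_integral is f x = cube_integral is f x'"
  using assms
proof (induction "is" arbitrary: x x')
  case Nil
  hence "x = x'" by (simp add: vec_eq_iff)
  thus ?case by simp
next
  case (Cons i "is")
  have "cube_integral is f (upd x i y) = cube_integral is f (upd x' i y)" for y
    using Cons.prems by (intro Cons.IH) auto
  thus ?case by simp
qed

lemma cube_integral_const: "cube_integral is (\<lambda>_. a) x = 2 ^ length is * a"
proof (induction "is" arbitrary: x)
  case (Cons i "is")
  have "cube_integral (i # is) (\<lambda>_. a) x = (\<integral>\<^sup>+y. (2 ^ length is * a) * indicator {-1..1::real} y \<partial>lborel)"
    by (simp add: Cons.IH mult_ac)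
  also have "\<dots> = 2 ^ length is * a * 2" by (subst nn_integral_cmult_indicator) auto
  finally show ?case by (simp add: mult_ac)
qed simp

lemma cube_integral_param:
  fixes F :: "'p \<Rightarrow> real^'d \<Rightarrow> ennreal"
  assumes F: "(\<lambda>(p,x). F p x) \<in> borel_measurable (N \<Otimes>\<^sub>M borel)"
  shows "(\<lambda>(p,x). cube_integral is (F p) x) \<in> borel_measurable (N \<Otimes>\<^sub>M borel)"
proof (induction "is")
  case Nil
  thus ?case using F by simp
next
  case (Cons i "is")
  have "(\<lambda>y. (fst (fst y), upd (snd (fst y)) i (snd y))) \<in> (N \<Otimes>\<^sub>M borel) \<Otimes>\<^sub>M lborel \<rightarrow>\<^sub>M N \<Otimes>\<^sub>M (borel :: (real^'d) measure)"
    by measurable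
  from measurable_compose[OF this Cons.IH]
  have [measurable]: "(\<lambda>(q, y). cube_integral is (F (fst q)) (upd (snd q) i y)) \<in> borel_measurable ((N \<Otimes>\<^sub>M borel) \<Otimes>\<^sub>M lborel)"
    by (simp add: case_prod_beta')
  have "(\<lambda>q. \<integral>\<^sup>+y. indicator {-1..1} y * cube_integral is (F (fst q)) (upd (snd q) i y) \<partial>lborel) \<in> borel_measurable (N \<Otimes>\<^sub>M borel)"
    by measurable
  thus ?case by (simp add: case_prod_beta')
qed

lemma cube_integral_param_sec:
  fixes F :: "'p \<Rightarrow> real^'d \<Rightarrow> ennreal"
  assumes F: "(\<lambda>(p,x). F p x) \<in> borel_measurable (N \<Otimes>\<^sub>M borel)"
    and [measurable]: "p \<in> measurable M N" "x \<in> borel_measurable M"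
  shows "(\<lambda>y. cube_integral is (F (p y)) (x y)) \<in> borel_measurable M"
proof -
  have "(\<lambda>y. (p y, x y)) \<in> M \<rightarrow>\<^sub>M N \<Otimes>\<^sub>M borel" by measurable
  from measurable_compose[OF this cube_integral_param[OF F]] show ?thesis by simp
qed

lemma cube_integral_measurable:
  assumes "f \<in> borel_measurable borel" "x \<in> borel_measurable M"
  shows "(\<lambda>y. cube_integral is f (x y)) \<in> borel_measurable M"
  by (rule cube_integral_param_sec[of "\<lambda>_. f" "borel :: real measure" "\<lambda>_. 0"])
     (use measurable_compose[OF measurable_snd assms(1)] assms(2) in \<open>simp_all add: case_prod_beta'\<close>)

lemma cube_integral_nn_integral:
  fixes F :: "'p \<Rightarrow> real^'d \<Rightarrow> ennreal"
  assumes F: "(\<lambda>(p,x). F p x) \<in> borel_measurable (N \<Otimes>\<^sub>M borel)" and N: "sigma_finite_measure N"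
  shows "cube_integral is (\<lambda>x. \<integral>\<^sup>+p. F p x \<partial>N) x = (\<integral>\<^sup>+p. cube_integral is (F p) x \<partial>N)"
proof (induction "is" arbitrary: x)
  case (Cons i "is")
  interpret N: sigma_finite_measure N by fact
  interpret pair_sigma_finite N "lborel :: real measure" ..
  have m: "(\<lambda>(p,y). indicator {-1..1} y * cube_integral is (F p) (upd x i y)) \<in> borel_measurable (N \<Otimes>\<^sub>M lborel)"
    unfolding case_prod_beta
    by (intro borel_measurable_times_ennreal cube_integral_param_sec[OF F]) measurable
  have m1: "(\<lambda>p. cube_integral is (F p) x) \<in> borel_measurable N" for x
    by (intro cube_integral_param_sec[OF F]) measurable
  have "cube_integral (i # is) (\<lambda>x. \<integral>\<^sup>+p. F p x \<partial>N) x =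
      (\<integral>\<^sup>+y. (\<integral>\<^sup>+p. indicator {-1..1} y * cube_integral is (F p) (upd x i y) \<partial>N) \<partial>lborel)"
    by (simp add: Cons.IH nn_integral_cmult m1)
  also have "\<dots> = (\<integral>\<^sup>+p. cube_integral (i # is) (F p) x \<partial>N)"
    using Fubini'[OF m] by simp
  finally show ?case .
qed simp

lemma cube_integral_suminf:
  fixes F :: "nat \<Rightarrow> real^'d \<Rightarrow> ennreal"
  assumes F: "\<And>i. F i \<in> borel_measurable borel"
  shows "cube_integral is (\<lambda>z. \<Sum>i. F i z) x = (\<Sum>i. cube_integral is (F i) x)"
proof -
  have "(\<lambda>(p,z). F p z) \<in> borel_measurable (count_space UNIV \<Otimes>\<^sub>M borel)"
    using F by (auto intro!: measurable_pair_measure_countable1)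
  from cube_integral_nn_integral[OF this sigma_finite_measure_count_space] show ?thesis
    by (simp add: nn_integral_count_space_nat)
qed

text \<open>A shift by \<open>s \<in> {0..1}\<close> keeps \<open>{-1..1}\<close> inside
  \<open>{-2..2}\<close>. So the longer interval produced by \<open>spread_coordinate\<close> pays
  for the random first flight of the next step.\<close>

lemma nn_integral_average_shift:
  assumes [measurable]: "h \<in> borel_measurable borel"
  shows "(\<integral>\<^sup>+y. indicator {-1..1} y * h y \<partial>lborel) \<le>
    (\<integral>\<^sup>+y. indicator {-2..2} y * (\<integral>\<^sup>+s. indicator {0..1::real} s * h (y - s) \<partial>lborel) \<partial>lborel)"
proof -
  have "(\<integral>\<^sup>+y. indicator {-1..1} y * h y \<partial>lborel) =
     (\<integral>\<^sup>+s. indicator {0..1::real} s * (\<integral>\<^sup>+y. indicator {-1..1} y * h y \<partial>lborel) \<partial>lborel)"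
    by (subst nn_integral_multc) auto
  also have "\<dots> \<le> (\<integral>\<^sup>+s. indicator {0..1::real} s * (\<integral>\<^sup>+y. indicator {-2..2} y * h (y - s) \<partial>lborel) \<partial>lborel)"
  proof (intro nn_integral_mono)
    fix s :: real
    have "(\<integral>\<^sup>+y. indicator {-1..1} y * h y \<partial>lborel) = (\<integral>\<^sup>+y. indicator {-1..1} (y - s) * h (y - s) \<partial>lborel)"
      using nn_integral_real_affine[of "\<lambda>y. indicator {-1..1} y * h y" 1 "-s"] by simp
    also have "\<dots> \<le> (\<integral>\<^sup>+y. indicator {-2..2} y * h (y - s) \<partial>lborel)" if "s \<in> {0..1}"
      using that by (intro nn_integral_mono mult_right_mono) (auto simp: indicator_def)
    finally show "indicator {0..1} s * (\<integral>\<^sup>+y. indicator {-1..1} y * h y \<partial>lborel) \<le>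
        indicator {0..1} s * (\<integral>\<^sup>+y. indicator {-2..2} y * h (y - s) \<partial>lborel)"
      by (auto simp: indicator_def)
  qed
  also have "\<dots> = (\<integral>\<^sup>+s. (\<integral>\<^sup>+y. indicator {0..1::real} s * (indicator {-2..2} y * h (y - s)) \<partial>lborel) \<partial>lborel)"
    by (intro nn_integral_cong nn_integral_cmult[symmetric]) measurable
  also have "\<dots> = (\<integral>\<^sup>+y. (\<integral>\<^sup>+s. indicator {0..1::real} s * (indicator {-2..2} y * h (y - s)) \<partial>lborel) \<partial>lborel)"
    by (rule lborel_pair.Fubini') measurable
  also have "\<dots> = (\<integral>\<^sup>+y. indicator {-2..2} y * (\<integral>\<^sup>+s. indicator {0..1::real} s * h (y - s) \<partial>lborel) \<partial>lborel)"
    by (simp add: nn_integral_cmult[symmetric] mult.left_commute)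
  finally show ?thesis .
qed

section \<open>Spreading the law over all coordinates\<close>

context coordinate_sampler
begin

lemma jump_op_ge:
  assumes "w \<in> Vset" "q \<le> rate gU lr x v * rate gU lr x (- w) / total_rate gU lr x"
  shows "ennreal q * f (x, w) \<le> jump_op f (x, v)"
proof -
  have "ennreal q * f (x, w) \<le> ennreal (rate gU lr x v * rate gU lr x (- w) / total_rate gU lr x) * f (x, w)"
    using assms by (intro mult_right_mono ennreal_leI) auto
  also have "\<dots> \<le> jump_op f (x, v)"
    unfolding jump_op_def prod.case using assms(1) by (intro member_le_sum) auto
  finally show ?thesis .
qed

lemma Qk_le_PP: "Q n t f z \<le> PP t f z"
  unfolding PP_def using sum_le_suminf[of "\<lambda>n. Q n t f z" "{n}"] by simp

text \<open>Jumping to \<open>axis i 1\<close> during the first time unit and then once to \<open>axis i (-1)\<close>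
  spreads coordinate \<open>i\<close> over an interval.\<close>

lemma spread_coordinate:
  assumes R: "R \<ge> 0"
  shows "\<exists>c>0. \<forall>x v i f. (\<forall>j. \<bar>x $ j\<bar> \<le> R) \<longrightarrow> v \<in> Vset \<longrightarrow> f \<in> borel_measurable borel \<longrightarrow>
    ennreal c * (\<integral>\<^sup>+s. indicator {0..1} s * (\<integral>\<^sup>+y. indicator {-2..2} y *
        f (upd (x + s *\<^sub>R v) i y, axis i (-1)) \<partial>lborel) \<partial>lborel) \<le> PP (R + 4) f (x, v)"
proof -
  \<comment> \<open>All positions stay in this ball: the initial norm is at most
    \<open>d * R\<close> and the distance travelled is at most \<open>R + 4\<close>.\<close>
  define B where "B = real CARD('d) * R + (R + 4)"
  obtain M where M: "M > 0" "\<And>x v. norm x \<le> B \<Longrightarrow> v \<in> Vset \<Longrightarrow> rate gU lr x v \<le> M"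
    using rate_bounded by blast
  \<comment> \<open>A lower bound for every jump coefficient: two rates of at least
    \<open>lr\<close> over a total rate of at most \<open>2 d M\<close>.\<close>
  define q where "q = lr * lr / (2 * real CARD('d) * M)"
  define e where "e = exp (- (M * (R + 4)))"
  have q: "q > 0" using lr_pos M(1) by (simp add: q_def)
  have e: "e > 0" by (simp add: e_def)
  have J: "ennreal q * f (x, w) \<le> jump_op f (x, v)" if "norm x \<le> B" "v \<in> Vset" "w \<in> Vset" for f x v w
  proof (rule jump_op_ge[OF that(3)])
    have "total_rate gU lr x \<le> (\<Sum>w\<in>(Vset :: (real^'d) set). M)"
      unfolding total_rate_def by (intro sum_mono M that)
    thus "q \<le> rate gU lr x v * rate gU lr x (- w) / total_rate gU lr x"
      unfolding q_def using lr_pos rate_ge total_rate_pos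
      by (intro frac_le mult_mono mult_nonneg_nonneg less_imp_le[OF rate_pos]) (auto simp: card_Vset)
  qed
  have Q0: "ennreal e * f (x + s *\<^sub>R v, v) \<le> Q 0 s f (x, v)"
    if "norm x + s \<le> B" "v \<in> Vset" "0 \<le> s" "s \<le> R + 4" for f x s v
  proof -
    have "cum_rate gU lr x v s \<le> M * s"
    proof (rule cum_rate_le)
      fix r assume "0 \<le> r" "r \<le> s"
      hence "norm (x + r *\<^sub>R v) \<le> B"
        using norm_triangle_ineq[of x "r *\<^sub>R v"] that norm_Vset[of v] by simp
      thus "rate gU lr (x + r *\<^sub>R v) v \<le> M" using that by (intro M)
    qed fact
    also have "\<dots> \<le> M * (R + 4)" using M(1) that by simp
    finally show ?thesis
      by (simp add: Qk_0 e_def) (intro mult_right_mono ennreal_leI, auto)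
  qed
  have QJ: "ennreal (e * q) * f (x + s *\<^sub>R v, w) \<le> Q 0 s (jump_op f) (x, v)"
    if "norm x + s \<le> B" "v \<in> Vset" "w \<in> Vset" "0 \<le> s" "s \<le> R + 4" for f x s v w
  proof -
    have "norm (x + s *\<^sub>R v) \<le> B"
      using norm_triangle_ineq[of x "s *\<^sub>R v"] that norm_Vset[of v] by simp
    hence "ennreal e * (ennreal q * f (x + s *\<^sub>R v, w)) \<le> ennreal e * jump_op f (x + s *\<^sub>R v, v)"
      using that by (intro mult_left_mono J) auto
    also have "\<dots> \<le> Q 0 s (jump_op f) (x, v)" by (rule Q0) fact+
    finally show ?thesis using e q by (simp add: ennreal_mult mult.assoc)
  qed
  \<comment> \<open>Two flights ending in a jump give \<open>e * q\<close> each, the last flight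
    gives \<open>e\<close>, and the \<open>2\<close> is the Jacobian of trading an event time for a
    coordinate.\<close>
  define c where "c = e * q * (e * q * e / 2)"
  have c: "c > 0" using e q by (simp add: c_def)
  have "ennreal c * (\<integral>\<^sup>+s. indicator {0..1} s * (\<integral>\<^sup>+y. indicator {-2..2} y *
        f (upd (x + s *\<^sub>R v) i y, axis i (-1)) \<partial>lborel) \<partial>lborel) \<le> PP (R + 4) f (x, v)"
    if x: "\<And>j. \<bar>x $ j\<bar> \<le> R" and v: "v \<in> Vset" and f: "f \<in> borel_measurable borel" for x v i f
  proof -
    have nx: "norm x \<le> real CARD('d) * R"
      using norm_le_l1_cart[of x] sum_bounded_above[of UNIV "\<lambda>j. \<bar>x $ j\<bar>" R] x by simp
    define h where "h = (\<lambda>s y. indicator {-2..2} y * f (upd (x + s *\<^sub>R v) i y, axis i (-1)))"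
    have pairm: "(\<lambda>z. (upd (x + fst z *\<^sub>R v) i (snd z), axis i (-1) :: real^'d)) \<in>
        borel_measurable (lborel \<Otimes>\<^sub>M lborel)"
      unfolding borel_prod[symmetric] by measurable
    have hm2: "(\<lambda>(s,y). h s y) \<in> borel_measurable (lborel \<Otimes>\<^sub>M lborel)"
      using measurable_compose[OF pairm f] by (simp add: h_def case_prod_beta')
    have hm [measurable]: "h s \<in> borel_measurable borel" for s
      using param_sec[OF hm2, of s] by simp
    have inner: "ennreal (e * q * e / 2) * (\<integral>\<^sup>+y. h s y \<partial>lborel) \<le> Q 1 (R + 4 - s) f (x + s *\<^sub>R v, axis i 1)"
      if s: "s \<in> {0..1}" for s
    proof -
      let ?x = "x + s *\<^sub>R v" and ?t = "R + 4 - s"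
      have nx': "norm ?x \<le> norm x + s"
        using norm_triangle_ineq[of x "s *\<^sub>R v"] s norm_Vset[OF v] by simp
      have "\<bar>?x $ i\<bar> \<le> \<bar>x $ i\<bar> + \<bar>s * v $ i\<bar>" by simp
      also have "\<bar>s * v $ i\<bar> \<le> 1 * 1"
        unfolding abs_mult using component_le_norm_cart[of v i] norm_Vset[OF v] s by (intro mult_mono) auto
      finally have xi: "\<bar>?x $ i\<bar> \<le> R + 1" using x[of i] by simp
      \<comment> \<open>Going up for time \<open>r\<close> and down for \<open>?t - r\<close> ends
        at coordinate \<open>?x $ i - ?t + 2 * r\<close>, so this coordinate is the new
        variable.\<close>
      have "ennreal (e * q * e / 2) * (\<integral>\<^sup>+y. h s y \<partial>lborel) =
          ennreal (e * q * e / 2) * (ennreal 2 * (\<integral>\<^sup>+r. h s (?x $ i - ?t + 2 * r) \<partial>lborel))"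
        using nn_integral_real_affine[OF hm, of 2 s "?x $ i - ?t"] by simp
      also have "\<dots> = ennreal (e * q * e) * (\<integral>\<^sup>+r. h s (?x $ i - ?t + 2 * r) \<partial>lborel)"
        using e q by (subst mult.assoc[symmetric], subst ennreal_mult[symmetric]) auto
      also have "\<dots> = (\<integral>\<^sup>+r. ennreal (e * q * e) * h s (?x $ i - ?t + 2 * r) \<partial>lborel)"
        by (rule nn_integral_cmult[symmetric]) measurable
      also have "\<dots> \<le> (\<integral>\<^sup>+r. indicator {0..?t} r * Q 0 r (jump_op (Q 0 (?t - r) f)) (?x, axis i 1) \<partial>lborel)"
      proof (intro nn_integral_mono)
        fix r :: real
        show "ennreal (e * q * e) * h s (?x $ i - ?t + 2 * r) \<le>
            indicator {0..?t} r * Q 0 r (jump_op (Q 0 (?t - r) f)) (?x, axis i 1)"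
        proof (cases "?x $ i - ?t + 2 * r \<in> {-2..2}")
          case True
          \<comment> \<open>The origin of \<open>R + 4\<close>: a target in \<open>{-2..2}\<close>
            and a start with \<open>\<bar>?x $ i\<bar> \<le> R + 1\<close> differ by at most
            \<open>R + 3\<close>, hence by at most \<open>?t\<close>.\<close>
          hence r: "0 \<le> r" "r \<le> ?t" using xi s by auto
          have bd: "norm ?x + r \<le> B" using nx' nx s r by (simp add: B_def)
          have bd': "norm (?x + r *\<^sub>R axis i 1) + (?t - r) \<le> B"
            using norm_triangle_ineq[of ?x "r *\<^sub>R axis i 1"] nx' nx s r by (simp add: B_def)
          have eq: "?x + r *\<^sub>R axis i 1 + (?t - r) *\<^sub>R axis i (-1) = upd ?x i (?x $ i - ?t + 2 * r)"
            by (simp add: vec_eq_iff axis_def)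
          have "ennreal (e * q * e) * h s (?x $ i - ?t + 2 * r) =
              ennreal (e * q) * (ennreal e * f (?x + r *\<^sub>R axis i 1 + (?t - r) *\<^sub>R axis i (-1), axis i (-1)))"
            using True e q unfolding eq by (simp add: h_def ennreal_mult mult.assoc)
          also have "\<dots> \<le> ennreal (e * q) * Q 0 (?t - r) f (?x + r *\<^sub>R axis i 1, axis i (-1))"
            using r s by (intro mult_left_mono Q0 bd') auto
          also have "\<dots> \<le> Q 0 r (jump_op (Q 0 (?t - r) f)) (?x, axis i 1)"
            using r s by (intro QJ bd) auto
          finally show ?thesis using r by simp
        qed (simp add: h_def)
      qed
      also have "\<dots> = Q 1 ?t f (?x, axis i 1)" unfolding One_nat_def Qk_Suc ..
      finally show ?thesis .
    qed
    have "ennreal c * (\<integral>\<^sup>+s. indicator {0..1} s * (\<integral>\<^sup>+y. h s y \<partial>lborel) \<partial>lborel) =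
        (\<integral>\<^sup>+s. ennreal c * (indicator {0..1} s * (\<integral>\<^sup>+y. h s y \<partial>lborel)) \<partial>lborel)"
      using lborel.borel_measurable_nn_integral[OF hm2] by (intro nn_integral_cmult[symmetric]) auto
    also have "\<dots> \<le> (\<integral>\<^sup>+s. indicator {0..R+4} s * Q 0 s (jump_op (Q 1 (R + 4 - s) f)) (x, v) \<partial>lborel)"
    proof (intro nn_integral_mono)
      fix s :: real
      show "ennreal c * (indicator {0..1} s * (\<integral>\<^sup>+y. h s y \<partial>lborel)) \<le>
          indicator {0..R+4} s * Q 0 s (jump_op (Q 1 (R + 4 - s) f)) (x, v)"
      proof (cases "s \<in> {0..1}")
        case True
        have "ennreal c * (\<integral>\<^sup>+y. h s y \<partial>lborel) = ennreal (e * q) * (ennreal (e * q * e / 2) * (\<integral>\<^sup>+y. h s y \<partial>lborel))"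
          unfolding c_def using e q by (subst ennreal_mult) (auto simp: mult.assoc)
        also have "\<dots> \<le> ennreal (e * q) * Q 1 (R + 4 - s) f (x + s *\<^sub>R v, axis i 1)"
          by (intro mult_left_mono inner True) auto
        also have "\<dots> \<le> Q 0 s (jump_op (Q 1 (R + 4 - s) f)) (x, v)"
          using True nx R v by (intro QJ) (auto simp: B_def)
        finally show ?thesis using True R by simp
      qed simp
    qed
    also have "\<dots> = Q (Suc 1) (R + 4) f (x, v)" unfolding Qk_Suc[of 1] ..
    also have "\<dots> \<le> PP (R + 4) f (x, v)" by (rule Qk_le_PP)
    finally show ?thesis by (simp add: h_def)
  qed
  thus ?thesis using c by blast
qed

text \<open>Each spread leaves the process with velocity \<open>axis i (-1)\<close>, and the next
  one begins with a flight of random length in \<open>{0..1}\<close>. This flight is therefore built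
  into the statement, and \<open>nn_integral_average_shift\<close> absorbs it in the
  induction.\<close>

lemma spread_coordinates:
  assumes "is \<noteq> []" "R \<ge> 0"
  shows "\<exists>c T. c > 0 \<and> T > 0 \<and> (\<forall>x v f. (\<forall>j. \<bar>x $ j\<bar> \<le> R) \<longrightarrow> v \<in> Vset \<longrightarrow> f \<in> borel_measurable borel \<longrightarrow>
    ennreal c * (\<integral>\<^sup>+s. indicator {0..1} s * cube_integral is (\<lambda>x. f (x, axis (last is) (-1))) (x + s *\<^sub>R v) \<partial>lborel)
      \<le> PP T f (x, v))"
  using assms
proof (induction "is" arbitrary: R rule: list_nonempty_induct)
  case (single i)
  from spread_coordinate[OF single] obtain c where c: "c > 0"
    "\<And>x v i f. \<lbrakk>\<And>j. \<bar>x $ j\<bar> \<le> R; v \<in> Vset; f \<in> borel_measurable borel\<rbrakk> \<Longrightarrow>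
    ennreal c * (\<integral>\<^sup>+s. indicator {0..1} s * (\<integral>\<^sup>+y. indicator {-2..2} y *
        f (upd (x + s *\<^sub>R v) i y, axis i (-1)) \<partial>lborel) \<partial>lborel) \<le> PP (R + 4) f (x, v)" by blast
  have "ennreal c * (\<integral>\<^sup>+s. indicator {0..1} s * cube_integral [i] (\<lambda>x. f (x, axis (last [i]) (-1))) (x + s *\<^sub>R v) \<partial>lborel)
      \<le> PP (R + 4) f (x, v)" if "\<And>j. \<bar>x $ j\<bar> \<le> R" "v \<in> Vset" "f \<in> borel_measurable borel" for x v f
  proof -
    have "ennreal c * (\<integral>\<^sup>+s. indicator {0..1} s * cube_integral [i] (\<lambda>x. f (x, axis (last [i]) (-1))) (x + s *\<^sub>R v) \<partial>lborel)
      \<le> ennreal c * (\<integral>\<^sup>+s. indicator {0..1} s * (\<integral>\<^sup>+y. indicator {-2..2} y *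
        f (upd (x + s *\<^sub>R v) i y, axis i (-1)) \<partial>lborel) \<partial>lborel)"
      by (auto intro!: mult_left_mono nn_integral_mono mult_right_mono simp: indicator_def)
    also have "\<dots> \<le> PP (R + 4) f (x, v)" by (rule c) fact+
    finally show ?thesis .
  qed
  thus ?case using c(1) single by (intro exI[of _ c] exI[of _ "R + 4"]) auto
next
  case (cons i "is")
  obtain c where c: "c > 0"
    "\<And>x v i f. \<lbrakk>\<And>j. \<bar>x $ j\<bar> \<le> R; v \<in> Vset; f \<in> borel_measurable borel\<rbrakk> \<Longrightarrow>
    ennreal c * (\<integral>\<^sup>+s. indicator {0..1} s * (\<integral>\<^sup>+y. indicator {-2..2} y *
        f (upd (x + s *\<^sub>R v) i y, axis i (-1)) \<partial>lborel) \<partial>lborel) \<le> PP (R + 4) f (x, v)"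
    using spread_coordinate[OF cons.prems] by blast
  \<comment> \<open>The first flight moves each coordinate by at most one and the spread puts
    coordinate \<open>i\<close> in \<open>{-2..2}\<close>; \<open>R + 2\<close> covers both.\<close>
  have "R + 2 \<ge> 0" using cons.prems by simp
  from cons.IH[OF this] obtain c' T where c': "c' > 0" "T > 0"
    "\<And>x v f. \<lbrakk>\<And>j. \<bar>x $ j\<bar> \<le> R + 2; v \<in> Vset; f \<in> borel_measurable borel\<rbrakk> \<Longrightarrow>
      ennreal c' * (\<integral>\<^sup>+s. indicator {0..1} s * cube_integral is (\<lambda>x. f (x, axis (last is) (-1))) (x + s *\<^sub>R v) \<partial>lborel)
      \<le> PP T f (x, v)" by blast
  have "ennreal (c * c') * (\<integral>\<^sup>+s. indicator {0..1} s *
      cube_integral (i # is) (\<lambda>x. f (x, axis (last (i # is)) (-1))) (x + s *\<^sub>R v) \<partial>lborel)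
      \<le> PP (R + 4 + T) f (x, v)"
    if x: "\<And>j. \<bar>x $ j\<bar> \<le> R" and v: "v \<in> Vset" and f: "f \<in> borel_measurable borel" for x v f
  proof -
    define G where "G = cube_integral is (\<lambda>x. f (x, axis (last is) (-1)))"
    have G_measurable [measurable]: "G \<in> borel_measurable borel"
      unfolding G_def
      by (intro cube_integral_measurable measurable_compose[OF borel_measurable_continuous_onI f])
         (auto intro!: continuous_intros)
    have *: "(\<integral>\<^sup>+y. indicator {-1..1} y * G (upd (x + s *\<^sub>R v) i y) \<partial>lborel) * ennreal c' \<le>
        (\<integral>\<^sup>+y. indicator {-2..2} y * PP T f (upd (x + s *\<^sub>R v) i y, axis i (-1)) \<partial>lborel)"
      if s: "s \<in> {0..1}" for s
    proof -
      have upd_shift: "upd (x + s *\<^sub>R v) i (y - r) = upd (x + s *\<^sub>R v) i y + r *\<^sub>R axis i (-1)" for y r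
        by (simp add: vec_eq_iff axis_def)
      have "(\<integral>\<^sup>+y. indicator {-1..1} y * G (upd (x + s *\<^sub>R v) i y) \<partial>lborel) * ennreal c' \<le>
          (\<integral>\<^sup>+y. indicator {-2..2} y * (\<integral>\<^sup>+r. indicator {0..1::real} r *
             G (upd (x + s *\<^sub>R v) i (y - r)) \<partial>lborel) \<partial>lborel) * ennreal c'"
        by (intro mult_right_mono nn_integral_average_shift) auto
      also have "\<dots> = (\<integral>\<^sup>+y. (indicator {-2..2} y * (\<integral>\<^sup>+r. indicator {0..1::real} r *
             G (upd (x + s *\<^sub>R v) i (y - r)) \<partial>lborel)) * ennreal c' \<partial>lborel)"
        by (rule nn_integral_multc[symmetric]) measurable
      also have "\<dots> \<le> (\<integral>\<^sup>+y. indicator {-2..2} y * PP T f (upd (x + s *\<^sub>R v) i y, axis i (-1)) \<partial>lborel)"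
      proof (intro nn_integral_mono)
        fix y :: real
        have "ennreal c' * (\<integral>\<^sup>+r. indicator {0..1} r * G (upd (x + s *\<^sub>R v) i y + r *\<^sub>R axis i (-1)) \<partial>lborel) \<le>
          PP T f (upd (x + s *\<^sub>R v) i y, axis i (-1))" if y: "y \<in> {-2..2}"
          unfolding G_def
        proof (rule c'(3))
          fix j
          have "\<bar>s * v $ j\<bar> \<le> 1 * 1"
            unfolding abs_mult using component_le_norm_cart[of v j] norm_Vset[OF v] s by (intro mult_mono) auto
          hence "\<bar>x $ j + s * v $ j\<bar> \<le> R + 1" using x[of j] by linarith
          thus "\<bar>upd (x + s *\<^sub>R v) i y $ j\<bar> \<le> R + 2"
            using y cons.prems by auto
        qed (use f in auto)
        thus "indicator {-2..2} y * (\<integral>\<^sup>+r. indicator {0..1::real} r *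
             G (upd (x + s *\<^sub>R v) i (y - r)) \<partial>lborel) * ennreal c' \<le>
          indicator {-2..2} y * PP T f (upd (x + s *\<^sub>R v) i y, axis i (-1))"
          unfolding upd_shift by (auto simp: indicator_def mult.commute)
      qed
      finally show ?thesis .
    qed
    have "ennreal (c * c') * (\<integral>\<^sup>+s. indicator {0..1} s *
      cube_integral (i # is) (\<lambda>x. f (x, axis (last (i # is)) (-1))) (x + s *\<^sub>R v) \<partial>lborel) =
      ennreal c * ((\<integral>\<^sup>+s. indicator {0..1} s * (\<integral>\<^sup>+y. indicator {-1..1} y * G (upd (x + s *\<^sub>R v) i y) \<partial>lborel) \<partial>lborel) * ennreal c')"
      using c(1) c'(1) cons.hyps by (simp add: G_def ennreal_mult mult_ac)
    also have "(\<integral>\<^sup>+s. indicator {0..1} s * (\<integral>\<^sup>+y. indicator {-1..1} y * G (upd (x + s *\<^sub>R v) i y) \<partial>lborel) \<partial>lborel) * ennreal c' =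
      (\<integral>\<^sup>+s. indicator {0..1} s * (\<integral>\<^sup>+y. indicator {-1..1} y * G (upd (x + s *\<^sub>R v) i y) \<partial>lborel) * ennreal c' \<partial>lborel)"
      by (rule nn_integral_multc[symmetric]) measurable
    also have "ennreal c * \<dots> \<le> ennreal c * (\<integral>\<^sup>+s. indicator {0..1} s * (\<integral>\<^sup>+y. indicator {-2..2} y *
        PP T f (upd (x + s *\<^sub>R v) i y, axis i (-1)) \<partial>lborel) \<partial>lborel)"
      using * by (intro mult_left_mono nn_integral_mono) (auto simp: indicator_def)
    also have "\<dots> \<le> PP (R + 4) (PP T f) (x, v)"
      by (intro c(2) x v PP_measurable f)
    also have "\<dots> = PP (R + 4 + T) f (x, v)"
      using c'(2) cons.prems by (intro PP_add_time[symmetric] f) auto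
    finally show ?thesis .
  qed
  thus ?case using c(1) c'(1,2) cons.prems by (intro exI[of _ "c * c'"] exI[of _ "R + 4 + T"]) auto
qed

lemma minorization:
  assumes R: "R \<ge> 0"
  shows "\<exists>T>0. \<exists>\<epsilon>>0. \<exists>\<nu> :: 'd state measure. sets \<nu> = sets borel \<and> emeasure \<nu> (space \<nu>) \<ge> ennreal \<epsilon> \<and>
    (\<forall>x v A. norm x \<le> R \<longrightarrow> v \<in> Vset \<longrightarrow> A \<in> sets borel \<longrightarrow> emeasure \<nu> A \<le> emeasure (K T (x, v)) A)"
proof -
  \<comment> \<open>Repetitions in the list only multiply the mass of the minorizing
    measure.\<close>
  obtain "is" :: "'d list" where "is": "set is = UNIV" using finite_list[OF finite[of UNIV]] by blast
  hence "is \<noteq> []" by auto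
  then obtain c T where cT: "c > 0" "T > 0" "\<And>x v f. \<lbrakk>\<And>j. \<bar>x $ j\<bar> \<le> R; v \<in> Vset; f \<in> borel_measurable borel\<rbrakk> \<Longrightarrow>
    ennreal c * (\<integral>\<^sup>+s. indicator {0..1} s * cube_integral is (\<lambda>x. f (x, axis (last is) (-1))) (x + s *\<^sub>R v) \<partial>lborel)
      \<le> PP T f (x, v)"
    using spread_coordinates[OF _ R] by blast
  \<comment> \<open>Up to a constant, Lebesgue measure on the cube with velocity
    \<open>axis (last is) (-1)\<close>; the base point \<open>0\<close> is arbitrary because every
    coordinate is overwritten.\<close>
  define L where "L = (\<lambda>f :: 'd state \<Rightarrow> ennreal. ennreal c * cube_integral is (\<lambda>x. f (x, axis (last is) (-1))) 0)"
  define \<nu> :: "'d state measure" where "\<nu> = measure_of UNIV (sets borel) (\<lambda>A. L (indicator A))"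
  have section_param: "(\<lambda>(p,x). F p (x, w)) \<in> borel_measurable (N \<Otimes>\<^sub>M borel)"
    if F: "(\<lambda>(p,z). F p z) \<in> borel_measurable (N \<Otimes>\<^sub>M borel)" for F :: "real \<Rightarrow> 'd state \<Rightarrow> ennreal" and N and w
  proof -
    have "(\<lambda>(p, x :: real^'d). (p, x, w)) \<in> N \<Otimes>\<^sub>M borel \<rightarrow>\<^sub>M N \<Otimes>\<^sub>M borel \<Otimes>\<^sub>M borel" by measurable
    from measurable_compose[OF this[unfolded borel_prod] F] show ?thesis by (simp add: case_prod_beta')
  qed
  have state_section: "(\<lambda>x. f (x, w)) \<in> borel_measurable borel"
    if "f \<in> borel_measurable borel" for f :: "'d state \<Rightarrow> ennreal" and w
    by (rule measurable_compose[OF borel_measurable_continuous_onI that]) (intro continuous_intros)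
  have em: "emeasure \<nu> A = L (indicator A)" if A: "A \<in> sets borel" for A
    unfolding \<nu>_def
  proof (rule emeasure_measure_of_functional[OF _ _ _ _ _ A])
    fix F :: "real \<Rightarrow> 'd state \<Rightarrow> ennreal"
    assume F: "(\<lambda>(p,z). F p z) \<in> borel_measurable (lborel \<Otimes>\<^sub>M borel)"
    have "(\<lambda>p. cube_integral is (\<lambda>x. F p (x, axis (last is) (-1))) 0) \<in> borel_measurable lborel"
      by (rule cube_integral_param_sec[OF section_param[OF F]]) auto
    thus "L (\<lambda>z. \<integral>\<^sup>+p. F p z \<partial>lborel) = (\<integral>\<^sup>+p. L (F p) \<partial>lborel)"
      unfolding L_def cube_integral_nn_integral[OF section_param[OF F] sigma_finite_lborel]
      by (rule nn_integral_cmult[symmetric])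
  next
    fix F :: "nat \<Rightarrow> 'd state \<Rightarrow> ennreal" assume "\<And>i. F i \<in> borel_measurable borel"
    thus "L (\<lambda>z. \<Sum>i. F i z) = (\<Sum>i. L (F i))"
      unfolding L_def by (subst cube_integral_suminf) (auto intro: state_section)
  qed (auto simp: L_def cube_integral_const ennreal_mult_less_top power_less_top_ennreal)
  have sets_\<nu>: "sets \<nu> = sets borel" and space_\<nu>: "space \<nu> = UNIV"
    using sets.sigma_sets_eq[of "borel :: 'd state measure"] by (simp_all add: \<nu>_def)
  have mass: "emeasure \<nu> (space \<nu>) = ennreal (c * 2 ^ length is)"
    using cT(1) by (simp add: space_\<nu> em L_def indicator_def[abs_def] cube_integral_const ennreal_mult ennreal_power[symmetric])
  have le: "emeasure \<nu> A \<le> emeasure (K T (x, v)) A" if x: "norm x \<le> R" and v: "v \<in> Vset" and A: "A \<in> sets borel" for x v A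
  proof -
    have ind: "(indicator A :: 'd state \<Rightarrow> ennreal) \<in> borel_measurable borel" using A by simp
    have "cube_integral is (\<lambda>x. indicator A (x, axis (last is) (-1))) (x + s *\<^sub>R v) =
        cube_integral is (\<lambda>x. indicator A (x, axis (last is) (-1))) 0" for s
      by (rule cube_integral_cong) (simp add: "is")
    hence "L (indicator A) = ennreal c * (\<integral>\<^sup>+s. indicator {0..1::real} s *
        cube_integral is (\<lambda>x. indicator A (x, axis (last is) (-1))) (x + s *\<^sub>R v) \<partial>lborel)"
      by (simp add: L_def nn_integral_multc)
    also have "\<dots> \<le> PP T (indicator A) (x, v)"
      using order_trans[OF component_le_norm_cart x] by (intro cT(3) v ind)
    also have "\<dots> = emeasure (K T (x, v)) A"
      using cT(2) v A by (intro emeasure_K[symmetric]) auto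
    finally show ?thesis by (simp add: em A)
  qed
  show ?thesis
    using cT(1,2) sets_\<nu> mass le
    by (intro exI[of _ T] exI[of _ "c * 2 ^ length is"] exI[of _ \<nu>] conjI) auto
qed

end

section \<open>The drift condition\<close>

text \<open>After tilting by a small slope \<open>e\<close> the right derivative is strictly
  negative. At the infimum \<open>c\<close> of the points where the tilted function \<open>g\<close>
  is positive, either \<open>c = a\<close> or continuity from the left gives
  \<open>g c \<le> 0\<close>; the derivative then keeps \<open>g\<close> nonpositive just after
  \<open>c\<close>, a contradiction.\<close>

lemma right_derivative_nonpos_imp_le:
  fixes f :: "real \<Rightarrow> real"
  assumes "a \<le> b" and cont: "continuous_on {a..b} f"
    and deriv: "\<And>s. a \<le> s \<Longrightarrow> s < b \<Longrightarrow> \<exists>D\<le>0. (f has_real_derivative D) (at s within {s..b})"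
  shows "f b \<le> f a"
proof (rule ccontr)
  assume "\<not> f b \<le> f a"
  hence less: "f a < f b" by simp
  with \<open>a \<le> b\<close> have "a < b" by (cases "a = b") auto
  \<comment> \<open>Half the mean slope, so that \<open>g b\<close> stays positive.\<close>
  define e where "e = (f b - f a) / (2 * (b - a))"
  have e: "e > 0" using less \<open>a < b\<close> by (simp add: e_def)
  define g where "g = (\<lambda>s. f s - f a - e * (s - a))"
  have "e * (b - a) = (f b - f a) / 2" using \<open>a < b\<close> by (simp add: e_def field_simps)
  hence gb: "g b > 0" using less by (simp add: g_def)
  have g_cont: "continuous_on {a..b} g" unfolding g_def by (intro continuous_intros cont)
  define P where "P = {s \<in> {a..b}. g s > 0}"
  define c where "c = Inf P"
  have bP: "b \<in> P" using gb \<open>a < b\<close> by (simp add: P_def)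
  have bdd: "bdd_below P" by (rule bdd_belowI[of _ a]) (simp add: P_def)
  have ca: "a \<le> c" unfolding c_def using bP by (intro cInf_greatest) (auto simp: P_def)
  have cb: "c \<le> b" unfolding c_def by (rule cInf_lower[OF bP bdd])
  have below: "g s \<le> 0" if "a \<le> s" "s < c" for s
  proof (rule ccontr)
    assume "\<not> g s \<le> 0"
    hence "s \<in> P" using that cb by (auto simp: P_def)
    from cInf_lower[OF this bdd] that show False by (simp add: c_def)
  qed
  have gc: "g c \<le> 0"
  proof (cases "c = a")
    case True
    thus ?thesis by (simp add: g_def)
  next
    case False
    hence ac: "a < c" using ca by simp
    have "(g \<longlongrightarrow> g c) (at c within {a..b})"
      using g_cont ca cb unfolding continuous_on_def by simp
    hence 1: "(g \<longlongrightarrow> g c) (at c within {a..c})"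
      by (rule tendsto_within_subset) (use cb in auto)
    have 2: "at c within {a..c} \<noteq> bot"
      using ac by (simp add: at_within_Icc_at_left)
    have 3: "eventually (\<lambda>s. g s \<le> 0) (at c within {a..c})"
      unfolding eventually_at_filter using below by (intro always_eventually) auto
    show ?thesis by (rule tendsto_upperbound[OF 1 3 2])
  qed
  hence "c < b" using gb cb by (cases "c = b") auto
  from deriv[OF ca this] obtain D where D: "D \<le> 0" "(f has_real_derivative D) (at c within {c..b})" by blast
  have "(g has_real_derivative D - e) (at c within {c..b})"
    unfolding g_def by (auto intro!: derivative_eq_intros D(2))
  from has_real_derivative_neg_dec_right[OF this] D(1) e
  obtain d where d: "d > 0" "\<And>h. 0 < h \<Longrightarrow> c + h \<in> {c..b} \<Longrightarrow> h < d \<Longrightarrow> g (c + h) < g c" by auto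
  have "c + d / 2 \<le> s" if "s \<in> P" for s
  proof (rule ccontr)
    assume "\<not> c + d / 2 \<le> s"
    moreover have "c \<le> s" unfolding c_def by (rule cInf_lower[OF that bdd])
    moreover have "s \<noteq> c" using that gc by (auto simp: P_def)
    ultimately have "g (c + (s - c)) < g c" using that d(1) by (intro d(2)) (auto simp: P_def)
    thus False using gc that by (simp add: P_def)
  qed
  hence "c + d / 2 \<le> c" unfolding c_def using bP by (intro cInf_greatest) auto
  thus False using d(1) by simp
qed

text \<open>At a zero of \<open>h\<close> the quotient is taken from the right only, so
  \<open>max 0\<close> commutes with division by \<open>u - s > 0\<close> and a derivative exists.
  The disjunction records that a negative derivative can occur only where
  \<open>h s > 0\<close>.\<close>

lemma max_0_right_derivative:
  fixes h :: "real \<Rightarrow> real"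
  assumes h: "(h has_real_derivative D) (at s within {s..t})"
  shows "\<exists>D'. ((\<lambda>u. max 0 (h u)) has_real_derivative D') (at s within {s..t}) \<and>
    (D' = D \<and> h s > 0 \<or> D' \<ge> 0)"
proof -
  have cont: "(h \<longlongrightarrow> h s) (at s within {s..t})"
    using DERIV_continuous[OF h] by (simp add: continuous_within)
  consider "h s > 0" | "h s < 0" | "h s = 0" by linarith
  thus ?thesis
  proof cases
    case 1
    have "eventually (\<lambda>u. h u > 0) (at s within {s..t})" using order_tendstoD(1)[OF cont 1] .
    hence ev: "eventually (\<lambda>u. max 0 (h u) = h u) (at s within {s..t})" by eventually_elim simp
    have "((\<lambda>u. max 0 (h u)) has_real_derivative D) (at s within {s..t})"
      using h 1 by (subst has_field_derivative_cong_eventually[OF ev]) auto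
    thus ?thesis using 1 by auto
  next
    case 2
    have "eventually (\<lambda>u. h u < 0) (at s within {s..t})" using order_tendstoD(2)[OF cont 2] .
    hence ev: "eventually (\<lambda>u. max 0 (h u) = 0) (at s within {s..t})" by eventually_elim simp
    have "((\<lambda>u. max 0 (h u)) has_real_derivative 0) (at s within {s..t})"
      using 2 by (subst has_field_derivative_cong_eventually[OF ev]) auto
    thus ?thesis by auto
  next
    case 3
    have "((\<lambda>u. (h u - h s) / (u - s)) \<longlongrightarrow> D) (at s within {s..t})"
      using h by (simp add: has_field_derivative_iff)
    hence "((\<lambda>u. max 0 ((h u - h s) / (u - s))) \<longlongrightarrow> max 0 D) (at s within {s..t})"
      by (intro tendsto_intros)
    moreover have "eventually (\<lambda>u. max 0 ((h u - h s) / (u - s)) = (max 0 (h u) - max 0 (h s)) / (u - s)) (at s within {s..t})"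
      using 3 by (auto simp: eventually_at_filter max_def divide_simps)
    ultimately have "((\<lambda>u. (max 0 (h u) - max 0 (h s)) / (u - s)) \<longlongrightarrow> max 0 D) (at s within {s..t})"
      by (rule Lim_transform_eventually)
    thus ?thesis by (intro exI[of _ "max 0 D"]) (simp add: has_field_derivative_iff)
  qed
qed

text \<open>The global Lipschitz constant \<open>\<alpha>\<close> of the gradient serves near the
  origin and for the sublevel sets; the sharp Hessian bound outside \<open>r0\<close> serves the
  contraction. The gradient enters through its l1 norm because that is its share of
  \<open>total_rate\<close>.\<close>

locale coordinate_sampler_drift = coordinate_sampler_target gU lr U
  for gU :: "real^'d \<Rightarrow> real^'d" and lr :: real and U :: "real^'d \<Rightarrow> real" +
  fixes H :: "real^'d \<Rightarrow> real^'d^'d" and \<alpha> r0 :: real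
  assumes U_nonneg: "\<And>x. 0 \<le> U x"
    and hess: "\<And>x. (gU has_derivative (\<lambda>h. H x *v h)) (at x)"
    and \<alpha>_pos: "\<alpha> > 0"
    and H_bound: "\<And>x h. norm (H x *v h) \<le> \<alpha> * norm h"
    and H_far: "\<And>x h. norm x \<ge> r0 \<Longrightarrow> norm (H x *v h) \<le> lr\<^sup>2 / 4 * norm h"
    and gU_far: "\<And>x. norm x \<ge> r0 \<Longrightarrow> 27 * real CARD('d) * lr \<le> (\<Sum>i\<in>UNIV. \<bar>gU x $ i\<bar>)"
begin

abbreviation "V \<equiv> Vfun U gU lr"

lemma V_eq: "V (x, v) = exp (U x / 2) / sqrt (rate gU lr x (- v))"
  by (simp add: Vfun_def rate_def inner_commute add.commute)

lemma V_pos: "V z > 0"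
  using rate_pos by (cases z) (simp add: V_eq)

lemma V_continuous: "continuous_on S V"
  unfolding Vfun_def using lr_pos
  by (intro continuous_intros continuous_on_compose2[OF U_cont[of UNIV]] continuous_on_compose2[OF gU_cont])
     (auto simp: add_pos_nonneg[THEN less_imp_neq, symmetric])

lemma V_measurable [measurable]: "V \<in> borel_measurable borel"
  using V_continuous by (rule borel_measurable_continuous_onI)

text \<open>The ratio of the mean of \<open>V\<close> after a jump to \<open>exp (U x / 2)\<close>.\<close>

definition jump_ratio :: "real^'d \<Rightarrow> real" where
  "jump_ratio x = (\<Sum>w\<in>Vset. sqrt (rate gU lr x w)) / total_rate gU lr x"

text \<open>The jump weight \<open>rate gU lr x (- w)\<close> meets the denominator
  \<open>sqrt (rate gU lr x (- w))\<close> of \<open>V\<close> and leaves a square root. So the mean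
  after a jump depends on the position only, and a large total rate makes it small against
  \<open>exp (U x / 2)\<close>.\<close>

lemma jump_mean_V:
  "(\<Sum>w\<in>Vset. rate gU lr x (- w) / total_rate gU lr x * V (x, w)) = exp (U x / 2) * jump_ratio x"
proof -
  have "(\<Sum>w\<in>Vset. rate gU lr x (- w) / total_rate gU lr x * V (x, w)) =
      (\<Sum>w\<in>Vset. exp (U x / 2) * sqrt (rate gU lr x (- w)) / total_rate gU lr x)"
  proof (intro sum.cong refl)
    fix w :: "real^'d"
    define a where "a = sqrt (rate gU lr x (- w))"
    have "a > 0" "rate gU lr x (- w) = a * a"
      using rate_pos[of x "- w"] by (simp_all add: a_def)
    thus "rate gU lr x (- w) / total_rate gU lr x * V (x, w) =
        exp (U x / 2) * sqrt (rate gU lr x (- w)) / total_rate gU lr x"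
      unfolding V_eq a_def[symmetric] by simp
  qed
  also have "\<dots> = exp (U x / 2) * (\<Sum>w\<in>Vset. sqrt (rate gU lr x (- w))) / total_rate gU lr x"
    by (simp add: sum_divide_distrib sum_distrib_left)
  also have "(\<Sum>w\<in>Vset. sqrt (rate gU lr x (- w))) = (\<Sum>w\<in>Vset. sqrt (rate gU lr x w))"
    by (rule sum_Vset_uminus)
  finally show ?thesis by (simp add: jump_ratio_def)
qed

lemma jump_ratio_le: "sqrt lr * jump_ratio x \<le> 1"
proof -
  have "sqrt lr * (\<Sum>w\<in>Vset. sqrt (rate gU lr x w)) \<le> total_rate gU lr x"
    unfolding total_rate_def sum_distrib_left
  proof (intro sum_mono)
    fix w
    have "sqrt lr * sqrt (rate gU lr x w) \<le> sqrt (rate gU lr x w) * sqrt (rate gU lr x w)"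
      using rate_ge[of x w] lr_pos by (intro mult_right_mono) auto
    thus "sqrt lr * sqrt (rate gU lr x w) \<le> rate gU lr x w" using rate_pos[of x w] by simp
  qed
  thus ?thesis using total_rate_pos[of x] by (simp add: jump_ratio_def field_simps)
qed

lemma total_rate_eq: "total_rate gU lr x = 2 * real CARD('d) * lr + (\<Sum>i\<in>UNIV. \<bar>gU x $ i\<bar>)"
proof -
  have "rate gU lr x (axis i 1) + rate gU lr x (axis i (-1)) = 2 * lr + \<bar>gU x $ i\<bar>" for i
    by (simp add: rate_def inner_axis' )
  thus ?thesis unfolding total_rate_def sum_Vset by (simp add: sum.distrib)
qed

text \<open>Expanding \<open>(4 sqrt lr - sqrt r)^2 \<ge> 0\<close> bounds each term by
  \<open>2 lr + r / 8\<close>. Over \<open>2 d\<close> velocities this sums to \<open>4 d lr\<close>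
  plus an eighth of the total rate. The total rate is at least \<open>29 d lr\<close>, where 29 is
  27 from the gradient plus 2 from refreshment, and \<open>4/29 + 1/8 < 1/3\<close>.\<close>

lemma jump_ratio_far:
  assumes "norm x \<ge> r0"
  shows "sqrt lr * jump_ratio x \<le> 1 / 3"
proof -
  let ?n = "real CARD('d)"
  have L: "29 * ?n * lr \<le> total_rate gU lr x"
    using gU_far[OF assms] by (simp add: total_rate_eq mult_ac)
  have "sqrt lr * (\<Sum>w\<in>Vset. sqrt (rate gU lr x w)) \<le> (\<Sum>w\<in>(Vset :: (real^'d) set). 2 * lr + rate gU lr x w / 8)"
    unfolding sum_distrib_left
  proof (intro sum_mono)
    fix w
    have "0 \<le> (4 * sqrt lr - sqrt (rate gU lr x w))\<^sup>2" by simp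
    thus "sqrt lr * sqrt (rate gU lr x w) \<le> 2 * lr + rate gU lr x w / 8"
      using lr_pos rate_pos[of x w] by (simp add: power2_diff power_mult_distrib)
  qed
  also have "\<dots> = 4 * ?n * lr + total_rate gU lr x / 8"
    by (simp add: sum.distrib card_Vset total_rate_def sum_divide_distrib)
  also have "\<dots> \<le> total_rate gU lr x / 3" using L total_rate_pos[of x] by simp
  finally show ?thesis using total_rate_pos[of x] by (simp add: jump_ratio_def field_simps)
qed

text \<open>Meant for the right derivative \<open>D\<close> of \<open>V\<close> along the flow. The
  Hessian term is present only for \<open>gU x \<bullet> v < 0\<close>: otherwise the positive part
  in the denominator is zero and can only grow.\<close>

definition drift_bound :: "real^'d \<Rightarrow> real^'d \<Rightarrow> real \<Rightarrow> bool" where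
  "drift_bound x v D \<longleftrightarrow> D \<le> V (x, v) * ((gU x \<bullet> v) / 2 +
     (if gU x \<bullet> v < 0 then norm (H x *v v) / (2 * (lr - gU x \<bullet> v)) else 0))"

lemma V_path_right_derivative:
  assumes v: "v \<in> Vset"
  shows "\<exists>D. ((\<lambda>u. V (x + u *\<^sub>R v, v)) has_real_derivative D) (at s within {s..t}) \<and>
     drift_bound (x + s *\<^sub>R v) v D"
proof -
  define h where "h = (\<lambda>u. gU (x + u *\<^sub>R v) \<bullet> (- v))"
  let ?y = "x + s *\<^sub>R v"
  have "((\<lambda>u. gU (x + u *\<^sub>R v)) has_derivative (\<lambda>k. H ?y *v (k *\<^sub>R v))) (at s within {s..t})"
    by (rule has_derivative_compose[OF _ hess, of "\<lambda>u. x + u *\<^sub>R v"]) (auto intro!: derivative_eq_intros)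
  hence "(h has_derivative (\<lambda>k. (H ?y *v (k *\<^sub>R v)) \<bullet> (- v))) (at s within {s..t})"
    unfolding h_def by (rule has_derivative_inner_left)
  moreover have "(\<lambda>k. (H ?y *v (k *\<^sub>R v)) \<bullet> (- v)) = (*) ((H ?y *v v) \<bullet> (- v))"
    by (simp add: fun_eq_iff matrix_vector_mult_scaleR)
  ultimately have h: "(h has_real_derivative (H ?y *v v) \<bullet> (- v)) (at s within {s..t})"
    unfolding has_field_derivative_def by simp
  obtain D' where D': "((\<lambda>u. max 0 (h u)) has_real_derivative D') (at s within {s..t})"
    "D' = (H ?y *v v) \<bullet> (- v) \<and> h s > 0 \<or> D' \<ge> 0"
    using max_0_right_derivative[OF h] by blast
  let ?m = "lr + max 0 (h s)"
  have m: "?m > 0" using lr_pos by simp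
  let ?V = "V (?y, v)"
  have Veq: "V (x + u *\<^sub>R v, v) = exp (U (x + u *\<^sub>R v) / 2) / sqrt (lr + max 0 (h u))" for u
    by (simp add: Vfun_def h_def)
  have deriv: "((\<lambda>u. V (x + u *\<^sub>R v, v)) has_real_derivative ?V * ((gU ?y \<bullet> v) / 2 - D' / (2 * ?m))) (at s within {s..t})"
  proof -
    have 1: "((\<lambda>u. exp (U (x + u *\<^sub>R v) / 2)) has_real_derivative exp (U ?y / 2) * ((gU ?y \<bullet> v) / 2)) (at s within {s..t})"
      by (auto intro!: derivative_eq_intros U_path_deriv)
    have 2: "((\<lambda>u. sqrt (lr + max 0 (h u))) has_real_derivative (inverse (sqrt ?m) / 2) * D') (at s within {s..t})"
      by (rule DERIV_chain'[where f = "\<lambda>u. lr + max 0 (h u)" and g = sqrt])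
         (auto intro!: derivative_eq_intros D'(1) DERIV_real_sqrt m)
    have sq: "sqrt ?m * sqrt ?m = ?m" using m by simp
    have "((\<lambda>u. V (x + u *\<^sub>R v, v)) has_real_derivative
        (exp (U ?y / 2) * ((gU ?y \<bullet> v) / 2) * sqrt ?m - exp (U ?y / 2) * ((inverse (sqrt ?m) / 2) * D')) / (sqrt ?m * sqrt ?m))
        (at s within {s..t})"
      unfolding Veq by (rule DERIV_divide[OF 1 2]) (use m in auto)
    also have "(exp (U ?y / 2) * ((gU ?y \<bullet> v) / 2) * sqrt ?m - exp (U ?y / 2) * ((inverse (sqrt ?m) / 2) * D')) / (sqrt ?m * sqrt ?m)
       = ?V * ((gU ?y \<bullet> v) / 2 - D' / (2 * (sqrt ?m * sqrt ?m)))"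
    proof -
      have "(E * (g / 2) * r - E * ((inverse r / 2) * D')) / (r * r) = E / r * (g / 2 - D' / (2 * (r * r)))"
        if "r > 0" for E g r :: real
        using that by (simp add: field_simps)
      from this[of "sqrt ?m"] show ?thesis using m by (simp add: Vfun_def h_def)
    qed
    finally show ?thesis unfolding sq .
  qed
  have hs: "h s = - (gU ?y \<bullet> v)" by (simp add: h_def)
  \<comment> \<open>Only a decreasing denominator can raise \<open>V\<close>; then
    \<open>h s > 0\<close> and \<open>D'\<close> is, up to sign, the quadratic form of
    \<open>H\<close> at \<open>v\<close>.\<close>
  have "- D' / (2 * ?m) \<le> (if gU ?y \<bullet> v < 0 then norm (H ?y *v v) / (2 * (lr - gU ?y \<bullet> v)) else 0)"
  proof (cases "D' \<ge> 0")
    case True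
    hence "- D' / (2 * ?m) \<le> 0" using m by simp
    moreover have "0 \<le> (if gU ?y \<bullet> v < 0 then norm (H ?y *v v) / (2 * (lr - gU ?y \<bullet> v)) else 0)"
      using lr_pos by auto
    ultimately show ?thesis by linarith
  next
    case False
    hence D'': "D' = - ((H ?y *v v) \<bullet> v)" "h s > 0" using D'(2) by auto
    have "- D' \<le> norm (H ?y *v v)"
      using norm_cauchy_schwarz[of "H ?y *v v" v] norm_Vset[OF v] D''(1) by simp
    hence "- D' / (2 * ?m) \<le> norm (H ?y *v v) / (2 * ?m)" using m by (intro divide_right_mono) auto
    thus ?thesis using D''(2) hs by simp
  qed
  hence "?V * ((gU ?y \<bullet> v) / 2 - D' / (2 * ?m)) \<le> ?V * ((gU ?y \<bullet> v) / 2 +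
     (if gU ?y \<bullet> v < 0 then norm (H ?y *v v) / (2 * (lr - gU ?y \<bullet> v)) else 0))"
    using V_pos[of "(?y, v)"] by (intro mult_left_mono) auto
  thus ?thesis using deriv unfolding drift_bound_def by blast
qed

text \<open>Everything is divided by \<open>V\<close>, with \<open>a\<close> the slope of
  \<open>U\<close> along \<open>v\<close>. For \<open>a \<ge> 0\<close> the event rate is
  \<open>lr + a\<close> and the sum is at most
  \<open>a / 2 - 2 (lr + a) / 3 = - 2 lr / 3 - a / 6\<close>. For \<open>a < 0\<close> events come
  at rate \<open>lr\<close>, jumps contribute at most \<open>lr / 3 - a / 6 - lr\<close>, and the
  sum is at most \<open>a / 3 - 13 lr / 24\<close>.\<close>

lemma generator_far:
  assumes x: "norm x \<ge> r0" and v: "v \<in> Vset" and D: "drift_bound x v D"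
  shows "D + rate gU lr x v * (exp (U x / 2) * jump_ratio x - V (x, v)) \<le> - (lr / 2) * V (x, v)"
proof -
  define a where "a = gU x \<bullet> v"
  have eV: "exp (U x / 2) = V (x, v) * sqrt (rate gU lr x (- v))"
    using rate_pos[of x "- v"] by (simp add: V_eq)
  define \<kappa> where "\<kappa> = sqrt lr * jump_ratio x"
  have \<kappa>: "\<kappa> \<le> 1 / 3" unfolding \<kappa>_def by (rule jump_ratio_far[OF x])
  have jr: "jump_ratio x = \<kappa> / sqrt lr" using lr_pos by (simp add: \<kappa>_def)
  have \<kappa>0: "\<kappa> \<ge> 0"
    unfolding \<kappa>_def jump_ratio_def using lr_pos rate_pos total_rate_pos
    by (intro mult_nonneg_nonneg divide_nonneg_nonneg sum_nonneg) (auto intro: less_imp_le)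
  have "(if a < 0 then norm (H x *v v) / (2 * (lr - a)) else 0) \<le> lr / 8"
  proof (cases "a < 0")
    case True
    have "norm (H x *v v) / (2 * (lr - a)) \<le> (lr\<^sup>2 / 4) / (2 * lr)"
      using H_far[OF x, of v] norm_Vset[OF v] True lr_pos by (intro frac_le) auto
    also have "\<dots> = lr / 8" using lr_pos by (simp add: power2_eq_square)
    finally show ?thesis using True by simp
  qed (use lr_pos in simp)
  define b where "b = (if a < 0 then norm (H x *v v) / (2 * (lr - a)) else 0)"
  have b: "b \<le> lr / 8" "a \<ge> 0 \<Longrightarrow> b = 0" using \<open>(if a < 0 then _ else _) \<le> lr / 8\<close> by (auto simp: b_def)
  have "a / 2 + b + rate gU lr x v * (sqrt (rate gU lr x (- v)) * (\<kappa> / sqrt lr) - 1) \<le> - (lr / 2)"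
  proof (cases "a \<ge> 0")
    case True
    hence r: "rate gU lr x v = lr + a" "rate gU lr x (- v) = lr"
      by (auto simp: rate_def a_def inner_commute)
    have "(lr + a) * (\<kappa> - 1) \<le> (lr + a) * (1 / 3 - 1)"
      using True lr_pos \<kappa> by (intro mult_left_mono) auto
    thus ?thesis using r b(2) True lr_pos by (simp add: field_simps)
  next
    case False
    hence r: "rate gU lr x v = lr" "rate gU lr x (- v) = lr - a"
      by (auto simp: rate_def a_def inner_commute)
    \<comment> \<open>The bound \<open>sqrt (1 + u) \<le> 1 + u / 2\<close> makes the gain from a
      jump linear in \<open>a\<close>, with a coefficient that the decay \<open>a / 2\<close> along
      the flow outweighs.\<close>
    have "sqrt (lr - a) / sqrt lr = sqrt (1 + (- a / lr))"
      using lr_pos False by (simp add: real_sqrt_divide[symmetric] field_simps)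
    also have "\<dots> \<le> 1 + (- a / lr) / 2"
    proof (rule real_le_lsqrt)
      have "0 \<le> - a / lr" using lr_pos False by (intro divide_nonneg_pos) auto
      thus "0 \<le> 1 + (- a / lr) / 2" "1 + - a / lr \<le> (1 + (- a / lr) / 2)\<^sup>2"
        by (auto simp: power2_eq_square algebra_simps)
    qed
    finally have "sqrt (lr - a) / sqrt lr * \<kappa> \<le> (1 + (- a / lr) / 2) * (1 / 3)"
      using \<kappa> \<kappa>0 lr_pos False by (intro mult_mono) (auto simp: field_simps)
    hence "lr * (sqrt (lr - a) / sqrt lr * \<kappa>) \<le> lr * ((1 + (- a / lr) / 2) * (1 / 3))"
      using lr_pos by (intro mult_left_mono) auto
    also have "\<dots> = lr / 3 - a / 6" using lr_pos by (simp add: field_simps)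
    finally have "lr * (sqrt (lr - a) * (\<kappa> / sqrt lr) - 1) \<le> lr / 3 - a / 6 - lr"
      by (simp add: algebra_simps)
    thus ?thesis using r b(1) False lr_pos by simp
  qed
  hence "V (x, v) * (a / 2 + b + rate gU lr x v * (sqrt (rate gU lr x (- v)) * (\<kappa> / sqrt lr) - 1)) \<le> V (x, v) * - (lr / 2)"
    using V_pos[of "(x, v)"] by (intro mult_left_mono) auto
  moreover have "D \<le> V (x, v) * (a / 2 + b)" using D unfolding drift_bound_def a_def[symmetric] b_def .
  ultimately show ?thesis unfolding eV jr by (simp add: algebra_simps)
qed

lemma generator_bound:
  "\<exists>C\<ge>0. \<forall>x v D. v \<in> Vset \<longrightarrow> drift_bound x v D \<longrightarrow>
    D + rate gU lr x v * (exp (U x / 2) * jump_ratio x - V (x, v)) \<le> - (lr / 2) * V (x, v) + C"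
proof -
  \<comment> \<open>A continuous majorant, uniform in the velocity, of the generator term plus
    \<open>(lr / 2) * V\<close>; a bound for it on the ball of radius \<open>r0\<close> supplies the
    constant.\<close>
  define \<Phi> where "\<Phi> = (\<lambda>x. exp (U x / 2) / sqrt lr * (norm (gU x) / 2 + \<alpha> / (2 * lr) + lr / 2 + (norm (gU x) + lr)))"
  have "compact (\<Phi> ` cball 0 r0)"
    unfolding \<Phi>_def using lr_pos
    by (intro compact_continuous_image continuous_intros U_cont continuous_on_subset[OF gU_cont]) auto
  hence "bounded (\<Phi> ` cball 0 r0)" by (rule compact_imp_bounded)
  then obtain C where "\<And>y. y \<in> \<Phi> ` cball 0 r0 \<Longrightarrow> norm y \<le> C" unfolding bounded_iff by blast
  hence C: "\<Phi> x \<le> C" if "norm x \<le> r0" for x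
    using that by (force simp: abs_le_iff)
  have near: "D + rate gU lr x v * (exp (U x / 2) * jump_ratio x - V (x, v)) \<le> - (lr / 2) * V (x, v) + \<Phi> x"
    if v: "v \<in> Vset" and D: "drift_bound x v D" for x v D
  proof -
    have a: "\<bar>gU x \<bullet> v\<bar> \<le> norm (gU x)"
      using Cauchy_Schwarz_ineq2[of "gU x" v] norm_Vset[OF v] by simp
    have "(if gU x \<bullet> v < 0 then norm (H x *v v) / (2 * (lr - gU x \<bullet> v)) else 0) \<le> \<alpha> / (2 * lr)"
      using H_bound[of x v] norm_Vset[OF v] lr_pos \<alpha>_pos by (auto intro!: frac_le)
    hence "(gU x \<bullet> v) / 2 + (if gU x \<bullet> v < 0 then norm (H x *v v) / (2 * (lr - gU x \<bullet> v)) else 0) \<le>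
        norm (gU x) / 2 + \<alpha> / (2 * lr)" using a by linarith
    hence "V (x, v) * ((gU x \<bullet> v) / 2 + (if gU x \<bullet> v < 0 then norm (H x *v v) / (2 * (lr - gU x \<bullet> v)) else 0)) \<le>
       V (x, v) * (norm (gU x) / 2 + \<alpha> / (2 * lr))"
      using V_pos[of "(x, v)"] by (intro mult_left_mono) auto
    hence D': "D \<le> V (x, v) * (norm (gU x) / 2 + \<alpha> / (2 * lr))"
      using D by (simp add: drift_bound_def)
    have V: "V (x, v) \<le> exp (U x / 2) / sqrt lr"
      unfolding V_eq using rate_ge lr_pos rate_pos by (intro divide_left_mono mult_pos_pos) auto
    have "rate gU lr x v * (exp (U x / 2) * jump_ratio x - V (x, v)) \<le> rate gU lr x v * (exp (U x / 2) * jump_ratio x)"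
      using rate_pos[of x v] V_pos[of "(x, v)"] by (intro mult_left_mono) auto
    also have "\<dots> \<le> (norm (gU x) + lr) * (exp (U x / 2) * (1 / sqrt lr))"
    proof (intro mult_mono)
      show "rate gU lr x v \<le> norm (gU x) + lr" using a by (auto simp: rate_def inner_commute)
      show "jump_ratio x \<le> 1 / sqrt lr" using jump_ratio_le[of x] lr_pos by (simp add: field_simps)
      show "0 \<le> jump_ratio x" unfolding jump_ratio_def using rate_pos total_rate_pos
        by (intro divide_nonneg_nonneg sum_nonneg) (auto intro: less_imp_le)
      thus "0 \<le> exp (U x / 2) * jump_ratio x" by simp
    qed (use lr_pos in auto)
    finally have J: "rate gU lr x v * (exp (U x / 2) * jump_ratio x - V (x, v)) \<le> exp (U x / 2) / sqrt lr * (norm (gU x) + lr)"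
      by (simp add: mult_ac)
    have "V (x, v) * (norm (gU x) / 2 + \<alpha> / (2 * lr) + lr / 2) \<le> exp (U x / 2) / sqrt lr * (norm (gU x) / 2 + \<alpha> / (2 * lr) + lr / 2)"
      using lr_pos \<alpha>_pos by (intro mult_right_mono V) auto
    moreover have "V (x, v) * (norm (gU x) / 2 + \<alpha> / (2 * lr) + lr / 2) =
        V (x, v) * (norm (gU x) / 2 + \<alpha> / (2 * lr)) + (lr / 2) * V (x, v)"
      by (simp add: distrib_left)
    moreover have "\<Phi> x = exp (U x / 2) / sqrt lr * (norm (gU x) / 2 + \<alpha> / (2 * lr) + lr / 2) +
        exp (U x / 2) / sqrt lr * (norm (gU x) + lr)"
      unfolding \<Phi>_def by (rule distrib_left)
    ultimately show ?thesis using D' J by linarith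
  qed
  have "D + rate gU lr x v * (exp (U x / 2) * jump_ratio x - V (x, v)) \<le> - (lr / 2) * V (x, v) + max 0 C"
    if v: "v \<in> Vset" and D: "drift_bound x v D" for x v D
  proof (cases "norm x \<ge> r0")
    case True
    from generator_far[OF this v D] show ?thesis by simp
  next
    case False
    with near[OF v D] C[of x] show ?thesis by simp
  qed
  thus ?thesis by (intro exI[of _ "max 0 C"]) auto
qed

section \<open>Integrating the drift inequality in time\<close>

lemma jump_ratio_continuous [continuous_intros]:
  assumes "continuous_on S f" shows "continuous_on S (\<lambda>z. jump_ratio (f z))"
  unfolding jump_ratio_def
  by (intro continuous_intros assms) (use total_rate_pos in \<open>auto simp: less_imp_neq[symmetric]\<close>)

lemma jump_ratio_nonneg: "jump_ratio x \<ge> 0"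
  unfolding jump_ratio_def using rate_pos total_rate_pos
  by (intro divide_nonneg_nonneg sum_nonneg) (auto intro: less_imp_le)

lemma jump_op_affine_V:
  assumes "a \<ge> 0" "b \<ge> 0"
  shows "jump_op (\<lambda>z. ennreal (a * V z + b)) (x, v) =
    ennreal (rate gU lr x v * (a * (exp (U x / 2) * jump_ratio x) + b))"
proof -
  let ?p = "\<lambda>w. rate gU lr x (- w) / total_rate gU lr x"
  have p: "(\<Sum>w\<in>Vset. ?p w) = 1"
    using total_rate_pos[of x] by (simp add: sum_divide_distrib[symmetric] sum_rate_uminus)
  have "jump_op (\<lambda>z. ennreal (a * V z + b)) (x, v) =
      (\<Sum>w\<in>Vset. ennreal (rate gU lr x v * (?p w * (a * V (x, w) + b))))"
    unfolding jump_op_def prod.case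
  proof (intro sum.cong refl)
    fix w
    have nn: "0 \<le> a * V (x, w) + b" using assms V_pos[of "(x, w)"] by simp
    show "ennreal (rate gU lr x v * rate gU lr x (- w) / total_rate gU lr x) * ennreal (a * V (x, w) + b) =
        ennreal (rate gU lr x v * (?p w * (a * V (x, w) + b)))"
      unfolding ennreal_mult''[OF nn, symmetric] by (simp add: mult_ac)
  qed
  also have "\<dots> = ennreal (\<Sum>w\<in>Vset. rate gU lr x v * (?p w * (a * V (x, w) + b)))"
    using assms V_pos rate_pos total_rate_pos
    by (intro sum_ennreal mult_nonneg_nonneg add_nonneg_nonneg divide_nonneg_nonneg) (auto intro: less_imp_le)
  also have "(\<Sum>w\<in>Vset. rate gU lr x v * (?p w * (a * V (x, w) + b))) =
      rate gU lr x v * (a * (\<Sum>w\<in>Vset. ?p w * V (x, w)) + b * (\<Sum>w\<in>Vset. ?p w))"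
  proof -
    have "(\<Sum>w\<in>Vset. r * (p w * (a * F w + b))) = r * (a * (\<Sum>w\<in>Vset. p w * F w) + b * (\<Sum>w\<in>Vset. p w))"
      for r and p F :: "real^'d \<Rightarrow> real"
      by (simp add: sum_distrib_left sum.distrib algebra_simps)
    thus ?thesis .
  qed
  finally show ?thesis unfolding jump_mean_V p mult_1_right .
qed

text \<open>For fixed state the bound solves \<open>w' = - c w + c C\<close> with
  \<open>c = lr / 2\<close>, and minimality applies once it is a supersolution of the renewal
  equation. The factor \<open>1 - exp (- (lr / 2) * t)\<close> at the constant is kept for the
  choice of the Harris level.\<close>

lemma PP_V_le:
  "\<exists>C\<ge>0. \<forall>t\<ge>0. \<forall>z. snd z \<in> Vset \<longrightarrow>
     PP t (\<lambda>z. ennreal (V z)) z \<le> ennreal (exp (- (lr / 2) * t) * V z + C * (1 - exp (- (lr / 2) * t)))"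
proof -
  define c where "c = lr / 2"
  have c: "c > 0" using lr_pos by (simp add: c_def)
  obtain C where C: "C \<ge> 0" "\<And>x v D. v \<in> Vset \<Longrightarrow> drift_bound x v D \<Longrightarrow>
    D + rate gU lr x v * (exp (U x / 2) * jump_ratio x - V (x, v)) \<le> - c * V (x, v) + C"
    using generator_bound unfolding c_def by blast
  define \<kappa> where "\<kappa> = C / c"
  have C_eq: "C = \<kappa> * c" and \<kappa>: "\<kappa> \<ge> 0" using c C(1) by (simp_all add: \<kappa>_def)
  define w where "w = (\<lambda>t z. exp (- c * t) * V z + \<kappa> * (1 - exp (- c * t)))"
  have coef: "exp (- c * t) \<ge> 0" "\<kappa> * (1 - exp (- c * t)) \<ge> 0" if "t \<ge> 0" for t
    using that c \<kappa> by auto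
  have super: "Q 0 t (\<lambda>z. ennreal (V z)) z +
      (\<integral>\<^sup>+ s. indicator {0..t} s * Q 0 s (jump_op (\<lambda>z. ennreal (w (t - s) z))) z \<partial>lborel) \<le> ennreal (w t z)"
    if t: "t \<ge> 0" and zv: "snd z \<in> Vset" for t z
  proof -
    obtain x v where z: "z = (x, v)" by (cases z)
    have v: "v \<in> Vset" using zv z by simp
    let ?y = "\<lambda>s. x + s *\<^sub>R v"
    let ?L = "cum_rate gU lr x v"
    let ?E = "\<lambda>s. exp (- c * (t - s))"
    define G where "G = (\<lambda>s. exp (- ?L s) * (rate gU lr (?y s) v *
        (?E s * (exp (U (?y s) / 2) * jump_ratio (?y s)) + \<kappa> * (1 - ?E s))))"
    have G_nonneg: "G s \<ge> 0" if "s \<in> {0..t}" for s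
    proof -
      have "0 \<le> \<kappa> * (1 - ?E s)" using that coef(2)[of "t - s"] by simp
      moreover have "0 \<le> ?E s * (exp (U (?y s) / 2) * jump_ratio (?y s))"
        using jump_ratio_nonneg[of "?y s"] by simp
      ultimately show ?thesis
        unfolding G_def using rate_pos[of "?y s" v]
        by (intro mult_nonneg_nonneg[OF _ mult_nonneg_nonneg[OF _ add_nonneg_nonneg]]) simp_all
    qed
    have L_cont: "continuous_on {0..t} ?L"
      using cum_rate_has_deriv[of _ t x v] by (intro DERIV_continuous_on) auto
    have G_cont: "continuous_on {0..t} G"
      unfolding G_def by (intro continuous_intros L_cont continuous_on_compose2[OF U_cont[of UNIV]]) auto
    have QG: "Q 0 s (jump_op (\<lambda>z. ennreal (w (t - s) z))) z = ennreal (G s)" if "s \<in> {0..t}" for s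
    proof -
      have "t - s \<ge> 0" using that by simp
      thus ?thesis unfolding w_def using coef[of "t - s"]
        by (subst Qk_0) (simp add: z jump_op_affine_V G_def ennreal_mult')
    qed
    \<comment> \<open>Interpolates along the free flight: \<open>\<psi> 0\<close> is
      \<open>w t z\<close> and \<open>\<psi> t\<close> is the left side of the renewal inequality;
      in between, events before \<open>s\<close> are integrated and \<open>w\<close> stands for what
      follows a flight without event. Its right derivative is the drift inequality times positive
      factors.\<close>
    define \<psi> where "\<psi> = (\<lambda>s. exp (- ?L s) * (?E s * V (?y s, v) + \<kappa> * (1 - ?E s)) + integral {0..s} G)"
    have "\<psi> t \<le> \<psi> 0"
    proof (rule right_derivative_nonpos_imp_le[OF t])
      have "continuous_on {0..t} (\<lambda>s. integral {0..s} G)"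
        by (intro indefinite_integral_continuous_1 integrable_continuous_real G_cont)
      thus "continuous_on {0..t} \<psi>"
        unfolding \<psi>_def by (intro continuous_intros L_cont continuous_on_compose2[OF V_continuous[of UNIV]]) auto
    next
      fix s assume s: "0 \<le> s" "s < t"
      obtain D where D: "((\<lambda>u. V (x + u *\<^sub>R v, v)) has_real_derivative D) (at s within {s..t})"
        "drift_bound (?y s) v D"
        using V_path_right_derivative[OF v] by blast
      have L': "(?L has_real_derivative rate gU lr (?y s) v) (at s within {s..t})"
        by (rule DERIV_subset[OF cum_rate_has_deriv[of s t]]) (use s in auto)
      have I': "((\<lambda>s. integral {0..s} G) has_real_derivative G s) (at s within {s..t})"
        by (rule DERIV_subset[OF integral_has_real_derivative[OF G_cont]]) (use s in auto)
      let ?e = "exp (- ?L s)" and ?r = "rate gU lr (?y s) v" and ?V = "V (?y s, v)"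
      have "(\<psi> has_real_derivative
          (?e * (- ?r)) * (?E s * ?V + \<kappa> * (1 - ?E s)) + ?e * ((?E s * c) * ?V + ?E s * D - \<kappa> * (?E s * c)) + G s)
          (at s within {s..t})"
        unfolding \<psi>_def by (auto intro!: derivative_eq_intros D(1) L' I' simp: algebra_simps)
      moreover have "(?e * (- ?r)) * (?E s * ?V + \<kappa> * (1 - ?E s)) + ?e * ((?E s * c) * ?V + ?E s * D - \<kappa> * (?E s * c)) + G s
         = ?e * ?E s * (D + ?r * (exp (U (?y s) / 2) * jump_ratio (?y s) - ?V) - (- c * ?V + C))"
      proof -
        have "(e * (- r)) * (E * W + \<kappa> * (1 - E)) + e * ((E * c) * W + E * D - \<kappa> * (E * c)) + e * (r * (E * J + \<kappa> * (1 - E))) =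
            e * E * (D + r * (J - W) - (- c * W + \<kappa> * c))" for e r E W J :: real
          by (simp add: algebra_simps)
        thus ?thesis unfolding G_def C_eq .
      qed
      moreover have "?e * ?E s * (D + ?r * (exp (U (?y s) / 2) * jump_ratio (?y s) - ?V) - (- c * ?V + C)) \<le> 0"
        using C(2)[OF v D(2)] by (intro mult_nonneg_nonpos) auto
      ultimately show "\<exists>D\<le>0. (\<psi> has_real_derivative D) (at s within {s..t})" by auto
    qed
    moreover have "\<psi> 0 = w t z" by (simp add: \<psi>_def w_def z)
    moreover have "\<psi> t = exp (- ?L t) * V (?y t, v) + integral {0..t} G" by (simp add: \<psi>_def)
    ultimately have le: "exp (- ?L t) * V (?y t, v) + integral {0..t} G \<le> w t z" by simp
    have "(\<integral>\<^sup>+ s. indicator {0..t} s * Q 0 s (jump_op (\<lambda>z. ennreal (w (t - s) z))) z \<partial>lborel) =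
        (\<integral>\<^sup>+ s. ennreal (G s) * indicator {0..t} s \<partial>lborel)"
      using QG by (intro nn_integral_cong) (auto simp: indicator_def)
    also have "\<dots> = ennreal (integral {0..t} G)"
      using G_nonneg by (intro nn_integral_has_integral_lebesgue' integrable_integral integrable_continuous_real G_cont) auto
    finally have int: "(\<integral>\<^sup>+ s. indicator {0..t} s * Q 0 s (jump_op (\<lambda>z. ennreal (w (t - s) z))) z \<partial>lborel) =
        ennreal (integral {0..t} G)" .
    have "Q 0 t (\<lambda>z. ennreal (V z)) z + ennreal (integral {0..t} G) =
        ennreal (exp (- ?L t) * V (?y t, v) + integral {0..t} G)"
      using V_pos[of "(?y t, v)"] G_nonneg
      by (subst ennreal_plus) (auto simp: Qk_0 z ennreal_mult less_imp_le
          intro!: integral_nonneg integrable_continuous_real G_cont)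
    also have "\<dots> \<le> ennreal (w t z)" using le by (rule ennreal_leI)
    finally show ?thesis using int by simp
  qed
  have "PP t (\<lambda>z. ennreal (V z)) z \<le> ennreal (exp (- c * t) * V z + \<kappa> * (1 - exp (- c * t)))"
    if "t \<ge> 0" "snd z \<in> Vset" for t z
    using PP_le_supersolution[OF _ that(2,1) super] by (simp add: w_def)
  thus ?thesis using \<kappa> unfolding c_def by (intro exI[of _ "\<kappa>"]) auto
qed

section \<open>Growth of the potential and bounded sublevel sets\<close>

lemma gU_lipschitz: "norm (gU x - gU y) \<le> \<alpha> * norm (x - y)"
  by (rule differentiable_bound[of UNIV gU "\<lambda>x h. H x *v h"])
     (auto intro!: onorm_bound H_bound hess less_imp_le[OF \<alpha>_pos])

text \<open>The mean value theorem with the Lipschitz bound on the gradient; this gives the constant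
  \<open>\<alpha>\<close> in place of the sharp \<open>\<alpha> / 2\<close>.\<close>

lemma U_increment:
  "U (x + h) - U x \<le> gU x \<bullet> h + \<alpha> * (norm h)\<^sup>2"
proof -
  have "\<exists>s. 0 < s \<and> s < 1 \<and> U (x + 1 *\<^sub>R h) - U (x + 0 *\<^sub>R h) = (1 - 0) * (gU (x + s *\<^sub>R h) \<bullet> h)"
    using U_path_deriv[of x h _ UNIV] by (intro MVT2) auto
  then obtain s where s: "0 < s" "s < 1" "U (x + h) - U x = gU (x + s *\<^sub>R h) \<bullet> h" by auto
  have "(gU (x + s *\<^sub>R h) - gU x) \<bullet> h \<le> norm (gU (x + s *\<^sub>R h) - gU x) * norm h"
    by (rule norm_cauchy_schwarz)
  also have "\<dots> \<le> (\<alpha> * (1 * norm h)) * norm h"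
  proof (intro mult_right_mono order_trans[OF gU_lipschitz] mult_left_mono)
    show "norm (x + s *\<^sub>R h - x) \<le> 1 * norm h"
      using s by (simp add: mult_left_le_one_le)
  qed (use \<alpha>_pos in auto)
  finally show ?thesis using s(3) by (simp add: inner_diff_left power2_eq_square algebra_simps)
qed

text \<open>The step \<open>- gU x / (2 \<alpha>)\<close> minimises the right side of
  \<open>U_increment\<close>. As \<open>U\<close> is nonnegative there, the squared norm of
  \<open>gU x\<close> is at most \<open>4 \<alpha> U x\<close>, and the arithmetic-geometric mean
  inequality finishes.\<close>

lemma norm_gU_le: "norm (gU x) \<le> \<alpha> + U x"
proof -
  define h where "h = (- 1 / (2 * \<alpha>)) *\<^sub>R gU x"
  have 1: "gU x \<bullet> h = - (norm (gU x))\<^sup>2 / (2 * \<alpha>)"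
    unfolding h_def power2_norm_eq_inner by simp
  have 2: "(norm h)\<^sup>2 = (norm (gU x))\<^sup>2 / (4 * \<alpha>\<^sup>2)"
  proof -
    have "norm h = norm (gU x) / (2 * \<alpha>)" using \<alpha>_pos by (simp add: h_def)
    thus ?thesis by (simp only: power_divide power_mult_distrib) simp
  qed
  have "0 - U x \<le> - (norm (gU x))\<^sup>2 / (2 * \<alpha>) + \<alpha> * ((norm (gU x))\<^sup>2 / (4 * \<alpha>\<^sup>2))"
    using U_increment[of x h] U_nonneg[of "x + h"] unfolding 1 2 by linarith
  also have "\<dots> = - ((norm (gU x))\<^sup>2 / (4 * \<alpha>))"
  proof -
    have "- n / (2 * a) + a * (n / (4 * a\<^sup>2)) = - (n / (4 * a))" if "a > 0" for n a :: real
      using that by (simp add: field_simps power2_eq_square)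
    thus ?thesis using \<alpha>_pos .
  qed
  finally have "(norm (gU x))\<^sup>2 / (4 * \<alpha>) \<le> U x" by simp
  hence "(norm (gU x))\<^sup>2 \<le> 4 * \<alpha> * U x"
    using \<alpha>_pos by (simp add: pos_divide_le_eq mult_ac)
  also have "\<dots> \<le> (\<alpha> + U x)\<^sup>2"
  proof -
    have "4 * a * u \<le> (a + u)\<^sup>2" for a u :: real
      using zero_le_power2[of "a - u"] by (simp add: power2_eq_square algebra_simps)
    thus ?thesis .
  qed
  finally show ?thesis using U_nonneg[of x] \<alpha>_pos by (intro power2_le_imp_le[of "norm (gU x)"]) auto
qed

text \<open>Where \<open>U\<close> is bounded so is its gradient, hence each point of a sublevel set carries a
  fixed amount of mass in its unit ball; integrability leaves no room for such points far away.\<close>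

lemma U_sublevel_bounded: "\<exists>r. \<forall>x. U x \<le> M \<longrightarrow> norm x \<le> r"
proof -
  \<comment> \<open>Bounds \<open>U\<close> on unit balls around points of the sublevel set: the
    value, the gradient term and the quadratic term of \<open>U_increment\<close>.\<close>
  define M' where "M' = M + (\<alpha> + M) + \<alpha>"
  have ball: "U y \<le> M'" if "U x \<le> M" "y \<in> ball x 1" for x y
  proof -
    have n: "norm (y - x) \<le> 1" using that by (simp add: dist_norm norm_minus_commute)
    have "gU x \<bullet> (y - x) \<le> norm (gU x) * norm (y - x)" by (rule norm_cauchy_schwarz)
    also have "\<dots> \<le> (\<alpha> + M) * 1"
      using n norm_gU_le[of x] that(1) U_nonneg[of x] \<alpha>_pos by (intro mult_mono) auto
    finally have "gU x \<bullet> (y - x) \<le> \<alpha> + M" by simp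
    moreover have "\<alpha> * (norm (y - x))\<^sup>2 \<le> \<alpha>"
      using n \<alpha>_pos by (simp add: power_le_one)
    ultimately show ?thesis using U_increment[of x "y - x"] that(1) by (simp add: M'_def)
  qed
  define f where "f = (\<lambda>(n::nat) y. indicator {y :: real^'d. norm y \<ge> real n} y * exp (- U y))"
  \<comment> \<open>A lower bound for the mass that such a unit ball carries under
    \<open>exp (- U)\<close>; for large \<open>n\<close> it exceeds the whole mass beyond radius
    \<open>n\<close>.\<close>
  define \<delta> where "\<delta> = exp (- M') * unit_ball_vol (real CARD('d))"
  have \<delta>: "\<delta> > 0" by (simp add: \<delta>_def)
  have fm [measurable]: "f n \<in> borel_measurable borel" for n unfolding f_def by measurable
  have "(\<lambda>n. \<integral>y. f n y \<partial>lborel) \<longlonglongrightarrow> (\<integral>y. 0 \<partial>(lborel :: (real^'d) measure))"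
  proof (rule integral_dominated_convergence[where w = "\<lambda>y. exp (- U y)"])
    show "AE y in lborel. (\<lambda>n. f n y) \<longlonglongrightarrow> 0"
    proof (rule AE_I2)
      fix y :: "real^'d"
      obtain N where "norm y < real N" using reals_Archimedean2 by blast
      hence "eventually (\<lambda>n. f n y = 0) sequentially"
        by (intro eventually_sequentiallyI[of N]) (auto simp: f_def indicator_def)
      thus "(\<lambda>n. f n y) \<longlonglongrightarrow> 0" by (rule tendsto_eventually)
    qed
  qed (use integrable_exp in \<open>auto simp: f_def indicator_def\<close>)
  hence "eventually (\<lambda>n. (\<integral>y. f n y \<partial>lborel) < \<delta>) sequentially"
    using \<delta> by (intro order_tendstoD(2)) auto
  then obtain n where n: "(\<integral>y. f n y \<partial>lborel) < \<delta>" by (auto simp: eventually_sequentially)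
  have f_int: "integrable lborel (f n)"
    by (rule Bochner_Integration.integrable_bound[OF integrable_exp]) (auto simp: f_def indicator_def)
  have "norm x \<le> real n + 1" if x: "U x \<le> M" for x
  proof (rule ccontr)
    assume far: "\<not> norm x \<le> real n + 1"
    have "\<delta> = (\<integral>y. exp (- M') * indicator (ball x 1) y \<partial>lborel)"
      by (simp add: \<delta>_def content_ball)
    also have "\<dots> \<le> (\<integral>y. f n y \<partial>lborel)"
    proof (intro integral_mono)
      show "integrable lborel (\<lambda>y. exp (- M') * indicator (ball x 1) y :: real)"
        using emeasure_lborel_ball_finite[of x 1] by (intro integrable_mult_right integrable_real_indicator) auto
      fix y
      have "norm y \<ge> real n" if "y \<in> ball x 1"
        using that far norm_triangle_ineq2[of x "x - y"] by (simp add: dist_norm)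
      thus "exp (- M') * indicator (ball x 1) y \<le> f n y"
        using ball[OF x, of y] by (auto simp: f_def indicator_def)
    qed (rule f_int)
    finally show False using n by simp
  qed
  thus ?thesis by blast
qed

lemma V_sublevel_bounded: "\<exists>r\<ge>0. \<forall>x v. v \<in> Vset \<longrightarrow> V (x, v) \<le> R \<longrightarrow> norm x \<le> r"
proof -
  \<comment> \<open>Since \<open>V^2\<close> is \<open>exp U\<close> over a rate of at most
    \<open>lr + \<alpha> + U\<close>, beyond this level \<open>V \<le> R\<close> would give
    \<open>exp U \<le> U^2 / 2\<close>.\<close>
  define M where "M = max 1 (2 * R\<^sup>2 * (lr + \<alpha> + 1))"
  have "U x \<le> M" if v: "v \<in> Vset" and le: "V (x, v) \<le> R" for x v
  proof (rule ccontr)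
    assume "\<not> U x \<le> M"
    hence u: "U x > 1" "U x > 2 * R\<^sup>2 * (lr + \<alpha> + 1)" by (auto simp: M_def)
    have "\<bar>gU x \<bullet> v\<bar> \<le> norm (gU x)"
      using Cauchy_Schwarz_ineq2[of "gU x" v] norm_Vset[OF v] by simp
    hence rate: "rate gU lr x (- v) \<le> lr + (\<alpha> + U x)"
      using norm_gU_le[of x] lr_pos U_nonneg[of x] \<alpha>_pos by (auto simp: rate_def inner_commute)
    have "exp (U x / 2) \<le> R * sqrt (rate gU lr x (- v))"
      using le rate_pos[of x "- v"] by (simp add: V_eq field_simps)
    hence "(exp (U x / 2))\<^sup>2 \<le> (R * sqrt (rate gU lr x (- v)))\<^sup>2"
      by (intro power_mono) auto
    hence "exp (U x) \<le> R\<^sup>2 * rate gU lr x (- v)"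
      using rate_pos[of x "- v"] by (simp add: power_mult_distrib exp_double[symmetric])
    also have "\<dots> \<le> R\<^sup>2 * (lr + (\<alpha> + U x))" using rate by (intro mult_left_mono) auto
    also have "\<dots> \<le> R\<^sup>2 * ((lr + \<alpha>) * U x + U x)"
      using u(1) lr_pos \<alpha>_pos mult_left_mono[of 1 "U x" "lr + \<alpha>"] by (intro mult_left_mono) auto
    also have "\<dots> = R\<^sup>2 * (lr + \<alpha> + 1) * U x" by (simp add: algebra_simps)
    also have "\<dots> \<le> (U x / 2) * U x" using u by (intro mult_right_mono) auto
    finally have "exp (U x) \<le> (U x)\<^sup>2 / 2" by (simp add: power2_eq_square)
    thus False using exp_lower_Taylor_quadratic[OF U_nonneg[of x]] u(1) by linarith
  qed
  moreover obtain r where "\<And>x. U x \<le> M \<Longrightarrow> norm x \<le> r" using U_sublevel_bounded by blast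
  ultimately show ?thesis by (intro exI[of _ "max 0 r"]) (auto simp: max.coboundedI2)
qed

lemma V_nonneg [simp]: "V z \<ge> 0"
  using V_pos[of z] by (rule less_imp_le)

section \<open>Geometric ergodicity\<close>

text \<open>Measurability in the state is inherited from \<open>PP\<close>, which makes iterates
  under the kernel legitimate test functions; agreement with the integral against \<open>K\<close>
  is shown on \<open>states\<close>.\<close>

definition PR :: "real \<Rightarrow> ('d state \<Rightarrow> real) \<Rightarrow> 'd state \<Rightarrow> real" where
  "PR t f z = enn2real (PP t (\<lambda>z. ennreal (f z)) z) - enn2real (PP t (\<lambda>z. ennreal (- f z)) z)"

lemma PR_measurable [measurable]:
  assumes [measurable]: "f \<in> borel_measurable borel" shows "PR t f \<in> borel_measurable borel"
proof -
  have [measurable]: "PP t (\<lambda>z. ennreal (f z)) \<in> borel_measurable borel"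
    "PP t (\<lambda>z. ennreal (- f z)) \<in> borel_measurable borel"
    by (intro PP_measurable; measurable)+
  show ?thesis unfolding PR_def by measurable
qed

definition states :: "'d state set" where "states = {z. snd z \<in> Vset}"

text \<open>Fixes one constant from \<open>PP_V_le\<close>, shared by all the estimates that
  follow.\<close>

definition drift_const :: real where
  "drift_const = (SOME C. C \<ge> 0 \<and> (\<forall>t\<ge>0. \<forall>z. snd z \<in> Vset \<longrightarrow>
     PP t (\<lambda>z. ennreal (V z)) z \<le> ennreal (exp (- (lr / 2) * t) * V z + C * (1 - exp (- (lr / 2) * t)))))"

lemma drift_const:
  shows drift_const_nonneg: "drift_const \<ge> 0"
    and PP_V_le_drift: "t \<ge> 0 \<Longrightarrow> z \<in> states \<Longrightarrow> PP t (\<lambda>z. ennreal (V z)) z \<le>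
      ennreal (exp (- (lr / 2) * t) * V z + drift_const * (1 - exp (- (lr / 2) * t)))"
proof -
  have "drift_const \<ge> 0 \<and> (\<forall>t\<ge>0. \<forall>z. snd z \<in> Vset \<longrightarrow>
     PP t (\<lambda>z. ennreal (V z)) z \<le> ennreal (exp (- (lr / 2) * t) * V z + drift_const * (1 - exp (- (lr / 2) * t))))"
    unfolding drift_const_def using PP_V_le by (rule someI_ex)
  thus "drift_const \<ge> 0" "t \<ge> 0 \<Longrightarrow> z \<in> states \<Longrightarrow> PP t (\<lambda>z. ennreal (V z)) z \<le>
      ennreal (exp (- (lr / 2) * t) * V z + drift_const * (1 - exp (- (lr / 2) * t)))"
    by (simp_all add: states_def del: split_paired_All)
qed

lemma drift_rhs_le:
  assumes "t \<ge> 0"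
  shows "exp (- (lr / 2) * t) * V z + drift_const * (1 - exp (- (lr / 2) * t)) \<le> V z + drift_const"
    "0 \<le> exp (- (lr / 2) * t) * V z + drift_const * (1 - exp (- (lr / 2) * t))"
proof -
  have e: "exp (- (lr / 2) * t) \<le> 1" "exp (- (lr / 2) * t) \<ge> 0" using assms lr_pos by auto
  have "exp (- (lr / 2) * t) * V z \<le> 1 * V z" using e V_pos[of z] by (intro mult_right_mono) auto
  moreover have "drift_const * (1 - exp (- (lr / 2) * t)) \<le> drift_const * 1"
    using e drift_const_nonneg by (intro mult_left_mono) auto
  ultimately show "exp (- (lr / 2) * t) * V z + drift_const * (1 - exp (- (lr / 2) * t)) \<le> V z + drift_const" by simp
  show "0 \<le> exp (- (lr / 2) * t) * V z + drift_const * (1 - exp (- (lr / 2) * t))"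
    using e V_pos[of z] drift_const_nonneg by (intro add_nonneg_nonneg mult_nonneg_nonneg) auto
qed

lemma PP_mono: "(\<And>z. f z \<le> g z) \<Longrightarrow> PP t f z \<le> PP t g z"
proof -
  assume le: "\<And>z. f z \<le> g z"
  have "Q n t f z \<le> Q n t g z" for n
  proof (induction n arbitrary: t z)
    case (Suc n)
    thus ?case unfolding Qk_Suc
      by (intro nn_integral_mono mult_left_mono Q0_mono jump_op_mono) auto
  qed (simp add: Qk_0 le mult_left_mono)
  thus ?thesis unfolding PP_def by (intro suminf_le) auto
qed

lemma K_V:
  assumes "t \<ge> 0" "z \<in> states"
  shows integrable_K_V: "integrable (K t z) V"
    and integral_K_V: "(\<integral>y. V y \<partial>K t z) \<le> exp (- (lr / 2) * t) * V z + drift_const * (1 - exp (- (lr / 2) * t))"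
proof -
  have nn: "(\<integral>\<^sup>+y. ennreal (V y) \<partial>K t z) \<le> ennreal (exp (- (lr / 2) * t) * V z + drift_const * (1 - exp (- (lr / 2) * t)))"
    using assms PP_V_le_drift[OF assms] by (subst nn_integral_K) (auto simp: states_def)
  show int: "integrable (K t z) V"
    using nn by (intro integrableI_nonneg) (auto intro: le_less_trans)
  show "(\<integral>y. V y \<partial>K t z) \<le> exp (- (lr / 2) * t) * V z + drift_const * (1 - exp (- (lr / 2) * t))"
    using nn nn_integral_eq_integral[OF int] drift_rhs_le(2)[OF assms(1), of z]
    by (simp add: ennreal_le_iff)
qed

lemma integrable_dominated:
  assumes "integrable \<mu> V" "AE y in \<mu>. y \<in> states" and [measurable_cong]: "sets \<mu> = sets borel"
    and [measurable]: "f \<in> borel_measurable borel" and f: "\<And>y. y \<in> states \<Longrightarrow> \<bar>f y\<bar> \<le> b * V y"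
  shows "integrable \<mu> f"
proof (rule Bochner_Integration.integrable_bound)
  show "integrable \<mu> (\<lambda>y. b * V y)" using assms(1) by simp
  show "AE y in \<mu>. norm (f y) \<le> norm (b * V y)"
    using assms(2) by eventually_elim (use f in force)
qed measurable

lemma AE_K_states: "t \<ge> 0 \<Longrightarrow> z \<in> states \<Longrightarrow> AE y in K t z. y \<in> states"
  using AE_K[of t z] by (simp add: states_def)

lemma PR_eq_integral:
  assumes "t \<ge> 0" "z \<in> states" and f: "f \<in> borel_measurable borel" "\<And>y. y \<in> states \<Longrightarrow> \<bar>f y\<bar> \<le> b * V y"
  shows "PR t f z = (\<integral>y. f y \<partial>K t z)"
proof -
  have "integrable (K t z) f"
    by (rule integrable_dominated[OF integrable_K_V[OF assms(1,2)] AE_K_states[OF assms(1,2)] sets_K f])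
  from real_lebesgue_integral_def[OF this] show ?thesis
    using assms(1,2) f(1) by (simp add: PR_def nn_integral_K states_def)
qed

section \<open>Domination by V and convergence to the invariant measure\<close>

context
  fixes c0 :: real
  assumes c0: "c0 > 0" and V_ge: "\<And>z. z \<in> states \<Longrightarrow> V z \<ge> c0"
begin

text \<open>As \<open>V \<ge> c0\<close>, the additive drift constant can be traded for a factor.
  The result bounds the semigroup in the \<open>V\<close>-norm uniformly in time.\<close>

definition growth :: real where "growth = 1 + drift_const / c0"

lemma V_add_const_le: "z \<in> states \<Longrightarrow> V z + drift_const \<le> growth * V z"
  using V_ge[of z] c0 mult_left_mono[of c0 "V z" "drift_const / c0"] drift_const_nonneg
  by (simp add: growth_def algebra_simps)

lemma PP_dominated:
  assumes "t \<ge> 0" "z \<in> states" "f \<in> borel_measurable borel" "\<And>y. y \<in> states \<Longrightarrow> f y \<le> b * V y" "b \<ge> 0"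
  shows "PP t (\<lambda>y. ennreal (f y)) z \<le> ennreal (b * growth * V z)"
proof -
  have int: "integrable (K t z) V" using assms by (intro integrable_K_V)
  have AE: "AE y in K t z. y \<in> states" using assms by (intro AE_K_states)
  have "PP t (\<lambda>y. ennreal (f y)) z = (\<integral>\<^sup>+y. ennreal (f y) \<partial>K t z)"
    using assms by (subst nn_integral_K) (auto simp: states_def)
  also have "\<dots> \<le> (\<integral>\<^sup>+y. ennreal (b * V y) \<partial>K t z)"
    by (intro nn_integral_mono_AE) (use AE in \<open>eventually_elim, use assms(4) in \<open>auto intro: ennreal_leI\<close>\<close>)
  also have "\<dots> = ennreal (\<integral>y. b * V y \<partial>K t z)"
    using int assms(5) by (intro nn_integral_eq_integral) auto
  also have "\<dots> \<le> ennreal (b * growth * V z)"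
  proof (intro ennreal_leI)
    have "(\<integral>y. V y \<partial>K t z) \<le> growth * V z"
      using integral_K_V[OF assms(1,2)] drift_rhs_le(1)[OF assms(1), of z] V_add_const_le[OF assms(2)] by linarith
    thus "(\<integral>y. b * V y \<partial>K t z) \<le> b * growth * V z"
      using assms(5) by (simp add: mult.assoc mult_left_mono)
  qed
  finally show ?thesis .
qed

lemma growth_pos: "growth > 0"
  using drift_const_nonneg c0 by (simp add: growth_def add_pos_nonneg)

text \<open>The measure \<open>\<mu>'\<close> stands for \<open>\<mu>\<close> transported by time
  \<open>t\<close>. With a law of the kernel as \<open>\<mu>\<close> this is the Chapman-Kolmogorov
  equation, with \<open>rho\<close> it is invariance. Positive and negative parts are treated
  separately because the assumption is an identity in \<open>ennreal\<close>.\<close>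

lemma integral_PR:
  assumes \<mu>: "integrable \<mu> V" "AE y in \<mu>. y \<in> states" and s [measurable_cong]: "sets \<mu> = sets borel"
    and inv: "\<And>g. g \<in> borel_measurable borel \<Longrightarrow> (\<integral>\<^sup>+y. g y \<partial>\<mu>') = (\<integral>\<^sup>+y. PP t g y \<partial>\<mu>)"
    and f: "f \<in> borel_measurable borel" "\<And>y. y \<in> states \<Longrightarrow> \<bar>f y\<bar> \<le> b * V y" and "b \<ge> 0" "t \<ge> 0"
    and int: "integrable \<mu>' f"
  shows "(\<integral>y. f y \<partial>\<mu>') = (\<integral>y. PR t f y \<partial>\<mu>)"
proof -
  have part: "integrable \<mu> (\<lambda>y. enn2real (PP t (\<lambda>z. ennreal (g z)) y)) \<and>
      enn2real (\<integral>\<^sup>+y. ennreal (g y) \<partial>\<mu>') = (\<integral>y. enn2real (PP t (\<lambda>z. ennreal (g z)) y) \<partial>\<mu>)"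
    if g [measurable]: "g \<in> borel_measurable borel" and le: "\<And>y. y \<in> states \<Longrightarrow> g y \<le> b * V y" for g
  proof -
    have [measurable]: "PP t (\<lambda>z. ennreal (g z)) \<in> borel_measurable borel" by (intro PP_measurable) measurable
    have fin: "PP t (\<lambda>z. ennreal (g z)) y \<le> ennreal (b * growth * V y)" if "y \<in> states" for y
      using PP_dominated[OF \<open>t \<ge> 0\<close> that g le \<open>b \<ge> 0\<close>] by simp
    have int: "integrable \<mu> (\<lambda>y. enn2real (PP t (\<lambda>z. ennreal (g z)) y))"
    proof (rule integrable_dominated[OF \<mu> s, where b = "b * growth"])
      fix y assume y: "y \<in> states"
      have "b * growth * V y \<ge> 0" using \<open>b \<ge> 0\<close> growth_pos V_pos[of y] by simp
      thus "\<bar>enn2real (PP t (\<lambda>z. ennreal (g z)) y)\<bar> \<le> b * growth * V y"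
        using enn2real_mono[OF fin[OF y]] by simp
    qed measurable
    have "(\<integral>\<^sup>+y. ennreal (g y) \<partial>\<mu>') = (\<integral>\<^sup>+y. PP t (\<lambda>z. ennreal (g z)) y \<partial>\<mu>)"
      by (intro inv) measurable
    also have "\<dots> = (\<integral>\<^sup>+y. ennreal (enn2real (PP t (\<lambda>z. ennreal (g z)) y)) \<partial>\<mu>)"
      by (intro nn_integral_cong_AE)
         (use \<mu>(2) in \<open>eventually_elim, use fin in \<open>auto simp: less_top[symmetric] intro!: ennreal_enn2real[symmetric] dest!: fin intro: le_less_trans\<close>\<close>)
    also have "\<dots> = ennreal (\<integral>y. enn2real (PP t (\<lambda>z. ennreal (g z)) y) \<partial>\<mu>)"
      using int by (intro nn_integral_eq_integral) auto
    finally show ?thesis using int by simp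
  qed
  have p: "f y \<le> b * V y" "- f y \<le> b * V y" if "y \<in> states" for y using f(2)[OF that] by auto
  have m: "(\<lambda>y. - f y) \<in> borel_measurable borel" using f(1) by simp
  show ?thesis
    unfolding real_lebesgue_integral_def[OF int] PR_def
    using part[OF f(1) p(1)] part[OF m p(2)] by simp
qed

lemma PR_bound:
  assumes "t \<ge> 0" "z \<in> states" "f \<in> borel_measurable borel" "\<And>y. y \<in> states \<Longrightarrow> \<bar>f y\<bar> \<le> b * V y" "b \<ge> 0"
  shows "\<bar>PR t f z\<bar> \<le> b * growth * V z"
proof -
  have p: "f y \<le> b * V y" "- f y \<le> b * V y" if "y \<in> states" for y using assms(4)[OF that] by auto
  have m: "(\<lambda>y. - f y) \<in> borel_measurable borel" using assms(3) by simp
  have "b * growth * V z \<ge> 0" using assms(5) growth_pos V_pos[of z] by simp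
  hence "enn2real (PP t (\<lambda>z. ennreal (f z)) z) \<le> b * growth * V z"
    "enn2real (PP t (\<lambda>z. ennreal (- f z)) z) \<le> b * growth * V z"
    using enn2real_mono[OF PP_dominated[OF assms(1,2,3) p(1) assms(5)]]
      enn2real_mono[OF PP_dominated[OF assms(1,2) m p(2) assms(5)]] by simp_all
  thus ?thesis unfolding PR_def
    using enn2real_nonneg[of "PP t (\<lambda>z. ennreal (f z)) z"] enn2real_nonneg[of "PP t (\<lambda>z. ennreal (- f z)) z"]
    by linarith
qed

lemma AE_rho_states: "AE y in rho. y \<in> states"
  using AE_rho by (simp add: states_def)

text \<open>Integrating the drift bound against \<open>rho\<close> directly could read
  \<open>\<infinity> \<le> \<infinity>\<close>. Truncating \<open>V\<close> at \<open>N\<close>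
  first makes the integrals finite; letting time tend to infinity leaves \<open>drift_const\<close>,
  and monotone convergence then releases \<open>N\<close>.\<close>

lemma integrable_rho_V: "integrable rho V"
proof -
  interpret rho: prob_space rho by (rule prob_space_rho)
  define c where "c = lr / 2"
  have c: "c > 0" using lr_pos by (simp add: c_def)
  have trunc: "(\<integral>\<^sup>+z. ennreal (min (V z) (real N)) \<partial>rho) \<le> ennreal drift_const" for N :: nat
  proof -
    define \<phi> where "\<phi> = (\<lambda>(n::nat) z. ennreal (min (exp (- c * real n) * V z + drift_const) (real N)))"
    have [measurable]: "\<phi> n \<in> borel_measurable borel" for n unfolding \<phi>_def by measurable
    have le: "(\<integral>\<^sup>+z. ennreal (min (V z) (real N)) \<partial>rho) \<le> (\<integral>\<^sup>+z. \<phi> n z \<partial>rho)" for n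
    proof -
      have "(\<integral>\<^sup>+z. ennreal (min (V z) (real N)) \<partial>rho) = (\<integral>\<^sup>+z. PP (real n) (\<lambda>z. ennreal (min (V z) (real N))) z \<partial>rho)"
        by (intro nn_integral_rho_PP[symmetric]) auto
      also have "\<dots> \<le> (\<integral>\<^sup>+z. \<phi> n z \<partial>rho)"
      proof (intro nn_integral_mono_AE)
        have "PP (real n) (\<lambda>z. ennreal (min (V z) (real N))) z \<le> \<phi> n z" if z: "z \<in> states" for z
        proof -
          have "PP (real n) (\<lambda>z. ennreal (min (V z) (real N))) z \<le> PP (real n) (\<lambda>z. ennreal (V z)) z"
            by (intro PP_mono ennreal_leI) auto
          also have "\<dots> \<le> ennreal (exp (- c * real n) * V z + drift_const)"
          proof (rule order_trans[OF PP_V_le_drift])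
            have "drift_const * (1 - exp (- c * real n)) \<le> drift_const * 1"
              using drift_const_nonneg by (intro mult_left_mono) auto
            thus "ennreal (exp (- (lr / 2) * real n) * V z + drift_const * (1 - exp (- (lr / 2) * real n))) \<le>
                ennreal (exp (- c * real n) * V z + drift_const)"
              unfolding c_def by (intro ennreal_leI) simp
          qed (use z in auto)
          finally have 1: "PP (real n) (\<lambda>z. ennreal (min (V z) (real N))) z \<le> ennreal (exp (- c * real n) * V z + drift_const)" .
          have "PP (real n) (\<lambda>z. ennreal (min (V z) (real N))) z \<le> PP (real n) (\<lambda>_. ennreal (real N)) z"
            by (intro PP_mono ennreal_leI) auto
          also have "\<dots> = (\<integral>\<^sup>+y. ennreal (real N) \<partial>K (real n) z)"
            using z by (subst nn_integral_K) (auto simp: states_def)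
          also have "\<dots> = ennreal (real N)"
            using prob_space.emeasure_space_1[OF prob_space_K[of "real n" z]] z by (simp add: states_def)
          finally have 2: "PP (real n) (\<lambda>z. ennreal (min (V z) (real N))) z \<le> ennreal (real N)" .
          show ?thesis unfolding \<phi>_def using 1 2 by (auto simp: min_def)
        qed
        thus "AE z in rho. PP (real n) (\<lambda>z. ennreal (min (V z) (real N))) z \<le> \<phi> n z"
          using AE_rho_states by (auto elim!: eventually_mono)
      qed
      finally show ?thesis .
    qed
    have "(\<lambda>n. \<integral>\<^sup>+z. \<phi> n z \<partial>rho) \<longlonglongrightarrow> (\<integral>\<^sup>+z. ennreal (min drift_const (real N)) \<partial>rho)"
    proof (rule nn_integral_dominated_convergence[where w = "\<lambda>_. ennreal (real N)"])
      show "AE z in rho. (\<lambda>n. \<phi> n z) \<longlonglongrightarrow> ennreal (min drift_const (real N))"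
      proof (rule AE_I2)
        fix z
        have "(\<lambda>n. exp (- c) ^ n) \<longlonglongrightarrow> 0" using c by (intro LIMSEQ_power_zero) auto
        hence "(\<lambda>n. exp (- c * real n)) \<longlonglongrightarrow> 0" by (simp add: exp_of_nat_mult[symmetric] mult.commute)
        hence "(\<lambda>n. min (exp (- c * real n) * V z + drift_const) (real N)) \<longlonglongrightarrow> min (0 * V z + drift_const) (real N)"
          by (intro tendsto_intros)
        thus "(\<lambda>n. \<phi> n z) \<longlonglongrightarrow> ennreal (min drift_const (real N))"
          unfolding \<phi>_def by (intro tendsto_ennrealI) simp
      qed
    qed (auto simp: \<phi>_def ennreal_mult_less_top rho.emeasure_space_1[simplified] intro!: ennreal_leI)
    moreover have "(\<integral>\<^sup>+z. ennreal (min drift_const (real N)) \<partial>rho) \<le> ennreal drift_const"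
      using rho.emeasure_space_1 by (simp add: ennreal_leI)
    ultimately show ?thesis using le by (meson LIMSEQ_le_const order_trans)
  qed
  have "(\<lambda>N. \<integral>\<^sup>+z. ennreal (min (V z) (real N)) \<partial>rho) \<longlonglongrightarrow> (\<integral>\<^sup>+z. ennreal (V z) \<partial>rho)"
  proof (rule nn_integral_LIMSEQ)
    show "incseq (\<lambda>N z. ennreal (min (V z) (real N)))"
      by (auto intro!: monoI le_funI ennreal_leI)
    fix z
    obtain N where "V z < real N" using reals_Archimedean2 by blast
    hence "eventually (\<lambda>N. ennreal (min (V z) (real N)) = ennreal (V z)) sequentially"
      by (intro eventually_sequentiallyI[of N]) (auto simp: min_def)
    thus "(\<lambda>N. ennreal (min (V z) (real N))) \<longlonglongrightarrow> ennreal (V z)" by (rule tendsto_eventually)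
  qed measurable
  hence "(\<integral>\<^sup>+z. ennreal (V z) \<partial>rho) \<le> ennreal drift_const"
    by (rule LIMSEQ_le_const2) (use trunc in auto)
  thus ?thesis by (intro integrableI_nonneg) (auto intro: le_less_trans)
qed

text \<open>By invariance the distance to \<open>rho\<close> is an average over \<open>y\<close> of
  differences between the starts \<open>z\<close> and \<open>y\<close>, and these contract by
  Harris' theorem once per time \<open>T\<close>.\<close>

lemma geometric_ergodicity:
  "\<exists>\<Gamma> \<gamma>. 0 < \<gamma> \<and> \<gamma> < 1 \<and> (\<forall>z\<in>states. \<forall>t\<ge>0. \<forall>f. f \<in> borel_measurable borel \<longrightarrow> (\<forall>y. \<bar>f y\<bar> < V y) \<longrightarrow>
     integrable (K t z) f \<and> integrable rho f \<and> (\<integral>y. f y \<partial>K t z) - (\<integral>y. f y \<partial>rho) \<le> V z * \<Gamma> * \<gamma> powr t)"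
proof -
  interpret rho: prob_space rho by (rule prob_space_rho)
  \<comment> \<open>Chosen before \<open>T\<close>, which depends on it through \<open>r\<close>.
    The drift constant at time \<open>T\<close> is \<open>drift_const * (1 - \<delta>)\<close>, so
    the condition on \<open>R\<close> holds for whatever \<open>\<delta>\<close> results.\<close>
  define R where "R = 2 * drift_const + 1"
  have Rpos: "R > 0" using drift_const_nonneg by (simp add: R_def)
  obtain r where r: "r \<ge> 0" "\<And>x v. v \<in> Vset \<Longrightarrow> V (x, v) \<le> R \<Longrightarrow> norm x \<le> r"
    using V_sublevel_bounded[of R] by blast
  obtain T \<epsilon> \<nu> where T: "T > 0" and \<epsilon>: "\<epsilon> > 0" and \<nu>: "sets \<nu> = sets (borel :: 'd state measure)"
    "emeasure \<nu> (space \<nu>) \<ge> ennreal \<epsilon>"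
    "\<And>x v A. norm x \<le> r \<Longrightarrow> v \<in> Vset \<Longrightarrow> A \<in> sets borel \<Longrightarrow> emeasure \<nu> A \<le> emeasure (K T (x, v)) A"
    using minorization[OF r(1)] by blast
  define \<delta> where "\<delta> = exp (- (lr / 2) * T)"
  have \<delta>: "0 \<le> \<delta>" "\<delta> < 1" using T lr_pos by (auto simp: \<delta>_def)
  have "\<exists>\<alpha> \<beta>. 0 < \<alpha> \<and> \<alpha> < 1 \<and> \<beta> > 0 \<and>
    (\<forall>f c. f \<in> borel_measurable \<nu> \<longrightarrow> c \<ge> 0 \<longrightarrow>
       (\<forall>y\<in>states. \<forall>y'\<in>states. \<bar>f y - f y'\<bar> \<le> c * (2 + \<beta> * V y + \<beta> * V y')) \<longrightarrow>
       (\<forall>z\<in>states. \<forall>z'\<in>states. \<bar>(\<integral>y. f y \<partial>K T z) - (\<integral>y. f y \<partial>K T z')\<bar> \<le> \<alpha> * c * (2 + \<beta> * V z + \<beta> * V z')))"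
  proof (rule Harris_contraction[where \<epsilon> = \<epsilon> and \<delta> = \<delta> and C = "drift_const * (1 - \<delta>)" and R = R])
    fix z assume z: "z \<in> states"
    show "prob_space (K T z)" "AE y in K T z. y \<in> states"
      using prob_space_K[of T z] AE_K_states[of T z] z T by (simp_all add: states_def)
    show "integrable (K T z) V" using z T by (intro integrable_K_V) auto
    show "(\<integral>y. V y \<partial>K T z) \<le> \<delta> * V z + drift_const * (1 - \<delta>)"
      unfolding \<delta>_def using z T by (intro integral_K_V) auto
    fix A assume "V z \<le> R" "A \<in> sets \<nu>"
    thus "emeasure \<nu> A \<le> emeasure (K T z) A"
      using r(2)[of "snd z" "fst z"] \<nu>(3)[of "fst z" "snd z" A] z by (simp add: states_def \<nu>(1))
  next
    show "R * (1 - \<delta>) > 2 * (drift_const * (1 - \<delta>))" using \<delta> by (simp add: R_def algebra_simps)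
  qed (use \<nu> \<epsilon> \<delta> Rpos drift_const_nonneg V_pos in \<open>auto intro: less_imp_le\<close>)
  moreover have "borel_measurable \<nu> = (borel_measurable borel :: ('d state \<Rightarrow> real) set)"
    by (rule measurable_cong_sets[OF \<nu>(1) refl])
  ultimately obtain \<alpha>' \<beta> where \<alpha>': "0 < \<alpha>'" "\<alpha>' < 1" and \<beta>: "\<beta> > 0" and raw:
    "\<forall>f c. f \<in> borel_measurable borel \<longrightarrow> c \<ge> 0 \<longrightarrow>
       (\<forall>y\<in>states. \<forall>y'\<in>states. \<bar>f y - f y'\<bar> \<le> c * (2 + \<beta> * V y + \<beta> * V y')) \<longrightarrow>
       (\<forall>z\<in>states. \<forall>z'\<in>states. \<bar>(\<integral>y. f y \<partial>K T z) - (\<integral>y. f y \<partial>K T z')\<bar> \<le> \<alpha>' * c * (2 + \<beta> * V z + \<beta> * V z'))"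
    by (elim exE conjE) (simp only:)
  have contract: "\<bar>(\<integral>y. f y \<partial>K T z) - (\<integral>y. f y \<partial>K T z')\<bar> \<le> \<alpha>' * c * (2 + \<beta> * V z + \<beta> * V z')"
    if "f \<in> borel_measurable borel" "c \<ge> 0"
      "\<And>y y'. y \<in> states \<Longrightarrow> y' \<in> states \<Longrightarrow> \<bar>f y - f y'\<bar> \<le> c * (2 + \<beta> * V y + \<beta> * V y')"
      "z \<in> states" "z' \<in> states" for f c z z'
    using raw that by blast
  \<comment> \<open>From \<open>\<bar>f\<bar> < V\<close>, the oscillation after any time is at most
    \<open>growth * (V y + V y')\<close>, which is \<open>c\<close> times the
    \<open>\<beta>\<close>-part of the Harris weight.\<close>
  define c where "c = growth / \<beta>"
  have c: "c > 0" using growth_pos \<beta> by (simp add: c_def)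
  define I where "I = (\<integral>y. V y \<partial>rho)"
  have I: "I \<ge> 0" unfolding I_def by (intro integral_nonneg_AE) auto
  \<comment> \<open>Here \<open>\<gamma>\<close> is \<open>\<alpha>'\<close> per unit of time. In
    \<open>\<Gamma>\<close> the division by \<open>\<alpha>'\<close> pays for rounding
    \<open>t / T\<close> down, and \<open>c0\<close> turns \<open>2 + \<beta> * I\<close> into a
    multiple of \<open>V z\<close>.\<close>
  define \<gamma> where "\<gamma> = \<alpha>' powr (1 / T)"
  define \<Gamma> where "\<Gamma> = c * ((2 + \<beta> * I) / c0 + \<beta>) / \<alpha>'"
  have \<gamma>: "0 < \<gamma>" "\<gamma> < 1" using \<alpha>' T powr_less_mono2[of "1 / T" \<alpha>' 1] by (auto simp: \<gamma>_def)
  have main: "integrable (K t z) f \<and> integrable rho f \<and> (\<integral>y. f y \<partial>K t z) - (\<integral>y. f y \<partial>rho) \<le> V z * \<Gamma> * \<gamma> powr t"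
    if z: "z \<in> states" and t: "t \<ge> 0" and f: "f \<in> borel_measurable borel" and fV: "\<And>y. \<bar>f y\<bar> < V y" for z t f
  proof -
    have dom: "\<bar>f y\<bar> \<le> 1 * V y" for y using fV[of y] by simp
    have f_K: "integrable (K t z) f" if "t \<ge> 0" "z \<in> states" for t z
      by (rule integrable_dominated[OF integrable_K_V[OF that] AE_K_states[OF that] sets_K f dom])
    have f_rho: "integrable rho f"
      by (rule integrable_dominated[OF integrable_rho_V AE_rho_states sets_rho f dom])
    \<comment> \<open>The remainder time \<open>s\<close> is run last, so it acts on
      \<open>f\<close> first and the induction peels off steps of length \<open>T\<close> at the
      start of the path.\<close>
    have osc: "\<bar>PR (real n * T + s) f y - PR (real n * T + s) f y'\<bar> \<le> \<alpha>' ^ n * c * (2 + \<beta> * V y + \<beta> * V y')"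
      if s: "s \<ge> 0" and y: "y \<in> states" "y' \<in> states" for n s y y'
      using y
    proof (induction n arbitrary: y y')
      case 0
      have b: "\<bar>PR s f u\<bar> \<le> growth * V u" if "u \<in> states" for u
        using PR_bound[OF s that f dom] by simp
      have "\<bar>PR s f y - PR s f y'\<bar> \<le> growth * V y + growth * V y'"
        using b[OF 0(1)] b[OF 0(2)] by linarith
      also have "\<dots> = c * (\<beta> * V y + \<beta> * V y')" using \<beta> by (simp add: c_def algebra_simps)
      also have "\<dots> \<le> c * (2 + \<beta> * V y + \<beta> * V y')" using c by (intro mult_left_mono) auto
      finally show ?case by simp
    next
      case (Suc n)
      let ?s = "real n * T + s"
      have s': "?s \<ge> 0" using s T by simp
      have step: "PR (real (Suc n) * T + s) f u = (\<integral>w. PR ?s f w \<partial>K T u)" if u: "u \<in> states" for u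
      proof -
        have "PR (T + ?s) f u = (\<integral>w. f w \<partial>K (T + ?s) u)"
          using T s' by (intro PR_eq_integral[where b=1] u f dom) auto
        also have "\<dots> = (\<integral>w. PR ?s f w \<partial>K T u)"
        proof (rule integral_PR[where b=1])
          show "integrable (K T u) V" using u T by (intro integrable_K_V) auto
          show "AE y in K T u. y \<in> states" using u T by (intro AE_K_states) auto
          show "integrable (K (T + ?s) u) f" using T s' u by (intro f_K) auto
          show "(\<integral>\<^sup>+y. g y \<partial>K (T + ?s) u) = (\<integral>\<^sup>+y. PP ?s g y \<partial>K T u)" if "g \<in> borel_measurable borel" for g
            using that T s' u by (simp add: nn_integral_K PP_measurable PP_add_time states_def)
        qed (use f dom s' in auto)
        finally show ?thesis by (simp add: algebra_simps)
      qed
      have "\<bar>(\<integral>w. PR ?s f w \<partial>K T y) - (\<integral>w. PR ?s f w \<partial>K T y')\<bar> \<le>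
          \<alpha>' * (\<alpha>' ^ n * c) * (2 + \<beta> * V y + \<beta> * V y')"
        using \<alpha>' c by (intro contract PR_measurable f Suc.IH Suc.prems) auto
      thus ?case using step[OF Suc.prems(1)] step[OF Suc.prems(2)] by (simp add: mult_ac)
    qed
    define n where "n = nat \<lfloor>t / T\<rfloor>"
    define s where "s = t - real n * T"
    have n: "real n \<le> t / T" "t / T < real n + 1"
      using t T by (auto simp: n_def)
    have s: "s \<ge> 0" using n(1) T by (simp add: s_def field_simps)
    have ts: "real n * T + s = t" by (simp add: s_def)
    have PR_rho: "(\<integral>y. f y \<partial>rho) = (\<integral>y. PR t f y \<partial>rho)"
      by (rule integral_PR[OF integrable_rho_V AE_rho_states sets_rho nn_integral_rho_PP[symmetric], where b=1])
         (use f dom t f_rho in auto)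
    have PR_int: "integrable rho (PR t f)"
      by (rule integrable_dominated[OF integrable_rho_V AE_rho_states sets_rho, where b = "1 * growth"])
         (use f PR_bound[OF t _ f dom] in auto)
    have "(\<integral>y. f y \<partial>K t z) - (\<integral>y. f y \<partial>rho) = PR t f z - (\<integral>y. PR t f y \<partial>rho)"
      using PR_eq_integral[OF t z f dom] PR_rho by simp
    also have "\<dots> = (\<integral>y. PR t f z - PR t f y \<partial>rho)"
      using PR_int by (simp add: rho.prob_space[simplified])
    also have "\<dots> \<le> (\<integral>y. \<alpha>' ^ n * c * (2 + \<beta> * V z + \<beta> * V y) \<partial>rho)"
    proof (rule integral_mono_AE)
      show "integrable rho (\<lambda>y. PR t f z - PR t f y)" using PR_int by auto
      show "integrable rho (\<lambda>y. \<alpha>' ^ n * c * (2 + \<beta> * V z + \<beta> * V y))"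
        using integrable_rho_V by auto
      show "AE y in rho. PR t f z - PR t f y \<le> \<alpha>' ^ n * c * (2 + \<beta> * V z + \<beta> * V y)"
        using AE_rho_states
      proof eventually_elim
        case (elim y)
        from osc[OF s z elim, of n] show ?case unfolding ts by linarith
      qed
    qed
    also have "\<dots> = \<alpha>' ^ n * (c * (2 + \<beta> * V z + \<beta> * I))"
      using integrable_rho_V by (simp add: rho.prob_space[simplified] I_def mult.assoc)
    also have "\<dots> \<le> (\<gamma> powr t / \<alpha>') * (c * (((2 + \<beta> * I) / c0 + \<beta>) * V z))"
    proof (intro mult_mono)
      have "\<alpha>' ^ n = \<alpha>' powr real n" using \<alpha>' by (simp add: powr_realpow)
      also have "\<dots> \<le> \<alpha>' powr (t / T - 1)" using \<alpha>' n by (intro powr_mono') auto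
      also have "\<dots> = \<gamma> powr t / \<alpha>'" using \<alpha>' by (simp add: \<gamma>_def powr_powr powr_diff)
      finally show "\<alpha>' ^ n \<le> \<gamma> powr t / \<alpha>'" .
      have "(2 + \<beta> * I) * 1 \<le> (2 + \<beta> * I) * (V z / c0)"
        using V_ge[OF z] c0 \<beta> I by (intro mult_left_mono) auto
      thus "2 + \<beta> * V z + \<beta> * I \<le> ((2 + \<beta> * I) / c0 + \<beta>) * V z" by (simp add: algebra_simps)
      show "0 \<le> 2 + \<beta> * V z + \<beta> * I" using \<beta> I V_pos[of z] by auto
      thus "0 \<le> c * (2 + \<beta> * V z + \<beta> * I)" using c by simp
    qed (use c \<alpha>' in auto)
    also have "\<dots> = V z * \<Gamma> * \<gamma> powr t" by (simp add: \<Gamma>_def)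
    finally show ?thesis using f_K[OF t z] f_rho by simp
  qed
  thus ?thesis using \<gamma> by blast
qed

lemma Vnorm_geometric_ergodicity:
  "\<exists>\<Gamma>::real. \<exists>\<gamma>::real. 0 < \<gamma> \<and> \<gamma> < 1 \<and>
     (\<forall>z. snd z \<in> Vset \<longrightarrow> (\<forall>t\<ge>0. Vnorm V (K t z) rho \<le> ereal (V z * \<Gamma> * \<gamma> powr t)))"
proof -
  from geometric_ergodicity obtain \<Gamma> \<gamma> where "0 < \<gamma>" "\<gamma> < 1" and
    *: "\<And>z t f. z \<in> states \<Longrightarrow> t \<ge> 0 \<Longrightarrow> f \<in> borel_measurable borel \<Longrightarrow> (\<And>y. \<bar>f y\<bar> < V y) \<Longrightarrow>
     integrable (K t z) f \<and> integrable rho f \<and> (\<integral>y. f y \<partial>K t z) - (\<integral>y. f y \<partial>rho) \<le> V z * \<Gamma> * \<gamma> powr t"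
    by blast
  show ?thesis
  proof (intro exI conjI allI impI)
    fix z :: "'d state" and t :: real assume "snd z \<in> Vset" "0 \<le> t"
    hence z: "z \<in> states" by (simp add: states_def)
    show "Vnorm V (K t z) rho \<le> ereal (V z * \<Gamma> * \<gamma> powr t)"
      unfolding Vnorm_def
    proof (rule SUP_least)
      \<comment> \<open>Integrability under both laws is part of the ergodicity statement, so the
        branch of \<open>Vnorm\<close> with value \<open>\<infinity>\<close> does not occur.\<close>
      fix f assume "f \<in> {f. f \<in> borel_measurable borel \<and> (\<forall>z. \<bar>f z\<bar> < V z)}"
      with *[OF z \<open>0 \<le> t\<close>, of f] show "(if integrable (K t z) f \<and> integrable rho f
          then ereal ((\<integral>z. f z \<partial>K t z) - (\<integral>z. f z \<partial>rho)) else \<infinity>) \<le> ereal (V z * \<Gamma> * \<gamma> powr t)"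
        by (simp del: split_paired_All)
    qed
  qed fact+
qed

end
end

section \<open>From the limit conditions to bounds outside a ball\<close>

lemma locally_lipschitz_imp_continuous:
  fixes f :: "'a::metric_space \<Rightarrow> real"
  assumes "\<And>x. \<exists>e>0. \<exists>L. L-lipschitz_on (ball x e) f"
  shows "continuous_on UNIV f"
proof (rule continuous_at_imp_continuous_on, rule ballI)
  fix x
  obtain e L where e: "e > 0" "L-lipschitz_on (ball x e) f" using assms by blast
  have "continuous_on (ball x e) f" by (rule lipschitz_on_continuous_on[OF e(2)])
  thus "isCont f x" using e(1) by (simp add: continuous_on_eq_continuous_at)
qed

lemma norm_matrix_vector_le_onorm:
  fixes A :: "real^'n^'m"
  shows "norm (A *v h) \<le> onorm (\<lambda>h. A *v h) * norm h"
  by (rule onorm[OF matrix_vector_mul_bounded_linear])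

text \<open>The sum of the absolute entries is continuous and dominates the operator norm.\<close>

lemma matrix_function_locally_bounded:
  fixes H :: "'a::euclidean_space \<Rightarrow> real^'n^'m"
  assumes "\<And>i j. continuous_on UNIV (\<lambda>x. H x $ i $ j)"
  shows "\<exists>B. \<forall>x h. norm x \<le> r \<longrightarrow> norm (H x *v h) \<le> B * norm h"
proof -
  define s where "s = (\<lambda>x. \<Sum>i\<in>UNIV. \<Sum>j\<in>UNIV. \<bar>H x $ i $ j\<bar>)"
  have "compact (s ` cball 0 r)"
    unfolding s_def by (intro compact_continuous_image continuous_intros continuous_on_subset[OF assms]) auto
  hence "bounded (s ` cball 0 r)" by (rule compact_imp_bounded)
  then obtain B where B: "\<And>y. y \<in> s ` cball 0 r \<Longrightarrow> norm y \<le> B" unfolding bounded_iff by blast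
  have "norm (H x *v h) \<le> B * norm h" if "norm x \<le> r" for x h
  proof -
    have "onorm (\<lambda>h. H x *v h) \<le> s x"
      unfolding s_def using onorm_le_matrix_component_sum[of "H x"] by simp
    also have "\<dots> \<le> B" using B[of "s x"] that by (auto simp: abs_le_iff)
    finally show ?thesis
      using norm_matrix_vector_le_onorm[of "H x" h] mult_right_mono[of _ B "norm h"] by fastforce
  qed
  thus ?thesis by blast
qed

theorem theorem4:
  fixes U :: "real^'d \<Rightarrow> real"
    and gU :: "real^'d \<Rightarrow> real^'d"
    and H :: "real^'d \<Rightarrow> real^'d^'d"
    and lr :: real
  assumes U_nonneg: "\<And>x. 0 \<le> U x"
    and grad: "\<And>x. (U has_derivative (\<lambda>h. gU x \<bullet> h)) (at x)"
    and hess: "\<And>x. (gU has_derivative (\<lambda>h. H x *v h)) (at x)"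
    and integrable_exp: "integrable lborel (\<lambda>x. exp (- U x))"
    and lr_pos: "lr > 0"
    and A1: "\<And>i j x. \<exists>e>0. \<exists>L. L-lipschitz_on (ball x e) (\<lambda>y. H y $ i $ j)"
    and A2: "integrable (pi_U U) (\<lambda>x. norm (gU x))"
    and A3: "Liminf at_infinity (\<lambda>x. if gU x = 0 then \<infinity>
               else ereal (exp (U x / 2) / sqrt (norm (gU x)))) > 0"
    and A4: "\<exists>c0>0. \<forall>x. \<forall>v\<in>Vset. Vfun U gU lr (x, v) \<ge> c0"
    and C: "(Liminf at_infinity (\<lambda>x. ereal (norm (gU x))) = \<infinity> \<and>
             (\<exists>\<alpha>1::real. Limsup at_infinity (\<lambda>x. ereal (onorm (\<lambda>h. H x *v h))) \<le> ereal \<alpha>1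
                       \<and> lr > sqrt (8 * \<alpha>1)))
          \<or> (\<exists>\<alpha>2::real. \<alpha>2 > 0 \<and>
               Liminf at_infinity (\<lambda>x. ereal (norm (gU x))) = ereal (2 * \<alpha>2) \<and>
               Limsup at_infinity (\<lambda>x. ereal (onorm (\<lambda>h. H x *v h))) = 0 \<and>
               lr < \<alpha>2 / (14 * real CARD('d)))"
  shows "\<exists>\<Gamma>::real. \<exists>\<gamma>::real. 0 < \<gamma> \<and> \<gamma> < 1 \<and>
           (\<forall>z. snd z \<in> Vset \<longrightarrow> (\<forall>t\<ge>0.
              Vnorm (Vfun U gU lr) (CS_kernel gU lr t z) (rho_U U)
                \<le> ereal (Vfun U gU lr z * \<Gamma> * \<gamma> powr t)))"
proof -
  let ?n = "real CARD('d)"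
  have far: "eventually (\<lambda>x. 27 * ?n * lr < norm (gU x) \<and> onorm (\<lambda>h. H x *v h) < lr\<^sup>2 / 4) at_infinity"
  proof -
    \<comment> \<open>Both alternatives yield such thresholds; \<open>b\<close> is an extended real
      because the lower limit is infinite in the first one.\<close>
    have "\<exists>a b. a < lr\<^sup>2 / 4 \<and> ereal (27 * ?n * lr) < b \<and>
        b \<le> Liminf at_infinity (\<lambda>x. ereal (norm (gU x))) \<and>
        Limsup at_infinity (\<lambda>x. ereal (onorm (\<lambda>h. H x *v h))) \<le> ereal a"
      using C
    proof (elim disjE conjE exE)
      fix \<alpha>1 :: real
      assume *: "Liminf at_infinity (\<lambda>x. ereal (norm (gU x))) = \<infinity>"
        "Limsup at_infinity (\<lambda>x. ereal (onorm (\<lambda>h. H x *v h))) \<le> ereal \<alpha>1" "sqrt (8 * \<alpha>1) < lr"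
      have "8 * \<alpha>1 < lr\<^sup>2"
      proof (rule ccontr)
        assume "\<not> 8 * \<alpha>1 < lr\<^sup>2"
        hence "lr \<le> sqrt (8 * \<alpha>1)" by (intro real_le_rsqrt) simp
        thus False using *(3) by simp
      qed
      moreover have "0 < lr\<^sup>2" using lr_pos by simp
      \<comment> \<open>The hypothesis gives the stronger
        \<open>\<alpha>1 < lr^2 / 8\<close>.\<close>
      ultimately have "\<alpha>1 < lr\<^sup>2 / 4" by linarith
      thus ?thesis using * by (intro exI[of _ \<alpha>1] exI[of _ \<infinity>]) auto
    next
      fix \<alpha>2 :: real
      assume *: "\<alpha>2 > 0" "Liminf at_infinity (\<lambda>x. ereal (norm (gU x))) = ereal (2 * \<alpha>2)"
        "Limsup at_infinity (\<lambda>x. ereal (onorm (\<lambda>h. H x *v h))) = 0" "lr < \<alpha>2 / (14 * ?n)"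
      have "lr * (14 * ?n) < \<alpha>2" using *(4) by (simp add: pos_less_divide_eq)
      moreover have "0 < lr * ?n" using lr_pos by simp
      \<comment> \<open>The hypothesis gives \<open>28 d lr < 2 \<alpha>2\<close>, a little more
        than the 27 that the drift uses.\<close>
      ultimately have "27 * ?n * lr < 2 * \<alpha>2" by (simp add: mult_ac)
      thus ?thesis using * lr_pos by (intro exI[of _ 0] exI[of _ "ereal (2 * \<alpha>2)"]) (auto simp: zero_ereal_def)
    qed
    then obtain a b where ab: "a < lr\<^sup>2 / 4" "ereal (27 * ?n * lr) < b"
        "b \<le> Liminf at_infinity (\<lambda>x. ereal (norm (gU x)))"
        "Limsup at_infinity (\<lambda>x. ereal (onorm (\<lambda>h. H x *v h))) \<le> ereal a" by blast
    have "eventually (\<lambda>x. ereal (27 * ?n * lr) < ereal (norm (gU x))) at_infinity"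
      using ab(2,3) unfolding le_Liminf_iff by blast
    moreover have "eventually (\<lambda>x. ereal (onorm (\<lambda>h. H x *v h)) < ereal (lr\<^sup>2 / 4)) at_infinity"
    proof -
      have "ereal a < ereal (lr\<^sup>2 / 4)" using ab(1) by simp
      thus ?thesis using ab(4) unfolding Limsup_le_iff by blast
    qed
    ultimately show ?thesis by eventually_elim simp
  qed
  then obtain r0 where r0: "\<And>x. norm x \<ge> r0 \<Longrightarrow> 27 * ?n * lr < norm (gU x)"
      "\<And>x. norm x \<ge> r0 \<Longrightarrow> onorm (\<lambda>h. H x *v h) < lr\<^sup>2 / 4"
    by (auto simp: eventually_at_infinity)
  have H_far: "norm (H x *v h) \<le> lr\<^sup>2 / 4 * norm h" if "norm x \<ge> r0" for x h
    using norm_matrix_vector_le_onorm[of "H x" h] r0(2)[OF that]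
      mult_right_mono[of "onorm (\<lambda>h. H x *v h)" "lr\<^sup>2 / 4" "norm h"] by simp
  have "continuous_on UNIV (\<lambda>x. H x $ i $ j)" for i j
    by (rule locally_lipschitz_imp_continuous[OF A1])
  then obtain B where B: "\<And>x h. norm x \<le> r0 \<Longrightarrow> norm (H x *v h) \<le> B * norm h"
    using matrix_function_locally_bounded[of H r0] by blast
  \<comment> \<open>Continuity of the Hessian covers the ball, the limit condition the rest; the
    \<open>1\<close> secures \<open>\<alpha> > 0\<close>.\<close>
  define \<alpha> where "\<alpha> = max 1 (max B (lr\<^sup>2 / 4))"
  have H_bound: "norm (H x *v h) \<le> \<alpha> * norm h" for x h
  proof (cases "norm x \<le> r0")
    case True
    have "norm (H x *v h) \<le> B * norm h" by (rule B[OF True])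
    also have "\<dots> \<le> \<alpha> * norm h" by (intro mult_right_mono) (auto simp: \<alpha>_def)
    finally show ?thesis .
  next
    case False
    hence "norm (H x *v h) \<le> lr\<^sup>2 / 4 * norm h" by (intro H_far) auto
    also have "\<dots> \<le> \<alpha> * norm h" by (intro mult_right_mono) (auto simp: \<alpha>_def)
    finally show ?thesis .
  qed
  have gU_cont: "continuous_on UNIV gU"
    using hess has_derivative_continuous by (blast intro: continuous_at_imp_continuous_on)
  interpret coordinate_sampler_drift gU lr U H \<alpha> r0
  proof
    fix x :: "real^'d" assume "r0 \<le> norm x"
    from r0(1)[OF this] show "27 * ?n * lr \<le> (\<Sum>i\<in>UNIV. \<bar>gU x $ i\<bar>)"
      using norm_le_l1_cart[of "gU x"] by linarith
  qed (use gU_cont lr_pos grad integrable_exp U_nonneg hess H_bound H_far in \<open>auto simp: \<alpha>_def\<close>)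
  obtain c0 where c0: "c0 > 0" "\<And>x v. v \<in> Vset \<Longrightarrow> Vfun U gU lr (x, v) \<ge> c0" using A4 by blast
  have "Vfun U gU lr z \<ge> c0" if "z \<in> states" for z
    using c0(2)[of "snd z" "fst z"] that by (simp add: states_def)
  from Vnorm_geometric_ergodicity[OF c0(1) this] show ?thesis .
qed

end
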